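(* Let $A$ be a commutative unital real algebra of finite dimension, let $1\le q\le n$ be integers, and let $a^j_m\in A$ ($1\le j\le n$, $1\le m\le q$) be such that the determinant $D_0=\det\big(a^j_m\big)_{1\le j,m\le q}\in A$ is invertible in $A$. For $1\le k\le n-q$ and $1\le m\le q$, let $D^k_m\in A$ be the determinant obtained from $D_0$ by deleting row $m$ and adding, as last row, the row $(a^{q+k}_1,\dots,a^{q+k}_q)$ (rows are indexed by the upper index $j$, columns by the lower index). Then the functions $f$ satisfying the Cauchy–Riemann equations $$\sum_{j=1}^n\frac{\partial f}{\partial x_j}\,a^j_m=0,\qquad m=1,\dots,q,$$ admit an integral representation if the following conditions (A) are satisfied: $$\sum_{m=1}^q D^l_m D^k_m+\delta^l_k\,D_0^2=0\qquad\text{for all }1\le k,l\le n-q,$$ where $\delta^l_k$ is the Kronecker symbol.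
   Context: The product of $A$ is bilinear over $\mathbb{R}$. $A$-valued functions are differentiated and integrated componentwise in a real basis of $A$. $\|\cdot\|$ is the Euclidean norm on $\mathbb{R}^n$, and $\widehat{dy_j}=dy_1\wedge\dots\wedge dy_{j-1}\wedge dy_{j+1}\wedge\dots\wedge dy_n$. The functions satisfying the equations are said to admit an integral representation (Cauchy formula) if there exist elements $b^i_m\in A$ ($1\le i\le n$, $1\le m\le q$) such that, setting $\varphi_m(x,y)=\sum_{i=1}^n b^i_m(y_i-x_i)$, for every bounded domain $D\subset\mathbb{R}^n$ with smooth boundary, every $C^1$ function $f:\overline D\to A$ satisfying the equations on $D$, and every $x\in D$, $$f(x)=\int_{\partial D} f(y)\sum_{m=1}^q\sum_{j=1}^n a^j_m\,\frac{\varphi_m(x,y)}{\|y-x\|^n}\,(-1)^{j-1}\,\widehat{dy_j},$$ where $\partial D$ carries the boundary orientation. *)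

theory Defs
  imports "HOL-Analysis.Analysis" "Jordan_Normal_Form.Determinant"
begin

no_notation Matrix.vec_index (infixl \<open>$\<close> 100)
no_notation Matrix.scalar_prod (infix \<open>\<bullet>\<close> 70)

text \<open>
  The coordinates of \<open>real ^ 'n\<close> are numbered \<open>1, \<dots>, CARD('n)\<close> along the order of the index type.
  This fixes the sign conventions and the standard orientation.
\<close>

definition coord :: "nat \<Rightarrow> 'n::{finite,wellorder}" where
  "coord j = sorted_list_of_set UNIV ! (j - 1)"

definition pdiff :: "nat \<Rightarrow> (real^'n::{finite,wellorder} \<Rightarrow> 'b::real_normed_vector) \<Rightarrow> real^'n::_ \<Rightarrow> 'b" where
  "pdiff j f x = frechet_derivative f (at x) (axis (coord j) 1)"

primrec C_diff :: "nat \<Rightarrow> (real^'n::{finite,wellorder} \<Rightarrow> real) \<Rightarrow> bool" where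
  "C_diff 0 g \<longleftrightarrow> continuous_on UNIV g"
| "C_diff (Suc k) g \<longleftrightarrow>
     (\<forall>x. g differentiable (at x)) \<and> (\<forall>j\<in>{1..CARD('n)}. C_diff k (pdiff j g))"

definition smooth :: "(real^'n::{finite,wellorder} \<Rightarrow> real) \<Rightarrow> bool" where
  "smooth g \<longleftrightarrow> (\<forall>k. C_diff k g)"

text \<open>
  \<open>C\<^sup>1\<close> on the closure of an open set: continuous on the closure, continuously differentiable
  inside, with a derivative that extends continuously to the closure.
\<close>

definition C1_on_closure ::
    "(real^'n::{finite,wellorder}) set \<Rightarrow> (real^'n::_ \<Rightarrow> 'b::real_normed_vector) \<Rightarrow> bool" where
  "C1_on_closure D f \<longleftrightarrow> continuous_on (closure D) f \<and>
     (\<exists>f'. (\<forall>x\<in>D. (f has_derivative f' x) (at x)) \<and> (\<forall>v. continuous_on (closure D) (\<lambda>x. f' x v)))"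

text \<open>
  Inside the open set \<open>U\<close>, the set \<open>D\<close> is the region on one side of the graph of a smooth function
  \<open>\<gamma>\<close> of the coordinates other than the \<open>i\<close>-th: below it if \<open>s = 1\<close>, above it if \<open>s = - 1\<close>. In either
  case \<open>s *\<^sub>R axis (coord i) 1\<close> points out of \<open>D\<close> along the graph.
\<close>

definition graph_patch ::
    "(real^'n::{finite,wellorder}) set \<Rightarrow> nat \<Rightarrow> real \<Rightarrow> (real^'n::_ \<Rightarrow> real) \<Rightarrow> (real^'n::_) set \<Rightarrow> bool" where
  "graph_patch D i s \<gamma> U \<longleftrightarrow>
     i \<in> {1..CARD('n)} \<and> s \<in> {1, - 1} \<and> open U \<and> smooth \<gamma> \<and>
     (\<forall>x t. \<gamma> (x + t *\<^sub>R axis (coord i) 1) = \<gamma> x) \<and>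
     D \<inter> U = {x\<in>U. s * (x $ coord i - \<gamma> x) < 0}"

definition smooth_boundary :: "(real^'n::{finite,wellorder}) set \<Rightarrow> bool" where
  "smooth_boundary D \<longleftrightarrow> (\<forall>p\<in>frontier D. \<exists>i s \<gamma> U. p \<in> U \<and> graph_patch D i s \<gamma> U)"

definition smooth_domain :: "(real^'n::{finite,wellorder}) set \<Rightarrow> bool" where
  "smooth_domain D \<longleftrightarrow> open D \<and> connected D \<and> D \<noteq> {} \<and> bounded D \<and> smooth_boundary D"

text \<open>
  An \<open>'a\<close>-valued differential form of degree \<open>p\<close> maps a point and a list of \<open>p\<close> tangent vectors to a
  value. \<open>dwedge [k\<^sub>1, \<dots>, k\<^sub>p]\<close> is \<open>dy\<^bsub>k\<^sub>1\<^esub> \<and> \<dots> \<and> dy\<^bsub>k\<^sub>p\<^esub>\<close>; for \<open>p = 0\<close> it is \<open>1\<close>.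
\<close>

type_synonym ('n, 'a) form = "real^'n \<Rightarrow> (real^'n) list \<Rightarrow> 'a"

definition dwedge :: "nat list \<Rightarrow> (real^'n::{finite,wellorder}) list \<Rightarrow> real" where
  "dwedge ks vs = Determinant.det (Matrix.mat (length ks) (length ks) (\<lambda>(r, c). vs ! c $ coord (ks ! r)))"

definition dhat :: "nat \<Rightarrow> (real^'n::{finite,wellorder}) list \<Rightarrow> real" where
  "dhat j = dwedge ([1..<j] @ [Suc j..<Suc CARD('n)])"

text \<open>
  The graph of \<open>\<gamma>\<close> over the \<open>i\<close>-th coordinate hyperplane is parametrised by \<open>graph_map i \<gamma> \<circ> hyper i\<close>.
  The parameters are the coordinates other than the \<open>i\<close>-th, so that for \<open>CARD('n) = 1\<close> the parameter
  space is a single point of mass one.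
\<close>

definition hyper :: "nat \<Rightarrow> ('n::{finite,wellorder} \<Rightarrow> real) \<Rightarrow> real^'n::_" where
  "hyper i u = (\<chi> l. if l = coord i then 0 else u l)"

definition graph_map :: "nat \<Rightarrow> (real^'n::{finite,wellorder} \<Rightarrow> real) \<Rightarrow> real^'n::_ \<Rightarrow> real^'n::_" where
  "graph_map i \<gamma> x = (\<chi> l. if l = coord i then \<gamma> x else x $ l)"

definition graph_tangents :: "nat \<Rightarrow> (real^'n::{finite,wellorder} \<Rightarrow> real) \<Rightarrow> real^'n::_ \<Rightarrow> (real^'n::_) list" where
  "graph_tangents i \<gamma> x = map (\<lambda>l. pdiff l (graph_map i \<gamma>) x) ([1..<i] @ [Suc i..<Suc CARD('n)])"

text \<open>
  Boundary orientation: a basis \<open>vs\<close> of a tangent space of the boundary is positive iff \<open>\<nu> # vs\<close> is a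
  positive basis of \<open>real ^ 'n\<close> for an outward pointing \<open>\<nu>\<close>.
\<close>

definition orientation_sign :: "real^'n::{finite,wellorder} \<Rightarrow> (real^'n::_) list \<Rightarrow> real" where
  "orientation_sign \<nu> vs = sgn (dwedge [1..<Suc CARD('n)] (\<nu> # vs))"

text \<open>The integrand, in graph parameters, of \<open>\<chi> \<omega>\<close> over the oriented graph.\<close>

definition patch_integrand ::
    "('n::{finite,wellorder}, 'a::real_vector) form \<Rightarrow>
     nat \<times> real \<times> (real^'n::_ \<Rightarrow> real) \<times> (real^'n::_) set \<times> (real^'n::_ \<Rightarrow> real) \<Rightarrow> ('n \<Rightarrow> real) \<Rightarrow> 'a" where
  "patch_integrand \<omega> = (\<lambda>(i, s, \<gamma>, U, \<rho>) u.
     let x = hyper i u; y = graph_map i \<gamma> x; vs = graph_tangents i \<gamma> x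
     in (\<rho> y * orientation_sign (s *\<^sub>R axis (coord i) 1) vs) *\<^sub>R \<omega> y vs)"

definition patch_measure ::
    "nat \<times> real \<times> (real^'n::{finite,wellorder} \<Rightarrow> real) \<times> (real^'n::_) set \<times> (real^'n::_ \<Rightarrow> real) \<Rightarrow>
     ('n \<Rightarrow> real) measure" where
  "patch_measure = (\<lambda>(i, s, \<gamma>, U, \<rho>). Pi\<^sub>M (UNIV - {coord i}) (\<lambda>_. lborel))"

text \<open>
  A finite cover of the boundary by graph patches, with a subordinate smooth partition of unity.
\<close>

definition boundary_atlas ::
    "(real^'n::{finite,wellorder}) set \<Rightarrow>
     (nat \<times> real \<times> (real^'n::_ \<Rightarrow> real) \<times> (real^'n::_) set \<times> (real^'n::_ \<Rightarrow> real)) list \<Rightarrow> bool" where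
  "boundary_atlas D ps \<longleftrightarrow>
     (\<forall>(i, s, \<gamma>, U, \<rho>)\<in>set ps. graph_patch D i s \<gamma> U \<and> smooth \<rho> \<and> (\<forall>y. 0 \<le> \<rho> y) \<and>
        closure {y. \<rho> y \<noteq> 0} \<subseteq> U) \<and>
     (\<exists>W. open W \<and> frontier D \<subseteq> W \<and> (\<forall>y\<in>W. (\<Sum>(i, s, \<gamma>, U, \<rho>)\<leftarrow>ps. \<rho> y) = 1))"

text \<open>
  The integral of a form of degree \<open>CARD('n) - 1\<close> over the boundary of \<open>D\<close> with its boundary
  orientation. As always for integrals of forms, the value does not depend on the atlas and the
  partition of unity; this independence is part of the notion.
\<close>

definition has_boundary_integral ::
    "('n::{finite,wellorder}, 'a::euclidean_space) form \<Rightarrow> 'a \<Rightarrow> (real^'n::_) set \<Rightarrow> bool"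
    (infixr \<open>has'_boundary'_integral\<close> 46) where
  "(\<omega> has_boundary_integral I) D \<longleftrightarrow>
     (\<exists>ps. boundary_atlas D ps) \<and>
     (\<forall>ps. boundary_atlas D ps \<longrightarrow>
        (\<forall>p\<in>set ps. integrable (patch_measure p) (patch_integrand \<omega> p)) \<and>
        (\<Sum>p\<leftarrow>ps. integral\<^sup>L (patch_measure p) (patch_integrand \<omega> p)) = I)"

text \<open>
  The algebra is a type \<open>'a\<close> of sort \<open>{comm_ring_1, real_algebra_1, euclidean_space}\<close>. The class
  \<open>euclidean_space\<close> provides finite dimension, a real basis and the topology; no compatibility of
  the norm with the product is assumed.
\<close>

definition CR_solution ::
    "nat \<Rightarrow> (nat \<Rightarrow> nat \<Rightarrow> 'a::{comm_ring_1, real_algebra_1, euclidean_space}) \<Rightarrow>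
     (real^'n::{finite,wellorder}) set \<Rightarrow> (real^'n::_ \<Rightarrow> 'a) \<Rightarrow> bool" where
  "CR_solution q a D f \<longleftrightarrow>
     (\<forall>x\<in>D. \<forall>m\<in>{1..q}. (\<Sum>j=1..CARD('n). pdiff j f x * a j m) = 0)"

definition phi ::
    "(nat \<Rightarrow> nat \<Rightarrow> 'a::{comm_ring_1, real_algebra_1, euclidean_space}) \<Rightarrow> nat \<Rightarrow>
     real^'n::{finite,wellorder} \<Rightarrow> real^'n::_ \<Rightarrow> 'a" where
  "phi b m x y = (\<Sum>i=1..CARD('n). (y $ coord i - x $ coord i) *\<^sub>R b i m)"

definition cauchy_form ::
    "nat \<Rightarrow> (nat \<Rightarrow> nat \<Rightarrow> 'a::{comm_ring_1, real_algebra_1, euclidean_space}) \<Rightarrow>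
     (nat \<Rightarrow> nat \<Rightarrow> 'a) \<Rightarrow> (real^'n::{finite,wellorder} \<Rightarrow> 'a) \<Rightarrow> real^'n::_ \<Rightarrow> ('n, 'a) form" where
  "cauchy_form q a b f x = (\<lambda>y vs.
     f y * (\<Sum>m=1..q. \<Sum>j=1..CARD('n).
       ((- 1) ^ (j - 1) * dhat j vs) *\<^sub>R (a j m * (phi b m x y /\<^sub>R norm (y - x) ^ CARD('n)))))"

definition admits_integral_representation ::
    "'n::{finite,wellorder} itself \<Rightarrow> nat \<Rightarrow>
     (nat \<Rightarrow> nat \<Rightarrow> 'a::{comm_ring_1, real_algebra_1, euclidean_space}) \<Rightarrow> bool" where
  "admits_integral_representation _ q a \<longleftrightarrow>
     (\<exists>b. \<forall>(D :: (real^'n::_) set) f. smooth_domain D \<longrightarrow> C1_on_closure D f \<longrightarrow> CR_solution q a D f \<longrightarrow>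
        (\<forall>x\<in>D. (cauchy_form q a b f x has_boundary_integral f x) D))"

text \<open>
  The determinant of the \<open>q \<times> q\<close> matrix whose rows are the rows of \<open>a\<close> listed in \<open>js\<close>
  (rows by the upper index, the first argument of \<open>a\<close>).
\<close>

definition det_rows :: "nat \<Rightarrow> (nat \<Rightarrow> nat \<Rightarrow> 'a::comm_ring_1) \<Rightarrow> nat list \<Rightarrow> 'a" where
  "det_rows q a js = Determinant.det (Matrix.mat q q (\<lambda>(r, c). a (js ! r) (Suc c)))"

definition D0 :: "nat \<Rightarrow> (nat \<Rightarrow> nat \<Rightarrow> 'a::comm_ring_1) \<Rightarrow> 'a" where
  "D0 q a = det_rows q a [1..<Suc q]"

definition Dkm :: "nat \<Rightarrow> (nat \<Rightarrow> nat \<Rightarrow> 'a::comm_ring_1) \<Rightarrow> nat \<Rightarrow> nat \<Rightarrow> 'a" where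
  "Dkm q a k m = det_rows q a ([1..<m] @ [Suc m..<Suc q] @ [q + k])"

end

theory Submission
  imports Defs
begin

text \<open>
  Write \<open>n\<close> for the dimension. The flux form \<open>\<Sum>\<^sub>j (-1)\<^bsup>j-1\<^esup> F\<^sub>j dy\<^sub>1 \<and> \<dots> \<and> dy\<^sub>n\<close> (with \<open>dy\<^sub>j\<close> left out)
  integrates over a boundary to the integral of the divergence of \<open>F\<close>. Here
  \<open>F\<^sub>j = f \<cdot> \<Sum>\<^sub>m a\<^sup>j\<^sub>m \<phi>\<^sub>m / \<parallel>y - x\<parallel>\<^sup>n\<close>. In \<open>div F\<close> the derivatives of \<open>f\<close> enter only through the
  Cauchy-Riemann expressions, because the algebra is commutative, and so they drop out. The remaining factor
  is the divergence of \<open>K\<^sub>j(z) / \<parallel>z\<parallel>\<^sup>n\<close> with \<open>K\<^sub>j(z) = \<Sum>\<^sub>i z\<^sub>i S\<^sub>i\<^sub>j\<close>, \<open>S\<^sub>i\<^sub>j = \<Sum>\<^sub>m a\<^sup>j\<^sub>m b\<^sup>i\<^sub>m\<close>. If the symmetric part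
  of \<open>S\<close> is a scalar multiple \<open>c\<close> of the identity, then \<open>K\<close> has the same divergence and the same radial
  component as \<open>c \<cdot> z\<close>, and \<open>z / \<parallel>z\<parallel>\<^sup>n\<close> is divergence free off the origin. The flux is then
  concentrated at \<open>x\<close>, and a suitable real constant \<open>c\<close> makes it equal to \<open>f x\<close>.

  The hypothesis on the minors is what allows the choice of \<open>b\<close>. Normalise the first \<open>q\<close> rows of \<open>a\<close> to the
  identity matrix; by Cramer's rule the remaining rows become a matrix \<open>C\<close> whose entries are
  \<open>\<plusminus> D\<^sup>k\<^sub>m / D\<^sub>0\<close>, and the hypothesis says \<open>C C\<^sup>T = - I\<close>. Then \<open>(I; C) (I; - C)\<^sup>T\<close> has symmetric part \<open>I\<close>, so \<open>b\<close>
  can be read off from \<open>(I; - C)\<close> (\<open>ex_conjugate_coefficients\<close>).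

  The singularity is removed by replacing \<open>1 / \<parallel>z\<parallel>\<^sup>n\<close> inside a small ball by a function that is linear in
  \<open>\<parallel>z\<parallel>\<^sup>2\<close> and matches to first order on the sphere (\<open>profile\<close>). The boundary values do not change, the
  field becomes \<open>C\<^sup>1\<close> on all of \<open>D\<close>, and its divergence is \<open>f\<close> times a nonnegative weight supported in the
  ball (\<open>cauchy_flux\<close>). The total mass of the weight does not depend on the radius, so shrinking the
  ball gives \<open>f x\<close> (\<open>cauchy_formula\<close>).

  The divergence theorem is proved for an arbitrary atlas and partition of unity. A patch turns into a
  problem on the whole region on one side of a graph; a shear flattens the graph, and there Fubini's theorem and the
  fundamental theorem of calculus on coordinate lines give the result (\<open>integral_graph_half_space\<close>). The part of
  the field that the partition of unity leaves over has compact support in \<open>D\<close> and contributes nothing.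
  The boundary integral also requires that an atlas exists, which needs smooth bump functions built from
  \<open>exp (- 1 / t)\<close> (\<open>ex_boundary_atlas\<close>).
\<close>

section \<open>Slicing Lebesgue measure along a coordinate\<close>

lemma measurable_vec_lambda_PiM:
  "vec_lambda \<in> borel_measurable (Pi\<^sub>M UNIV (\<lambda>_::'n::finite. lborel :: real measure))"
proof -
  have "(\<lambda>u::'n\<Rightarrow>real. vec_lambda u \<bullet> b) \<in> borel_measurable (Pi\<^sub>M UNIV (\<lambda>_. lborel))"
    if bB: "b \<in> Basis" for b :: "real^'n"
  proof -
    obtain i where b: "b = axis i 1" using bB by (auto simp: Basis_vec_def)
    have "(\<lambda>u::'n\<Rightarrow>real. vec_lambda u \<bullet> b) = (\<lambda>u. u i)" by (auto simp: b inner_axis)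
    then show ?thesis by simp
  qed
  then show ?thesis by (subst borel_measurable_euclidean_space) auto
qed

text \<open>
  The product measure that serves as parameter space of a patch is indexed by coordinates, whereas
  \<open>lborel\<close> is defined by the product over basis vectors. Both give a box its volume.
\<close>

lemma lborel_vec_eq_distr:
  "(lborel :: (real^'n::finite) measure) = distr (Pi\<^sub>M UNIV (\<lambda>_. lborel)) borel vec_lambda"
proof (rule lborel_eqI)
  interpret product_sigma_finite "\<lambda>_::'n. lborel::real measure" by standard
  fix l u :: "real^'n"
  assume lu: "\<And>b. b \<in> Basis \<Longrightarrow> l \<bullet> b \<le> u \<bullet> b"
  have lu': "l $ i \<le> u $ i" for i using lu[of "axis i 1"] by (simp add: inner_axis)
  have "emeasure (distr (Pi\<^sub>M UNIV (\<lambda>_. lborel)) borel vec_lambda) (box l u)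
     = emeasure (Pi\<^sub>M UNIV (\<lambda>_::'n. lborel)) (vec_lambda -` box l u \<inter> space (Pi\<^sub>M UNIV (\<lambda>_. lborel)))"
    by (rule emeasure_distr[OF measurable_vec_lambda_PiM]) simp
  also have "vec_lambda -` box l u \<inter> space (Pi\<^sub>M UNIV (\<lambda>_::'n. lborel::real measure)) = Pi\<^sub>E UNIV (\<lambda>i. {l $ i <..< u $ i})"
    by (auto simp: space_PiM PiE_def Pi_def mem_box_cart)
  also have "emeasure (Pi\<^sub>M UNIV (\<lambda>_::'n. lborel)) \<dots> = (\<Prod>i\<in>UNIV. emeasure lborel {l $ i <..< u $ i})"
    by (rule emeasure_PiM) auto
  also have "\<dots> = (\<Prod>i\<in>UNIV. ennreal (u $ i - l $ i))"
    using lu' by (auto intro!: prod.cong)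
  also have "\<dots> = ennreal (\<Prod>i\<in>UNIV. (u $ i - l $ i))"
    using lu' by (intro prod_ennreal) auto
  also have "(\<Prod>i\<in>UNIV. (u $ i - l $ i)) = (\<Prod>b\<in>Basis. (u - l) \<bullet> b)"
  proof -
    have B: "(Basis :: (real^'n) set) = range (\<lambda>i. axis i 1)" by (auto simp: Basis_vec_def)
    have inj: "inj (\<lambda>i::'n. axis i (1::real))" by (auto simp: inj_def axis_eq_axis)
    show ?thesis unfolding B by (subst prod.reindex[OF inj]) (simp add: inner_axis)
  qed
  finally show "emeasure (distr (Pi\<^sub>M UNIV (\<lambda>_. lborel)) borel vec_lambda) (box l u) = ennreal (\<Prod>b\<in>Basis. (u - l) \<bullet> b)" .
qed simp

lemma vec_lambda_fun_upd:
  "vec_lambda (u(coord i := t)) = hyper i u + t *\<^sub>R axis (coord i) 1"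
  by (simp add: Finite_Cartesian_Product.vec_eq_iff hyper_def axis_def)

abbreviation hyper_measure :: "nat \<Rightarrow> ('n::{finite,wellorder} \<Rightarrow> real) measure" where
  "hyper_measure i \<equiv> Pi\<^sub>M (UNIV - {coord i}) (\<lambda>_. lborel)"

lemma integral_slice:
  fixes F :: "real^'n::{finite,wellorder} \<Rightarrow> 'b::{banach,second_countable_topology}"
  assumes "integrable lborel F"
  shows "integral\<^sup>L lborel F =
    (\<integral>u. (\<integral>t. F (hyper i u + t *\<^sub>R axis (coord i) 1) \<partial>lborel) \<partial>hyper_measure i)"
proof -
  interpret product_sigma_finite "\<lambda>_::'n. lborel::real measure" by standard
  have int: "integrable (Pi\<^sub>M UNIV (\<lambda>_::'n. lborel)) (\<lambda>u. F (vec_lambda u))"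
    using assms by (subst (asm) lborel_vec_eq_distr) (rule integrable_distr[OF measurable_vec_lambda_PiM])
  have F: "F \<in> borel_measurable borel" using assms by auto
  have "integral\<^sup>L lborel F = integral\<^sup>L (Pi\<^sub>M UNIV (\<lambda>_::'n. lborel)) (\<lambda>u. F (vec_lambda u))"
    by (subst lborel_vec_eq_distr) (rule integral_distr[OF measurable_vec_lambda_PiM F])
  also have "\<dots> = integral\<^sup>L (Pi\<^sub>M (insert (coord i) (UNIV - {coord i})) (\<lambda>_::'n. lborel)) (\<lambda>u. F (vec_lambda u))"
    by (simp add: insert_absorb)
  also have "\<dots> = (\<integral>u. (\<integral>t. F (vec_lambda (u(coord i := t))) \<partial>lborel) \<partial>hyper_measure i)"
    using int by (intro product_integral_insert) (auto simp: insert_absorb)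
  finally show ?thesis by (simp add: vec_lambda_fun_upd)
qed

section \<open>The fundamental theorem of calculus on a line\<close>

lemma integral_Icc_derivative:
  fixes p :: "real \<Rightarrow> 'b::euclidean_space"
  assumes "a \<le> b" and p: "continuous_on {a..b} p" and p': "continuous_on {a..b} p'"
    and d: "\<And>t. t \<in> {a<..<b} \<Longrightarrow> (p has_vector_derivative p' t) (at t)"
  shows "(\<integral>t. indicator {a..b} t *\<^sub>R p' t \<partial>lborel) = p b - p a"
proof -
  have "set_integrable lborel {a..b} p'"
    unfolding set_integrable_def using borel_integrable_compact[OF _ p'] by simp
  then have "(\<integral>t. indicator {a..b} t *\<^sub>R p' t \<partial>lborel) = integral {a..b} p'"
    using set_borel_integral_eq_integral(2) unfolding set_lebesgue_integral_def by blast
  also have "\<dots> = p b - p a"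
    using fundamental_theorem_of_calculus_interior[OF \<open>a \<le> b\<close> p d] by (rule integral_unique)
  finally show ?thesis .
qed

lemma integral_line_eq_0:
  fixes p :: "real \<Rightarrow> 'b::euclidean_space"
  assumes d: "\<And>t. (p has_vector_derivative p' t) (at t)" and p': "continuous_on UNIV p'"
    and 0: "\<And>t. R \<le> \<bar>t\<bar> \<Longrightarrow> p t = 0 \<and> p' t = 0"
  shows "(\<integral>t. p' t \<partial>lborel) = 0"
proof -
  define R' where "R' = max R 1"
  have c: "continuous_on {- R'..R'} p"
    using d by (meson continuous_at_imp_continuous_on has_vector_derivative_continuous)
  have "p' t = indicator {- R'..R'} t *\<^sub>R p' t" for t
    using 0[of t] by (auto simp: R'_def indicator_def)
  then have "(\<integral>t. p' t \<partial>lborel) = (\<integral>t. indicator {- R'..R'} t *\<^sub>R p' t \<partial>lborel)" by presburger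
  also have "\<dots> = p R' - p (- R')"
    using d c continuous_on_subset[OF p'] by (intro integral_Icc_derivative) (auto simp: R'_def)
  also have "\<dots> = 0" using 0[of R'] 0[of "- R'"] by (auto simp: R'_def)
  finally show ?thesis .
qed

text \<open>
  Only the one-sided limit at \<open>0\<close> is available, because in the application \<open>p\<close> is differentiable inside
  the domain and merely continuous up to the boundary. The factor \<open>s\<close> is the sign of the outward direction
  at the end point \<open>0\<close>.
\<close>

lemma integral_half_line:
  fixes p :: "real \<Rightarrow> 'b::euclidean_space"
  assumes s: "s \<in> {1, - 1}"
    and p: "continuous_on {t. s * t \<le> 0} p" and p': "continuous_on {t. s * t \<le> 0} p'"
    and d: "\<And>t. s * t < 0 \<Longrightarrow> (p has_vector_derivative p' t) (at t)"
    and 0: "\<And>t. s * t \<le> 0 \<Longrightarrow> R \<le> \<bar>t\<bar> \<Longrightarrow> p t = 0 \<and> p' t = 0"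
  shows "(\<integral>t. indicator {t. s * t < 0} t *\<^sub>R p' t \<partial>lborel) = s *\<^sub>R p 0"
proof -
  define R' where "R' = max R 1"
  define a where "a = (if s = 1 then - R' else 0)"
  define b where "b = (if s = 1 then 0 else R')"
  have ab: "a \<le> b" "{a..b} \<subseteq> {t. s * t \<le> 0}" "{a<..<b} \<subseteq> {t. s * t < 0}"
    using s by (auto simp: a_def b_def R'_def)
  have ae: "AE t in lborel. indicator {t. s * t < 0} t *\<^sub>R p' t = indicator {a..b} t *\<^sub>R p' t"
  proof (rule AE_I')
    show "{0::real} \<in> null_sets lborel" by (simp add: null_sets_def)
    have "indicator {t. s * t < 0} t *\<^sub>R p' t = indicator {a..b} t *\<^sub>R p' t" if "t \<noteq> 0" for t
    proof (cases "s * t < 0")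
      case True
      then show ?thesis using 0[of t] s by (auto simp: a_def b_def R'_def indicator_def)
    next
      case False
      then show ?thesis using that s by (auto simp: a_def b_def R'_def indicator_def)
    qed
    then show "{t \<in> space lborel. indicator {t. s * t < 0} t *\<^sub>R p' t \<noteq> indicator {a..b} t *\<^sub>R p' t} \<subseteq> {0}"
      by auto
  qed
  have m2: "(\<lambda>t. indicator {a..b} t *\<^sub>R p' t) \<in> borel_measurable borel"
    using continuous_on_subset[OF p' ab(2)] by (intro borel_measurable_continuous_on_indicator) auto
  have m1: "(\<lambda>t. indicator {t. s * t < 0} t *\<^sub>R p' t) \<in> borel_measurable borel"
  proof (rule borel_measurable_continuous_on_indicator)
    show "continuous_on {t. s * t < 0} p'" by (rule continuous_on_subset[OF p']) auto
    have "open {t. s * t < 0}" by (intro open_Collect_less continuous_intros)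
    then show "{t. s * t < 0} \<in> sets borel" by simp
  qed
  have "(\<integral>t. indicator {t. s * t < 0} t *\<^sub>R p' t \<partial>lborel) = (\<integral>t. indicator {a..b} t *\<^sub>R p' t \<partial>lborel)"
    using ae m1 m2 by (intro integral_cong_AE) auto
  also have "\<dots> = p b - p a"
    using d ab continuous_on_subset[OF p ab(2)] continuous_on_subset[OF p' ab(2)]
    by (intro integral_Icc_derivative) auto
  also have "\<dots> = s *\<^sub>R p 0" using 0[of R'] 0[of "- R'"] s by (auto simp: a_def b_def R'_def)
  finally show ?thesis .
qed

section \<open>Coordinates and derivatives of smooth functions\<close>

lemma coord_bij: "bij_betw (coord :: nat \<Rightarrow> 'n) {1..CARD('n::{finite,wellorder})} UNIV"
proof -
  let ?xs = "sorted_list_of_set (UNIV :: 'n set)"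
  have b: "bij_betw ((!) ?xs) {..<length ?xs} (set ?xs)"
    by (rule bij_betw_nth) auto
  have "bij_betw (\<lambda>j::nat. j - 1) {1..CARD('n)} {..<CARD('n)}"
    by (rule bij_betw_byWitness[where f' = Suc]) auto
  from bij_betw_trans[OF this, of "(!) ?xs" "UNIV"] b
  have "bij_betw ((!) ?xs \<circ> (\<lambda>j. j - 1)) {1..CARD('n)} UNIV" by simp
  moreover have "(!) ?xs \<circ> (\<lambda>j. j - 1) = coord" by (auto simp: coord_def)
  ultimately show ?thesis by simp
qed

lemma coord_eq_iff:
  "j \<in> {1..CARD('n)} \<Longrightarrow> k \<in> {1..CARD('n)} \<Longrightarrow> (coord j :: 'n::{finite,wellorder}) = coord k \<longleftrightarrow> j = k"
  using bij_betw_imp_inj_on[OF coord_bij[where 'n='n]] by (rule inj_on_eq_iff)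

lemma vec_eq_sum_coord:
  "(v :: real^'n::{finite,wellorder}) = (\<Sum>j=1..CARD('n). (v $ coord j) *\<^sub>R axis (coord j) 1)"
proof -
  have "(\<Sum>j=1..CARD('n). (v $ coord j) *\<^sub>R axis (coord j :: 'n) (1::real)) = (\<Sum>l\<in>UNIV. (v $ l) *\<^sub>R axis l 1)"
    using sum.reindex_bij_betw[OF coord_bij, of "\<lambda>l. (v $ l) *\<^sub>R axis l (1::real)"] by simp
  also have "\<dots> = v"
    by (simp add: Finite_Cartesian_Product.vec_eq_iff axis_def if_distrib cong: if_cong)
  finally show ?thesis by simp
qed

lemma C_diff_continuous: "C_diff k g \<Longrightarrow> continuous_on UNIV g"
  by (cases k) (auto simp: continuous_on_eq_continuous_at differentiable_imp_continuous_within)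

lemma smooth_has_derivative: "smooth g \<Longrightarrow> (g has_derivative frechet_derivative g (at x)) (at x)"
  unfolding smooth_def using C_diff.simps(2)[of 0 g] frechet_derivative_works by blast

lemma smooth_continuous: "smooth g \<Longrightarrow> continuous_on A g"
  unfolding smooth_def using C_diff_continuous continuous_on_subset by blast

lemma linear_expand_coord:
  fixes L :: "real^'n::{finite,wellorder} \<Rightarrow> 'b::real_vector"
  assumes "linear L"
  shows "L v = (\<Sum>j=1..CARD('n). (v $ coord j) *\<^sub>R L (axis (coord j) 1))"
proof -
  have "L v = L (\<Sum>j=1..CARD('n). (v $ coord j) *\<^sub>R axis (coord j) 1)" using vec_eq_sum_coord[of v] by simp
  then show ?thesis by (simp add: linear_sum[OF assms] linear_cmul[OF assms])
qed

lemma smooth_continuous_derivative: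
  fixes g :: "real^'n::{finite,wellorder} \<Rightarrow> real"
  assumes "smooth g"
  shows "continuous_on A (\<lambda>x. frechet_derivative g (at x) v)"
proof -
  have lin: "linear (frechet_derivative g (at x))" for x
    using smooth_has_derivative[OF assms] has_derivative_linear by blast
  have c: "continuous_on A (pdiff j g)" if "j \<in> {1..CARD('n)}" for j
  proof -
    have "C_diff (Suc 0) g" using assms by (simp only: smooth_def)
    then show ?thesis using that by (auto intro: continuous_on_subset[OF _ subset_UNIV])
  qed
  have "(\<lambda>x. frechet_derivative g (at x) v) = (\<lambda>x. \<Sum>j=1..CARD('n). (v $ coord j) *\<^sub>R pdiff j g x)"
    by (rule ext, subst linear_expand_coord[OF lin]) (simp add: pdiff_def)
  moreover have "continuous_on A (\<lambda>x. \<Sum>j=1..CARD('n). (v $ coord j) *\<^sub>R pdiff j g x)"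
    by (intro continuous_intros c)
  ultimately show ?thesis by (simp only:)
qed

section \<open>Partial derivatives on half-spaces\<close>

lemma integrable_continuous_bounded_support:
  fixes F :: "'m::euclidean_space \<Rightarrow> 'b::euclidean_space"
  assumes C: "closed C" "continuous_on C F" and S: "S \<subseteq> C" "S \<in> sets borel"
    and B: "bounded B" "\<And>x. x \<in> S \<Longrightarrow> x \<notin> B \<Longrightarrow> F x = 0"
  shows "integrable lborel (\<lambda>x. indicator S x *\<^sub>R F x)"
proof -
  obtain R where R: "B \<subseteq> cball 0 R" using B(1) by (auto simp: bounded_iff subset_iff)
  have "set_integrable lborel (C \<inter> cball 0 R) F"
    unfolding set_integrable_def using C
    by (intro borel_integrable_compact) (auto intro: closed_Int_compact continuous_on_subset)
  moreover have "S \<inter> cball 0 R \<in> sets lborel" using S(2) by simp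
  ultimately have "set_integrable lborel (S \<inter> cball 0 R) F"
    using S(1) by (elim set_integrable_subset) blast+
  moreover have "indicator (S \<inter> cball 0 R) x *\<^sub>R F x = indicator S x *\<^sub>R F x" for x
  proof (cases "x \<in> S \<and> x \<notin> B")
    case True
    then show ?thesis using B(2)[of x] by simp
  next
    case False
    then show ?thesis using R by (auto simp: indicator_def)
  qed
  ultimately show ?thesis unfolding set_integrable_def by (simp only:)
qed

lemma has_vector_derivative_along_line:
  assumes "(P has_derivative P') (at (c + t *\<^sub>R e))"
  shows "((\<lambda>t. P (c + t *\<^sub>R e)) has_vector_derivative P' e) (at t)"
proof -
  have 1: "((\<lambda>t. c + t *\<^sub>R e) has_derivative (\<lambda>h. h *\<^sub>R e)) (at t)"
    by (auto intro!: derivative_eq_intros)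
  have "((\<lambda>t. P (c + t *\<^sub>R e)) has_derivative (\<lambda>h. P' (h *\<^sub>R e))) (at t)"
    by (rule has_derivative_compose[OF 1 assms])
  moreover have "P' (h *\<^sub>R e) = h *\<^sub>R P' e" for h
    using has_derivative_linear[OF assms] by (rule linear_cmul)
  ultimately show ?thesis by (simp add: has_vector_derivative_def)
qed

lemma hyper_nth [simp]:
  "hyper i u $ coord i = 0"
  "l \<noteq> coord i \<Longrightarrow> hyper i u $ l = u l"
  by (auto simp: hyper_def)

text \<open>
  The bound is uniform in the line, since the moving coordinate alone already forces the norm to be large.
\<close>

lemma outside_bounded_line:
  assumes "bounded B"
  shows "\<exists>R. \<forall>u t. R \<le> \<bar>t\<bar> \<longrightarrow> hyper i u + t *\<^sub>R axis (coord i) 1 \<notin> (B :: (real^'n::{finite,wellorder}) set)"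
proof -
  obtain R where R: "\<And>x. x \<in> B \<Longrightarrow> norm x \<le> R" using assms by (auto simp: bounded_iff)
  have "hyper i u + t *\<^sub>R axis (coord i) 1 \<notin> B" if "R + 1 \<le> \<bar>t\<bar>" for u t
  proof
    assume "hyper i u + t *\<^sub>R axis (coord i) 1 \<in> B"
    then have "norm (hyper i u + t *\<^sub>R axis (coord i) 1) \<le> R" by (rule R)
    moreover have "\<bar>(hyper i u + t *\<^sub>R axis (coord i) 1) $ coord i\<bar> \<le> norm (hyper i u + t *\<^sub>R axis (coord i) 1)"
      by (rule component_le_norm_cart)
    ultimately show False using that by simp
  qed
  then show ?thesis by blast
qed

text \<open>
  A region that is invariant in direction \<open>j\<close> consists of full lines in that direction, on each of which
  a compactly supported function has a derivative of integral zero.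
\<close>

lemma integral_partial_derivative_eq_0:
  fixes P :: "real^'n::{finite,wellorder} \<Rightarrow> 'b::euclidean_space"
  assumes inv: "\<And>x t. x + t *\<^sub>R axis (coord j) 1 \<in> S \<longleftrightarrow> x \<in> S"
    and d: "\<And>x. x \<in> S \<Longrightarrow> (P has_derivative P' x) (at x)"
    and c: "continuous_on S (\<lambda>x. P' x (axis (coord j) 1))"
    and int: "integrable lborel (\<lambda>x. indicator S x *\<^sub>R P' x (axis (coord j) 1))"
    and B: "bounded B" "\<And>x. x \<in> S \<Longrightarrow> x \<notin> B \<Longrightarrow> P x = 0 \<and> (\<forall>v. P' x v = 0)"
  shows "(\<integral>x. indicator S x *\<^sub>R P' x (axis (coord j) 1) \<partial>lborel) = 0"
proof -
  let ?e = "axis (coord j) 1 :: real^'n::_"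
  obtain R where R: "\<And>u t. R \<le> \<bar>t\<bar> \<Longrightarrow> hyper j u + t *\<^sub>R ?e \<notin> B" using outside_bounded_line[OF B(1), where i=j] by auto
  have "(\<integral>t. indicator S (hyper j u + t *\<^sub>R ?e) *\<^sub>R P' (hyper j u + t *\<^sub>R ?e) ?e \<partial>lborel) = 0" for u
  proof (cases "hyper j u \<in> S")
    case False
    then show ?thesis by (simp add: inv)
  next
    case True
    then have S: "hyper j u + t *\<^sub>R ?e \<in> S" for t by (simp add: inv)
    have "(\<integral>t. P' (hyper j u + t *\<^sub>R ?e) ?e \<partial>lborel) = 0"
    proof (rule integral_line_eq_0)
      show "((\<lambda>t. P (hyper j u + t *\<^sub>R ?e)) has_vector_derivative P' (hyper j u + t *\<^sub>R ?e) ?e) (at t)" for t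
        by (rule has_vector_derivative_along_line[OF d[OF S]])
      show "continuous_on UNIV (\<lambda>t. P' (hyper j u + t *\<^sub>R ?e) ?e)"
        by (rule continuous_on_compose2[OF c]) (auto intro!: continuous_intros simp: S)
      show "P (hyper j u + t *\<^sub>R ?e) = 0 \<and> P' (hyper j u + t *\<^sub>R ?e) ?e = 0" if "R \<le> \<bar>t\<bar>" for t
        using B(2)[OF S R[OF that]] by simp
    qed
    then show ?thesis by (simp add: S)
  qed
  then show ?thesis by (simp add: integral_slice[OF int, of j])
qed

text \<open>
  The factor \<open>\<psi>\<close> does not vary along the lines of integration. It will be a slope \<open>\<partial>\<^sub>j \<gamma>\<close> of the graph.
\<close>

lemma integral_half_space_normal:
  fixes P :: "real^'n::{finite,wellorder} \<Rightarrow> 'b::euclidean_space"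
  assumes s: "s \<in> {1, - 1}"
    and P: "continuous_on {x. s * x $ coord i \<le> 0} P"
    and P': "continuous_on {x. s * x $ coord i \<le> 0} (\<lambda>x. P' x (axis (coord i) 1))"
    and d: "\<And>x. s * x $ coord i < 0 \<Longrightarrow> (P has_derivative P' x) (at x)"
    and B: "bounded B" "\<And>x. s * x $ coord i \<le> 0 \<Longrightarrow> x \<notin> B \<Longrightarrow> P x = 0 \<and> (\<forall>v. P' x v = 0)"
    and \<psi>: "continuous_on UNIV \<psi>" "\<And>x t. \<psi> (x + t *\<^sub>R axis (coord i) 1) = \<psi> x"
  shows "(\<integral>x. indicator {x. s * x $ coord i < 0} x *\<^sub>R (\<psi> x *\<^sub>R P' x (axis (coord i) 1)) \<partial>lborel)
    = (\<integral>u. (s * \<psi> (hyper i u)) *\<^sub>R P (hyper i u) \<partial>hyper_measure i)"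
proof -
  let ?e = "axis (coord i) 1 :: real^'n::_"
  let ?l = "\<lambda>u t. hyper i u + t *\<^sub>R ?e"
  obtain R where R: "\<And>u t. R \<le> \<bar>t\<bar> \<Longrightarrow> ?l u t \<notin> B" using outside_bounded_line[OF B(1), where i=i] by auto
  have int: "integrable lborel (\<lambda>x. indicator {x. s * x $ coord i < 0} x *\<^sub>R (\<psi> x *\<^sub>R P' x ?e))"
  proof (rule integrable_continuous_bounded_support)
    show "closed {x. s * x $ coord i \<le> 0}" by (intro closed_Collect_le continuous_intros)
    show "continuous_on {x. s * x $ coord i \<le> 0} (\<lambda>x. \<psi> x *\<^sub>R P' x ?e)"
      by (intro continuous_intros P' continuous_on_subset[OF \<psi>(1)]) auto
    have "open {x::real^'n::_. s * x $ coord i < 0}" by (intro open_Collect_less continuous_intros)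
    then show "{x::real^'n::_. s * x $ coord i < 0} \<in> sets borel" by simp
    show "\<psi> x *\<^sub>R P' x ?e = 0" if "x \<in> {x. s * x $ coord i < 0}" "x \<notin> B" for x
      using B(2)[of x] that by simp
  qed (use B(1) in auto)
  have "(\<integral>t. indicator {x. s * x $ coord i < 0} (?l u t) *\<^sub>R (\<psi> (?l u t) *\<^sub>R P' (?l u t) ?e) \<partial>lborel)
     = (s * \<psi> (hyper i u)) *\<^sub>R P (hyper i u)" for u
  proof -
    have "(\<integral>t. indicator {t. s * t < 0} t *\<^sub>R P' (?l u t) ?e \<partial>lborel) = s *\<^sub>R P (?l u 0)"
    proof (rule integral_half_line[OF s])
      show "continuous_on {t. s * t \<le> 0} (\<lambda>t. P (?l u t))"
        by (rule continuous_on_compose2[OF P]) (auto intro!: continuous_intros)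
      show "continuous_on {t. s * t \<le> 0} (\<lambda>t. P' (?l u t) ?e)"
        by (rule continuous_on_compose2[OF P']) (auto intro!: continuous_intros)
      show "((\<lambda>t. P (?l u t)) has_vector_derivative P' (?l u t) ?e) (at t)" if "s * t < 0" for t
        by (rule has_vector_derivative_along_line[OF d]) (use that in simp)
      show "P (?l u t) = 0 \<and> P' (?l u t) ?e = 0" if "s * t \<le> 0" "R \<le> \<bar>t\<bar>" for t
        using B(2)[of "?l u t"] R[OF that(2)] that(1) by simp
    qed
    moreover have "(\<lambda>t. indicator {x. s * x $ coord i < 0} (?l u t) *\<^sub>R (\<psi> (?l u t) *\<^sub>R P' (?l u t) ?e))
      = (\<lambda>t. \<psi> (hyper i u) *\<^sub>R (indicator {t. s * t < 0} t *\<^sub>R P' (?l u t) ?e))"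
      by (simp add: \<psi>(2) indicator_def mult.commute)
    ultimately show ?thesis by (simp only: integral_scaleR_right) (simp add: mult.commute)
  qed
  then show ?thesis by (simp only: integral_slice[OF int, of i])
qed

text \<open>
  On each line in direction \<open>i\<close> the shear is a translation, so it preserves Lebesgue measure.
\<close>

lemma integral_shear:
  fixes F :: "real^'n::{finite,wellorder} \<Rightarrow> 'b::euclidean_space"
  assumes \<gamma>: "\<And>x t. \<gamma> (x + t *\<^sub>R axis (coord i) 1) = \<gamma> x"
    and F: "integrable lborel F" "integrable lborel (\<lambda>x. F (x + \<gamma> x *\<^sub>R axis (coord i) 1))"
  shows "(\<integral>x. F (x + \<gamma> x *\<^sub>R axis (coord i) 1) \<partial>lborel) = integral\<^sup>L lborel F"
proof -
  let ?e = "axis (coord i) 1 :: real^'n::_"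
  have "(\<integral>t. F (hyper i u + t *\<^sub>R ?e + \<gamma> (hyper i u + t *\<^sub>R ?e) *\<^sub>R ?e) \<partial>lborel)
     = (\<integral>t. F (hyper i u + t *\<^sub>R ?e) \<partial>lborel)" for u
  proof -
    have "(\<integral>t. F (hyper i u + t *\<^sub>R ?e) \<partial>lborel) = (\<integral>t. F (hyper i u + (\<gamma> (hyper i u) + t) *\<^sub>R ?e) \<partial>lborel)"
      using lborel_integral_real_affine[of 1 "\<lambda>t. F (hyper i u + t *\<^sub>R ?e)" "\<gamma> (hyper i u)"] by simp
    then show ?thesis by (simp add: \<gamma> scaleR_add_left add.assoc add.commute add.left_commute)
  qed
  then show ?thesis by (simp only: integral_slice[OF F(1), of i] integral_slice[OF F(2), of i])
qed

section \<open>Regions beside a graph\<close>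

lemma graph_map_eq: "graph_map i \<gamma> x = x + (\<gamma> x - x $ coord i) *\<^sub>R axis (coord i) 1"
  by (simp add: Finite_Cartesian_Product.vec_eq_iff graph_map_def axis_def)

lemma frechet_derivative_invariant:
  assumes \<gamma>: "smooth \<gamma>" "\<And>x t. \<gamma> (x + t *\<^sub>R e) = \<gamma> x"
  shows "frechet_derivative \<gamma> (at x) e = 0"
    and "frechet_derivative \<gamma> (at (x + t *\<^sub>R e)) = frechet_derivative \<gamma> (at x)"
proof -
  have "((\<lambda>t. \<gamma> (x + t *\<^sub>R e)) has_vector_derivative frechet_derivative \<gamma> (at x) e) (at 0)"
    by (rule has_vector_derivative_along_line) (simp add: smooth_has_derivative[OF \<gamma>(1)])
  moreover have "((\<lambda>t. \<gamma> (x + t *\<^sub>R e)) has_vector_derivative 0) (at 0)" by (simp add: \<gamma>(2))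
  ultimately show "frechet_derivative \<gamma> (at x) e = 0" by (rule vector_derivative_unique_at)
  have "((\<lambda>y. \<gamma> (y + t *\<^sub>R e)) has_derivative frechet_derivative \<gamma> (at (x + t *\<^sub>R e))) (at x)"
    by (rule has_derivative_compose[OF _ smooth_has_derivative[OF \<gamma>(1)]])
       (auto intro!: derivative_eq_intros)
  then have "(\<gamma> has_derivative frechet_derivative \<gamma> (at (x + t *\<^sub>R e))) (at x)" by (simp add: \<gamma>(2))
  then show "frechet_derivative \<gamma> (at (x + t *\<^sub>R e)) = frechet_derivative \<gamma> (at x)"
    by (rule frechet_derivative_at)
qed

text \<open>
  Let \<open>S\<close> be the shear that maps a half-space onto the region, and \<open>P = G \<circ> S\<close>. The chain rule gives
  \<open>(\<partial>\<^sub>j G) \<circ> S = \<partial>\<^sub>j P - \<partial>\<^sub>j \<gamma> \<cdot> \<partial>\<^sub>i P\<close> for \<open>j \<noteq> i\<close>. The first term integrates to zero along lines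
  parallel to the boundary hyperplane, the second one to its boundary values. The factor in the result is the \<open>j\<close>-th
  component of the outward normal \<open>s (e\<^sub>i - \<Sum>\<^sub>j \<partial>\<^sub>j \<gamma> e\<^sub>j)\<close>, whose length is the area element of the graph.
\<close>

lemma integral_graph_half_space:
  fixes G :: "real^'n::{finite,wellorder} \<Rightarrow> 'b::euclidean_space"
  assumes s: "s \<in> {1, - 1}"
    and \<gamma>: "smooth \<gamma>" "\<And>x t. \<gamma> (x + t *\<^sub>R axis (coord i) 1) = \<gamma> x"
    and G: "continuous_on {x. s * (x $ coord i - \<gamma> x) \<le> 0} G"
    and G': "\<And>v. continuous_on {x. s * (x $ coord i - \<gamma> x) \<le> 0} (\<lambda>x. G' x v)"
    and d: "\<And>x. s * (x $ coord i - \<gamma> x) < 0 \<Longrightarrow> (G has_derivative G' x) (at x)"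
    and B: "bounded B" "\<And>x. s * (x $ coord i - \<gamma> x) \<le> 0 \<Longrightarrow> x \<notin> B \<Longrightarrow> G x = 0 \<and> (\<forall>v. G' x v = 0)"
  shows "(\<integral>x. indicator {x. s * (x $ coord i - \<gamma> x) < 0} x *\<^sub>R G' x (axis (coord j) 1) \<partial>lborel)
    = (\<integral>u. (if coord j = (coord i :: 'n) then s else - s * pdiff j \<gamma> (hyper i u))
         *\<^sub>R G (graph_map i \<gamma> (hyper i u)) \<partial>hyper_measure i)"
proof -
  let ?e = "axis (coord i) 1 :: real^'n::_" and ?f = "axis (coord j) 1 :: real^'n::_"
  define D\<gamma> where "D\<gamma> x = frechet_derivative \<gamma> (at x)" for x
  define S where "S x = x + \<gamma> x *\<^sub>R ?e" for x
  define P where "P x = G (S x)" for x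
  define P' where "P' x v = G' (S x) v + D\<gamma> x v *\<^sub>R G' (S x) ?e" for x v
  define C where "C = {x. s * (x $ coord i - \<gamma> x) \<le> 0}"
  define Om where "Om = {x. s * (x $ coord i - \<gamma> x) < 0}"
  define H where "H = {x::real^'n::_. s * x $ coord i < 0}"
  have D\<gamma>: "(\<gamma> has_derivative D\<gamma> x) (at x)" for x
    unfolding D\<gamma>_def by (rule smooth_has_derivative[OF \<gamma>(1)])
  have cD\<gamma>: "continuous_on A (\<lambda>x. D\<gamma> x v)" for A v
    unfolding D\<gamma>_def by (rule smooth_continuous_derivative[OF \<gamma>(1)])
  have D\<gamma>e: "D\<gamma> x ?e = 0" "D\<gamma> (x + t *\<^sub>R ?e) = D\<gamma> x" for x t
    unfolding D\<gamma>_def using frechet_derivative_invariant[OF \<gamma>] by auto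
  have c\<gamma>: "continuous_on A \<gamma>" for A by (rule smooth_continuous[OF \<gamma>(1)])
  have cS: "continuous_on A S" for A unfolding S_def by (intro continuous_intros c\<gamma>)
  have S: "S x $ coord i - \<gamma> (S x) = x $ coord i" for x by (simp add: S_def \<gamma>(2))
  have Om: "open Om" unfolding Om_def by (intro open_Collect_less continuous_intros c\<gamma>)
  have C: "closed C" unfolding C_def by (intro closed_Collect_le continuous_intros c\<gamma>)
  have H: "open H" unfolding H_def by (intro open_Collect_less continuous_intros)
  have Hc: "closed {x::real^'n::_. s * x $ coord i \<le> 0}" by (intro closed_Collect_le continuous_intros)
  have indS: "indicator Om (S x) = (indicator H x :: real)" for x
    by (simp add: indicator_def Om_def H_def S)
  define B' where "B' = S -` B"
  have B': "bounded B'"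
  proof -
    obtain R where R: "B \<subseteq> cball 0 R" using B(1) by (auto simp: bounded_iff subset_iff)
    define T where "T y = y - \<gamma> y *\<^sub>R ?e" for y
    have "compact (T ` cball 0 R)"
      unfolding T_def by (intro compact_continuous_image continuous_intros c\<gamma>) auto
    moreover have TS: "T (S x) = x" for x by (simp add: T_def S_def \<gamma>(2))
    have "B' \<subseteq> T ` cball 0 R"
    proof
      fix x assume "x \<in> B'"
      then have "S x \<in> cball 0 R" using R by (auto simp: B'_def)
      with TS[of x, symmetric] show "x \<in> T ` cball 0 R" by (rule image_eqI)
    qed
    ultimately show ?thesis by (meson bounded_subset compact_imp_bounded)
  qed
  have zero: "P x = 0" "P' x v = 0" "G' (S x) v = 0" if "s * x $ coord i \<le> 0" "x \<notin> B'" for x v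
    using B(2)[of "S x"] that by (auto simp: S P_def P'_def B'_def)
  have cP: "continuous_on {x. s * x $ coord i \<le> 0} P" unfolding P_def
    by (rule continuous_on_compose2[OF G cS]) (auto simp: S)
  have cG'S: "continuous_on {x. s * x $ coord i \<le> 0} (\<lambda>x. G' (S x) v)" for v
    by (rule continuous_on_compose2[OF G' cS]) (auto simp: S)
  have cP': "continuous_on {x. s * x $ coord i \<le> 0} (\<lambda>x. P' x v)" for v
    unfolding P'_def by (intro continuous_intros cG'S cD\<gamma>)
  have dP: "(P has_derivative P' x) (at x)" if "s * x $ coord i < 0" for x
  proof -
    have dG: "(G has_derivative G' (S x)) (at (S x))" using d[of "S x"] that by (simp add: S)
    have dS: "(S has_derivative (\<lambda>v. v + D\<gamma> x v *\<^sub>R ?e)) (at x)"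
      unfolding S_def by (intro derivative_intros D\<gamma>)
    have "(P has_derivative (\<lambda>v. G' (S x) (v + D\<gamma> x v *\<^sub>R ?e))) (at x)"
      unfolding P_def by (rule has_derivative_compose[OF dS dG])
    moreover have "(\<lambda>v. G' (S x) (v + D\<gamma> x v *\<^sub>R ?e)) = P' x"
      using has_derivative_linear[OF dG] by (auto simp: P'_def linear_add linear_cmul)
    ultimately show ?thesis by simp
  qed
  have int1: "integrable lborel (\<lambda>x. indicator Om x *\<^sub>R G' x ?f)"
  proof (rule integrable_continuous_bounded_support[OF C])
    show "G' x ?f = 0" if "x \<in> Om" "x \<notin> B" for x using B(2)[of x] that by (auto simp: Om_def)
  qed (use G' Om B(1) in \<open>auto simp: C_def Om_def\<close>)
  have intH: "integrable lborel (\<lambda>x. indicator H x *\<^sub>R F x)"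
    if "continuous_on {x. s * x $ coord i \<le> 0} F" "\<And>x. s * x $ coord i \<le> 0 \<Longrightarrow> x \<notin> B' \<Longrightarrow> F x = 0" for F :: "_ \<Rightarrow> 'b"
    by (rule integrable_continuous_bounded_support[OF Hc that(1) _ _ B']) (use H that(2) in \<open>auto simp: H_def\<close>)
  have int2: "integrable lborel (\<lambda>x. indicator Om (S x) *\<^sub>R G' (S x) ?f)"
    unfolding indS by (rule intH) (use cG'S zero in auto)
  have "(\<integral>x. indicator Om x *\<^sub>R G' x ?f \<partial>lborel) = (\<integral>x. indicator Om (S x) *\<^sub>R G' (S x) ?f \<partial>lborel)"
    using integral_shear[OF \<gamma>(2) int1] int2 unfolding S_def by simp
  also have "\<dots> = (\<integral>x. indicator H x *\<^sub>R G' (S x) ?f \<partial>lborel)" by (simp only: indS)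
  also have "\<dots> = (\<integral>u. (if coord j = (coord i :: 'n) then s else - s * pdiff j \<gamma> (hyper i u))
         *\<^sub>R P (hyper i u) \<partial>hyper_measure i)"
  proof (cases "coord j = (coord i :: 'n)")
    case True
    have "(\<integral>x. indicator H x *\<^sub>R G' (S x) ?f \<partial>lborel) = (\<integral>x. indicator H x *\<^sub>R (1 *\<^sub>R P' x ?e) \<partial>lborel)"
      by (simp add: True P'_def D\<gamma>e)
    also have "\<dots> = (\<integral>u. (s * 1) *\<^sub>R P (hyper i u) \<partial>hyper_measure i)"
      unfolding H_def
      by (rule integral_half_space_normal[OF s cP cP' dP B']) (use zero in auto)
    finally show ?thesis by (simp add: True)
  next
    case False
    have eq: "indicator H x *\<^sub>R G' (S x) ?f
      = indicator H x *\<^sub>R P' x ?f - indicator H x *\<^sub>R (D\<gamma> x ?f *\<^sub>R P' x ?e)" for x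
      by (simp add: P'_def D\<gamma>e algebra_simps)
    have i1: "integrable lborel (\<lambda>x. indicator H x *\<^sub>R P' x ?f)"
      by (rule intH) (use cP' zero in auto)
    have i2: "integrable lborel (\<lambda>x. indicator H x *\<^sub>R (D\<gamma> x ?f *\<^sub>R P' x ?e))"
      by (rule intH) (use zero in \<open>auto intro!: continuous_intros cP' cD\<gamma>\<close>)
    have "(\<integral>x. indicator H x *\<^sub>R P' x ?f \<partial>lborel) = 0"
    proof (rule integral_partial_derivative_eq_0[where S = H and P = P and P' = P' and B = B'])
      show "x + t *\<^sub>R ?f \<in> H \<longleftrightarrow> x \<in> H" for x t using False by (simp add: H_def axis_def)
      show "(P has_derivative P' x) (at x)" if "x \<in> H" for x using dP that by (simp add: H_def)
      show "continuous_on H (\<lambda>x. P' x ?f)" by (rule continuous_on_subset[OF cP']) (auto simp: H_def)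
      show "P x = 0 \<and> (\<forall>v. P' x v = 0)" if "x \<in> H" "x \<notin> B'" for x using zero[of x] that by (simp add: H_def)
    qed (rule i1 B')+
    moreover have "(\<integral>x. indicator H x *\<^sub>R (D\<gamma> x ?f *\<^sub>R P' x ?e) \<partial>lborel)
      = (\<integral>u. (s * D\<gamma> (hyper i u) ?f) *\<^sub>R P (hyper i u) \<partial>hyper_measure i)"
      unfolding H_def
      by (rule integral_half_space_normal[OF s cP cP' dP B']) (use zero D\<gamma>e cD\<gamma> in auto)
    ultimately have "(\<integral>x. indicator H x *\<^sub>R G' (S x) ?f \<partial>lborel)
      = - (\<integral>u. (s * D\<gamma> (hyper i u) ?f) *\<^sub>R P (hyper i u) \<partial>hyper_measure i)"
      unfolding eq using i1 i2 by simp
    then show ?thesis using False by (simp add: D\<gamma>_def pdiff_def)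
  qed
  also have "(\<lambda>u. P (hyper i u)) = (\<lambda>u. G (graph_map i \<gamma> (hyper i u)))"
    by (simp add: P_def S_def graph_map_eq)
  finally show ?thesis unfolding Om_def P_def by (simp add: S_def graph_map_eq)
qed

section \<open>The volume form on graph tangents\<close>

text \<open>
  Laplace expansion along the column of \<open>v\<close>: the signed forms \<open>(-1)\<^bsup>j-1\<^esup> dhat j\<close> are the components of the
  volume form with a free first argument.
\<close>

lemma dwedge_Cons:
  fixes v :: "real^'n::{finite,wellorder}"
  assumes "length vs = CARD('n) - 1"
  shows "dwedge [1..<Suc CARD('n)] (v # vs) = (\<Sum>j=1..CARD('n). v $ coord j * ((- 1) ^ (j - 1) * dhat j vs))"
proof -
  let ?n = "CARD('n)"
  define A where "A = Matrix.mat ?n ?n (\<lambda>(r, c). (v # vs) ! c $ coord ([1..<Suc ?n] ! r))"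
  have n: "0 < ?n" by simp
  have A: "A \<in> carrier_mat ?n ?n" by (simp add: A_def)
  have "dwedge [1..<Suc ?n] (v # vs) = Determinant.det A"
    by (simp add: dwedge_def A_def)
  also have "\<dots> = (\<Sum>i<?n. A $$ (i, 0) * cofactor A i 0)"
    by (rule laplace_expansion_column[OF A n])
  also have "\<dots> = (\<Sum>i<?n. v $ coord (Suc i) * ((- 1) ^ i * dhat (Suc i) vs))"
  proof (rule sum.cong[OF refl])
    fix i assume "i \<in> {..<?n}"
    then have i: "i < ?n" by simp
    let ?ks = "[1..<Suc i] @ [Suc (Suc i)..<Suc ?n]"
    have "mat_delete A i 0 = Matrix.mat (length ?ks) (length ?ks) (\<lambda>(r, c). vs ! c $ coord (?ks ! r))"
    proof (rule eq_matI)
      fix r c assume rc: "r < dim_row (Matrix.mat (length ?ks) (length ?ks) (\<lambda>(r, c). vs ! c $ coord (?ks ! r)))"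
        "c < dim_col (Matrix.mat (length ?ks) (length ?ks) (\<lambda>(r, c). vs ! c $ coord (?ks ! r)))"
      have "?ks ! r = (if r < i then Suc r else Suc (Suc r))" using rc i by (auto simp: nth_append)
      then show "mat_delete A i 0 $$ (r, c) =
        Matrix.mat (length ?ks) (length ?ks) (\<lambda>(r, c). vs ! c $ coord (?ks ! r)) $$ (r, c)"
        using rc i by (auto simp: mat_delete_def A_def simp del: upt_Suc)
    qed (use i in \<open>auto simp: mat_delete_def A_def\<close>)
    then have "cofactor A i 0 = (- 1) ^ i * dhat (Suc i) vs"
      by (simp add: cofactor_def dhat_def dwedge_def)
    moreover have "A $$ (i, 0) = v $ coord (Suc i)" using i n by (simp add: A_def del: upt_Suc)
    ultimately show "A $$ (i, 0) * cofactor A i 0 = v $ coord (Suc i) * ((- 1) ^ i * dhat (Suc i) vs)"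
      by simp
  qed
  also have "\<dots> = (\<Sum>j=1..?n. v $ coord j * ((- 1) ^ (j - 1) * dhat j vs))"
    by (rule sum.reindex_bij_witness[of _ "\<lambda>j. j - 1" Suc]) auto
  finally show ?thesis .
qed

lemma dwedge_Cons_mem:
  fixes v :: "real^'n::{finite,wellorder}"
  assumes "length vs = CARD('n) - 1" "v \<in> set vs"
  shows "dwedge [1..<Suc CARD('n)] (v # vs) = 0"
proof -
  let ?n = "CARD('n)"
  obtain c where c: "c < length vs" "vs ! c = v" using assms(2) by (auto simp: in_set_conv_nth)
  define A where "A = Matrix.mat ?n ?n (\<lambda>(r, c). (v # vs) ! c $ coord ([1..<Suc ?n] ! r))"
  have A: "A \<in> carrier_mat ?n ?n" by (simp add: A_def)
  have "Determinant.det A = 0"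
    by (rule det_identical_columns[OF A, of 0 "Suc c"]) (use c assms(1) in \<open>auto simp: A_def Matrix.col_def simp del: upt_Suc\<close>)
  then show ?thesis by (simp add: dwedge_def A_def)
qed

lemma pdiff_graph_map:
  fixes \<gamma> :: "real^'n::{finite,wellorder} \<Rightarrow> real"
  assumes "smooth \<gamma>"
  shows "pdiff l (graph_map i \<gamma>) x
    = axis (coord l) 1 + (pdiff l \<gamma> x - (axis (coord l) 1 :: real^'n::_) $ coord i) *\<^sub>R axis (coord i) 1"
proof -
  have "(graph_map i \<gamma> has_derivative
      (\<lambda>h. h + (frechet_derivative \<gamma> (at x) h - h $ coord i) *\<^sub>R axis (coord i) 1)) (at x)"
    unfolding graph_map_eq
    by (intro derivative_intros smooth_has_derivative[OF assms] bounded_linear_imp_has_derivative bounded_linear_vec_nth)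
  from frechet_derivative_at[OF this, symmetric] show ?thesis by (simp add: pdiff_def)
qed

lemma dhat_graph_tangents:
  fixes \<gamma> :: "real^'n::{finite,wellorder} \<Rightarrow> real"
  assumes \<gamma>: "smooth \<gamma>" and i: "i \<in> {1..CARD('n)}"
  shows "dhat i (graph_tangents i \<gamma> x) = 1"
proof -
  define ks where "ks = [1..<i] @ [Suc i..<Suc CARD('n)]"
  have ks: "ks ! r \<in> {1..CARD('n)} - {i}" if "r < length ks" for r
  proof -
    have "ks ! r \<in> set ks" using that by (rule nth_mem)
    then show ?thesis using i by (auto simp: ks_def)
  qed
  have "Matrix.mat (length ks) (length ks) (\<lambda>(r, c). graph_tangents i \<gamma> x ! c $ coord (ks ! r)) = 1\<^sub>m (length ks)"
  proof (rule eq_matI)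
    fix r c assume "r < dim_row (1\<^sub>m (length ks))" "c < dim_col (1\<^sub>m (length ks))"
    then have rc: "r < length ks" "c < length ks" by simp_all
    have d: "distinct ks" by (auto simp: ks_def)
    have ne: "(coord (ks ! r) :: 'n) \<noteq> coord i" using ks[OF rc(1)] i by (subst coord_eq_iff) auto
    have "graph_tangents i \<gamma> x ! c = pdiff (ks ! c) (graph_map i \<gamma>) x"
      unfolding graph_tangents_def ks_def[symmetric] using rc(2) by (rule nth_map)
    then have "graph_tangents i \<gamma> x ! c $ coord (ks ! r) = (if coord (ks ! r) = (coord (ks ! c) :: 'n) then 1 else 0)"
      using ne by (simp add: pdiff_graph_map[OF \<gamma>] axis_def)
    also have "coord (ks ! r) = (coord (ks ! c) :: 'n) \<longleftrightarrow> r = c"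
    proof -
      have "coord (ks ! r) = (coord (ks ! c) :: 'n) \<longleftrightarrow> ks ! r = ks ! c"
        using ks[OF rc(1)] ks[OF rc(2)] by (intro coord_eq_iff) blast+
      then show ?thesis using nth_eq_iff_index_eq[OF d rc] by simp
    qed
    finally show "Matrix.mat (length ks) (length ks) (\<lambda>(r, c). graph_tangents i \<gamma> x ! c $ coord (ks ! r)) $$ (r, c)
      = 1\<^sub>m (length ks) $$ (r, c)" using rc by simp
  qed auto
  then show ?thesis by (simp only: dhat_def dwedge_def ks_def[symmetric] Determinant.det_one)
qed

text \<open>
  By the expansion above, \<open>(-1)\<^bsup>j-1\<^esup> dhat j\<close> of the tangents is the volume spanned by \<open>e\<^sub>j\<close> and the
  tangents. Since \<open>e\<^sub>j = t\<^sub>j - \<partial>\<^sub>j \<gamma> e\<^sub>i\<close> with a tangent \<open>t\<^sub>j\<close>, it equals \<open>- \<partial>\<^sub>j \<gamma>\<close> times the volume spanned by \<open>e\<^sub>i\<close>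
  and the tangents. The orientation sign turns that last volume into \<open>s\<close>.
\<close>

lemma oriented_dhat_graph_tangents:
  fixes \<gamma> :: "real^'n::{finite,wellorder} \<Rightarrow> real"
  assumes \<gamma>: "smooth \<gamma>" and s: "s \<in> {1, - 1}" and i: "i \<in> {1..CARD('n)}" and j: "j \<in> {1..CARD('n)}"
  shows "orientation_sign (s *\<^sub>R axis (coord i) 1) (graph_tangents i \<gamma> x) * ((- 1) ^ (j - 1) * dhat j (graph_tangents i \<gamma> x))
    = (if coord j = (coord i :: 'n) then s else - s * pdiff j \<gamma> x)"
proof -
  let ?vs = "graph_tangents i \<gamma> x"
  have len: "length ?vs = CARD('n) - 1" using i by (auto simp: graph_tangents_def)
  define L where "L v = dwedge [1..<Suc CARD('n)] (v # ?vs)" for v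
  have L: "L v = (\<Sum>j=1..CARD('n). v $ coord j * ((- 1) ^ (j - 1) * dhat j ?vs))" for v
    unfolding L_def by (rule dwedge_Cons[OF len])
  have lin: "L (v + c *\<^sub>R w) = L v + c * L w" for v c w
    by (simp add: L sum.distrib sum_distrib_left algebra_simps)
  have Laxis: "L (axis (coord k) 1) = (- 1) ^ (k - 1) * dhat k ?vs" if k: "k \<in> {1..CARD('n)}" for k
  proof -
    have "L (axis (coord k) 1) = (\<Sum>j=1..CARD('n). if j = k then (- 1) ^ (j - 1) * dhat j ?vs else 0)"
      unfolding L by (rule sum.cong[OF refl]) (use k in \<open>auto simp: axis_def coord_eq_iff\<close>)
    also have "\<dots> = (- 1) ^ (k - 1) * dhat k ?vs" using k by simp
    finally show ?thesis .
  qed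
  have Li: "L (axis (coord i) 1) = (- 1) ^ (i - 1)"
    using Laxis[OF i] dhat_graph_tangents[OF \<gamma> i] by simp
  have "L (s *\<^sub>R axis (coord i) 1) = s * (- 1) ^ (i - 1)"
    using lin[of 0 s "axis (coord i) 1"] Li by (simp add: L)
  then have sign: "orientation_sign (s *\<^sub>R axis (coord i) 1) ?vs = s * (- 1) ^ (i - 1)"
    using s by (cases "even (i - 1)") (auto simp: orientation_sign_def L_def)
  show ?thesis
  proof (cases "j = i")
    case True
    then show ?thesis using sign dhat_graph_tangents[OF \<gamma> i] by simp
  next
    case False
    then have ne: "coord j \<noteq> (coord i :: 'n)" using i j by (simp add: coord_eq_iff)
    define t where "t = pdiff j (graph_map i \<gamma>) x"
    have t: "axis (coord j) 1 = t + (- pdiff j \<gamma> x) *\<^sub>R axis (coord i) 1"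
      using ne by (simp add: t_def pdiff_graph_map[OF \<gamma>] axis_def[of "coord j"] Finite_Cartesian_Product.vec_eq_iff)
    have "j \<in> set ([1..<i] @ [Suc i..<Suc CARD('n)])" using j False by auto
    then have "t \<in> set ?vs" unfolding t_def graph_tangents_def set_map by (rule imageI)
    then have "L t = 0" unfolding L_def by (rule dwedge_Cons_mem[OF len])
    then have "L (axis (coord j) 1) = - pdiff j \<gamma> x * (- 1) ^ (i - 1)"
      unfolding t lin Li by simp
    then have "(- 1) ^ (j - 1) * dhat j ?vs = - pdiff j \<gamma> x * (- 1) ^ (i - 1)" by (simp only: Laxis[OF j])
    moreover have "(- 1) ^ (i - 1) * (- 1) ^ (i - 1) = (1::real)" by (simp add: power_mult_distrib[symmetric])
    ultimately show ?thesis using ne unfolding sign by (simp add: mult.assoc mult.left_commute)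
  qed
qed

section \<open>The divergence theorem\<close>

lemma measurable_hyper:
  "hyper i \<in> borel_measurable (hyper_measure i :: ('n::{finite,wellorder} \<Rightarrow> real) measure)"
proof -
  have "(\<lambda>u. hyper i u \<bullet> b) \<in> borel_measurable (hyper_measure i)"
    if "b \<in> Basis" for b :: "real^'n::_"
  proof -
    have "\<exists>l. b = axis l 1" using that by (auto simp: Basis_vec_def)
    then obtain l where b: "b = axis l 1" ..
    show ?thesis
    proof (cases "l = coord i")
      case True
      then show ?thesis by (simp add: b inner_axis)
    next
      case False
      have "(\<lambda>u. u l) \<in> borel_measurable (hyper_measure i :: ('n \<Rightarrow> real) measure)"
        using measurable_component_singleton[of l "UNIV - {coord i}" "\<lambda>_. lborel :: real measure"] False by simp
      then show ?thesis using False by (simp add: b inner_axis)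
    qed
  qed
  then show ?thesis by (subst borel_measurable_euclidean_space) auto
qed

lemma integrable_hyper:
  fixes Q :: "real^'n::{finite,wellorder} \<Rightarrow> 'b::euclidean_space"
  assumes Q: "continuous_on UNIV Q"
    and R: "\<And>u l. l \<noteq> coord i \<Longrightarrow> R < \<bar>u l\<bar> \<Longrightarrow> Q (hyper i u) = 0"
  shows "integrable (hyper_measure i) (\<lambda>u. Q (hyper i u))"
proof -
  interpret product_sigma_finite "\<lambda>_::'n. lborel::real measure" by standard
  define A where "A = Pi\<^sub>E (UNIV - {coord i :: 'n}) (\<lambda>_. {- R..R})"
  define K where "K = cball (0 :: real^'n::_) (\<Sum>l\<in>(UNIV::'n set). \<bar>R\<bar>)"
  have "compact (Q ` K)"
    unfolding K_def by (intro compact_continuous_image continuous_on_subset[OF Q]) auto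
  then obtain c where c: "\<And>x. x \<in> K \<Longrightarrow> norm (Q x) \<le> c"
    by (meson bounded_iff compact_imp_bounded image_eqI)
  show ?thesis
  proof (rule integrableI_bounded_set)
    show "A \<in> sets (hyper_measure i)" unfolding A_def by (rule sets_PiM_I_finite) auto
    show "(\<lambda>u. Q (hyper i u)) \<in> borel_measurable (hyper_measure i)"
      by (rule measurable_compose[OF measurable_hyper borel_measurable_continuous_onI[OF Q]])
    have "emeasure (hyper_measure i) A = (\<Prod>l\<in>UNIV - {coord i :: 'n}. emeasure lborel {- R..R})"
      unfolding A_def by (rule emeasure_PiM) auto
    also have "\<dots> < \<infinity>" by (cases "- R \<le> R") (auto simp: ennreal_prod_eq_top less_top[symmetric] power_eq_top_ennreal)
    finally show "emeasure (hyper_measure i) A < \<infinity>" .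
    show "AE u in hyper_measure i. u \<in> A \<longrightarrow> norm (Q (hyper i u)) \<le> c"
    proof (intro AE_I2 impI c)
      fix u assume "u \<in> A"
      then have "\<bar>hyper i u $ l\<bar> \<le> \<bar>R\<bar>" for l
        by (cases "l = coord i") (auto simp: A_def PiE_def Pi_def abs_le_iff)
      then have "norm (hyper i u) \<le> (\<Sum>l\<in>(UNIV::'n set). \<bar>R\<bar>)"
        by (intro order_trans[OF norm_le_l1_cart] sum_mono) auto
      then show "hyper i u \<in> K" by (simp add: K_def)
    qed
    show "AE u in hyper_measure i. u \<notin> A \<longrightarrow> Q (hyper i u) = 0"
    proof (intro AE_I2 impI)
      fix u assume u: "u \<in> space (hyper_measure i)" "u \<notin> A"
      have "\<exists>l. l \<noteq> coord i \<and> u l \<notin> {- R..R}"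
      proof (rule ccontr)
        assume "\<nexists>l. l \<noteq> coord i \<and> u l \<notin> {- R..R}"
        then have "u \<in> A" using u(1) by (auto simp: A_def space_PiM PiE_def Pi_def)
        then show False using u(2) by simp
      qed
      then obtain l where "l \<noteq> coord i" "u l \<notin> {- R..R}" by blast
      then show "Q (hyper i u) = 0" by (intro R[of l]) auto
    qed
  qed
qed

text \<open>
  A cutoff whose support lies in a patch makes a function continuous on the whole region beside the graph,
  although the function itself is known to be continuous only on the closure of the domain.
\<close>

lemma continuous_on_cutoff:
  fixes F :: "'m::topological_space \<Rightarrow> 'b::real_normed_vector"
  assumes F: "continuous_on E F" and 0: "\<And>x. x \<notin> K \<Longrightarrow> F x = 0"
    and K: "closed K" "K \<subseteq> U" "open U" and C: "C \<inter> U \<subseteq> E"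
  shows "continuous_on C F"
proof -
  have C2: "(C \<inter> U) \<union> (C - K) = C" using K(2) by blast
  have "continuous_on (C \<inter> U) F" using F C by (rule continuous_on_subset)
  moreover have "continuous_on (C - K) F"
    using continuous_on_cong[of "C - K" "C - K" F "\<lambda>_. 0"] 0 by simp
  moreover have "openin (top_of_set C) (C \<inter> U)" using K(3) by (rule openin_open_Int)
  moreover have "openin (top_of_set C) (C - K)"
    using openin_open_Int[of "- K" C] K(1) by (simp add: Diff_eq open_Compl)
  ultimately show ?thesis using continuous_on_Un_local_open[of "C \<inter> U" "C - K" F] unfolding C2 by blast
qed

text \<open>
  A point of the graph inside the patch is the limit of points displaced against the outward direction.
\<close>

lemma graph_patch_closure:
  assumes "graph_patch D i s \<gamma> U"
  shows "{x. s * (x $ coord i - \<gamma> x) \<le> 0} \<inter> U \<subseteq> closure D"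
proof
  fix x assume x: "x \<in> {x. s * (x $ coord i - \<gamma> x) \<le> 0} \<inter> U"
  have U: "open U" and s: "s \<in> {1, - 1}" and inv: "\<And>x t. \<gamma> (x + t *\<^sub>R axis (coord i) 1) = \<gamma> x"
    and D: "D \<inter> U = {x \<in> U. s * (x $ coord i - \<gamma> x) < 0}"
    using assms by (auto simp: graph_patch_def)
  show "x \<in> closure D"
  proof (cases "s * (x $ coord i - \<gamma> x) < 0")
    case True
    then show ?thesis using x D closure_subset by blast
  next
    case False
    then have x0: "s * (x $ coord i - \<gamma> x) = 0" and xU: "x \<in> U" using x by auto
    show ?thesis
    proof (unfold closure_approachable, intro allI impI)
      fix e :: real assume "0 < e"
      obtain d where d: "d > 0" "ball x d \<subseteq> U" using U xU by (meson openE)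
      define t where "t = min d e / 2"
      have t: "0 < t" "t < d" "t < e" using d(1) \<open>0 < e\<close> by (auto simp: t_def)
      define y where "y = x + (- s * t) *\<^sub>R axis (coord i) 1"
      have dist: "dist y x = t" using s t(1) by (auto simp: y_def dist_norm)
      have "y \<in> U" using d(2) dist t(2) by (auto simp: dist_commute mem_ball)
      moreover have "s * (y $ coord i - \<gamma> y) = s * (x $ coord i - \<gamma> x) - (s * s) * t"
        unfolding y_def inv by (simp add: algebra_simps)
      then have "s * (y $ coord i - \<gamma> y) < 0" using x0 s t(1) by auto
      ultimately have "y \<in> D" using D by blast
      then show "\<exists>y\<in>D. dist y x < e" using dist t(3) by blast
    qed
  qed
qed

lemma frechet_derivative_eq_0_outside:
  assumes "x \<notin> closure {y. \<rho> y \<noteq> 0}"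
  shows "frechet_derivative \<rho> (at x) = (\<lambda>_. 0)"
proof -
  have "(\<rho> has_derivative (\<lambda>_. 0)) (at x)"
    by (rule has_derivative_transform_within_open[of "\<lambda>_. 0" _ _ "UNIV" "- closure {y. \<rho> y \<noteq> 0}"])
       (use assms closure_subset[of "{y. \<rho> y \<noteq> 0}"] in auto)
  then show ?thesis by (rule frechet_derivative_at[symmetric])
qed

definition hat_form :: "nat \<Rightarrow> (real^'n::{finite,wellorder} \<Rightarrow> 'b::real_vector) \<Rightarrow> ('n, 'b) form" where
  "hat_form j h = (\<lambda>y vs. ((- 1) ^ (j - 1) * dhat j vs) *\<^sub>R h y)"

text \<open>
  The \<open>j\<close>-th partial derivative of \<open>\<rho> h\<close>, written with the derivative \<open>h'\<close> that extends to the
  closure of the domain.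
\<close>

definition localized_partial ::
    "(real^'n::{finite,wellorder} \<Rightarrow> 'b::real_normed_vector) \<Rightarrow> (real^'n::_ \<Rightarrow> real^'n::_ \<Rightarrow> 'b) \<Rightarrow> nat \<Rightarrow>
     (real^'n::_ \<Rightarrow> real) \<Rightarrow> real^'n::_ \<Rightarrow> 'b" where
  "localized_partial h h' j \<rho> x =
     \<rho> x *\<^sub>R h' x (axis (coord j) 1) + frechet_derivative \<rho> (at x) (axis (coord j) 1) *\<^sub>R h x"

text \<open>
  The field \<open>\<rho> h\<close> can be regarded as a field on the entire region beside the graph, because it vanishes
  near every point outside the patch. It then falls under the graph case.
\<close>

lemma patch_divergence:
  fixes h :: "real^'n::{finite,wellorder} \<Rightarrow> 'b::euclidean_space"
  assumes D: "bounded D" "graph_patch D i s \<gamma> U"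
    and \<rho>: "smooth \<rho>" "closure {y. \<rho> y \<noteq> 0} \<subseteq> U"
    and h: "continuous_on (closure D) h" "\<And>x. x \<in> D \<Longrightarrow> (h has_derivative h' x) (at x)"
      "\<And>v. continuous_on (closure D) (\<lambda>x. h' x v)"
    and j: "j \<in> {1..CARD('n)}"
  shows "integrable (patch_measure (i, s, \<gamma>, U, \<rho>)) (patch_integrand (hat_form j h) (i, s, \<gamma>, U, \<rho>))"
    and "integral\<^sup>L (patch_measure (i, s, \<gamma>, U, \<rho>)) (patch_integrand (hat_form j h) (i, s, \<gamma>, U, \<rho>))
      = (\<integral>x. indicator D x *\<^sub>R localized_partial h h' j \<rho> x \<partial>lborel)"
proof -
  let ?K = "closure {y. \<rho> y \<noteq> 0}"
  define C where "C = {x. s * (x $ coord i - \<gamma> x) \<le> 0}"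
  \<comment> \<open>the \<open>j\<close>-th component of the outward normal, scaled by the area element\<close>
  define N where "N x = (if coord j = (coord i :: 'n) then s else - s * pdiff j \<gamma> x)" for x
  define G where "G x = \<rho> x *\<^sub>R h x" for x
  define G' where "G' x v = \<rho> x *\<^sub>R h' x v + frechet_derivative \<rho> (at x) v *\<^sub>R h x" for x v
  have U: "open U" and s: "s \<in> {1, - 1}" and inv: "\<And>x t. \<gamma> (x + t *\<^sub>R axis (coord i) 1) = \<gamma> x"
    and DU: "D \<inter> U = {x \<in> U. s * (x $ coord i - \<gamma> x) < 0}" and \<gamma>: "smooth \<gamma>" and i: "i \<in> {1..CARD('n)}"
    using D(2) by (auto simp: graph_patch_def)
  have CU: "C \<inter> U \<subseteq> closure D" unfolding C_def by (rule graph_patch_closure[OF D(2)])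
  have \<rho>0: "\<rho> x = 0" if "x \<notin> ?K" for x using that closure_subset[of "{y. \<rho> y \<noteq> 0}"] by auto
  have 0: "G x = 0" "G' x v = 0" if "x \<notin> ?K" for x v
    unfolding G_def G'_def \<rho>0[OF that] frechet_derivative_eq_0_outside[OF that] by simp_all
  have zero': "G x = 0" "G' x v = 0" if "x \<in> C" "x \<notin> closure D" for x v
  proof -
    have "x \<notin> ?K" using that CU \<rho>(2) by blast
    then show "G x = 0" "G' x v = 0" by (rule 0)+
  qed
  have c: "continuous_on C F" if "continuous_on (closure D) F" "\<And>x. x \<notin> ?K \<Longrightarrow> F x = 0" for F :: "_ \<Rightarrow> 'b"
    by (rule continuous_on_cutoff[OF that closed_closure \<rho>(2) U CU])
  have cG: "continuous_on C G"
  proof (rule c)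
    show "continuous_on (closure D) G" unfolding G_def by (intro continuous_intros h smooth_continuous[OF \<rho>(1)])
  qed (rule 0)
  have cG': "continuous_on C (\<lambda>x. G' x v)" for v
  proof (rule c)
    show "continuous_on (closure D) (\<lambda>x. G' x v)"
      unfolding G'_def by (intro continuous_intros h smooth_continuous[OF \<rho>(1)] smooth_continuous_derivative[OF \<rho>(1)])
  qed (rule 0)
  have dG: "(G has_derivative G' x) (at x)" if "s * (x $ coord i - \<gamma> x) < 0" for x
  proof (cases "x \<in> U")
    case True
    then have "x \<in> D" using that DU by blast
    from has_derivative_scaleR[OF smooth_has_derivative[OF \<rho>(1)] h(2)[OF this]]
    show ?thesis unfolding G_def G'_def by (simp add: add.commute)
  next
    case False
    then have "x \<notin> ?K" using \<rho>(2) by blast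
    have "(G has_derivative (\<lambda>_. 0)) (at x)"
      by (rule has_derivative_transform_within_open[of "\<lambda>_. 0" _ _ "UNIV" "- ?K"]) (use \<open>x \<notin> ?K\<close> 0 in auto)
    moreover have "G' x = (\<lambda>_. 0)" using 0(2)[OF \<open>x \<notin> ?K\<close>] by auto
    ultimately show ?thesis by simp
  qed
  have P: "patch_integrand (hat_form j h) (i, s, \<gamma>, U, \<rho>)
    = (\<lambda>u. N (hyper i u) *\<^sub>R G (graph_map i \<gamma> (hyper i u)))"
  proof
    fix u
    let ?x = "hyper i u :: real^'n::_"
    have "patch_integrand (hat_form j h) (i, s, \<gamma>, U, \<rho>) u =
      (orientation_sign (s *\<^sub>R axis (coord i) 1) (graph_tangents i \<gamma> ?x)
        * ((- 1) ^ (j - 1) * dhat j (graph_tangents i \<gamma> ?x))) *\<^sub>R G (graph_map i \<gamma> ?x)"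
      by (simp add: patch_integrand_def Let_def hat_form_def G_def mult_ac)
    then show "patch_integrand (hat_form j h) (i, s, \<gamma>, U, \<rho>) u = N ?x *\<^sub>R G (graph_map i \<gamma> ?x)"
      unfolding oriented_dhat_graph_tangents[OF \<gamma> s i j] N_def .
  qed
  have M: "patch_measure (i, s, \<gamma>, U, \<rho>) = hyper_measure i" by (simp add: patch_measure_def)
  have gC: "graph_map i \<gamma> x \<in> C" for x by (simp add: C_def graph_map_eq inv)
  show "integrable (patch_measure (i, s, \<gamma>, U, \<rho>)) (patch_integrand (hat_form j h) (i, s, \<gamma>, U, \<rho>))"
    unfolding P M
  proof -
    have "continuous_on UNIV (graph_map i \<gamma>)"
      unfolding graph_map_eq by (intro continuous_intros smooth_continuous[OF \<gamma>])
    then have "continuous_on UNIV (\<lambda>x. G (graph_map i \<gamma> x))"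
      by (rule continuous_on_compose2[OF cG]) (use gC in auto)
    moreover have "continuous_on UNIV N"
      unfolding N_def pdiff_def by (cases "coord j = (coord i :: 'n)") (auto intro!: continuous_intros smooth_continuous_derivative[OF \<gamma>])
    ultimately have Q: "continuous_on UNIV (\<lambda>x. N x *\<^sub>R G (graph_map i \<gamma> x))" by (intro continuous_intros)
    obtain R where R: "\<And>x. x \<in> closure D \<Longrightarrow> norm x \<le> R"
      using bounded_closure[OF D(1)] by (auto simp: bounded_iff)
    show "integrable (hyper_measure i) (\<lambda>u. N (hyper i u) *\<^sub>R G (graph_map i \<gamma> (hyper i u)))"
    proof (rule integrable_hyper[OF Q])
      fix u :: "'n \<Rightarrow> real" and l assume l: "l \<noteq> coord i" "R < \<bar>u l\<bar>"
      have "\<bar>graph_map i \<gamma> (hyper i u) $ l\<bar> \<le> norm (graph_map i \<gamma> (hyper i u))" by (rule component_le_norm_cart)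
      moreover have "graph_map i \<gamma> (hyper i u) $ l = u l" using l(1) by (simp add: graph_map_def)
      ultimately have "graph_map i \<gamma> (hyper i u) \<notin> closure D" using R[of "graph_map i \<gamma> (hyper i u)"] l(2) by auto
      then show "N (hyper i u) *\<^sub>R G (graph_map i \<gamma> (hyper i u)) = 0" using zero'(1)[OF gC] by simp
    qed
  qed
  have "integral\<^sup>L (patch_measure (i, s, \<gamma>, U, \<rho>)) (patch_integrand (hat_form j h) (i, s, \<gamma>, U, \<rho>))
     = (\<integral>x. indicator {x. s * (x $ coord i - \<gamma> x) < 0} x *\<^sub>R G' x (axis (coord j) 1) \<partial>lborel)"
    unfolding P M N_def
    by (rule integral_graph_half_space[OF s \<gamma> inv cG[unfolded C_def] cG'[unfolded C_def] dG bounded_closure[OF D(1)], symmetric])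
       (use zero' in \<open>auto simp: C_def\<close>)
  also have "\<dots> = (\<integral>x. indicator D x *\<^sub>R localized_partial h h' j \<rho> x \<partial>lborel)"
  proof (rule Bochner_Integration.integral_cong[OF refl])
    fix x
    show "indicator {x. s * (x $ coord i - \<gamma> x) < 0} x *\<^sub>R G' x (axis (coord j) 1)
      = indicator D x *\<^sub>R localized_partial h h' j \<rho> x"
    proof (cases "x \<in> U")
      case True
      then have "x \<in> {x. s * (x $ coord i - \<gamma> x) < 0} \<longleftrightarrow> x \<in> D" using DU by blast
      then show ?thesis by (simp add: indicator_def G'_def localized_partial_def)
    next
      case False
      then have "G' x (axis (coord j) 1) = 0" using \<rho>(2) by (intro 0) blast
      then show ?thesis by (simp add: G'_def localized_partial_def)
    qed
  qed
  finally show "integral\<^sup>L (patch_measure (i, s, \<gamma>, U, \<rho>)) (patch_integrand (hat_form j h) (i, s, \<gamma>, U, \<rho>))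
      = (\<integral>x. indicator D x *\<^sub>R localized_partial h h' j \<rho> x \<partial>lborel)" .
qed

text \<open>
  The product \<open>\<theta> h\<close> vanishes near the frontier, so its extension by zero is a compactly supported
  \<open>C\<^sup>1\<close> function on the whole space.
\<close>

lemma interior_divergence:
  fixes h :: "real^'n::{finite,wellorder} \<Rightarrow> 'b::euclidean_space"
  assumes D: "open D" "bounded D" and W: "open W" "frontier D \<subseteq> W" and \<theta>: "\<And>x. x \<in> W \<Longrightarrow> \<theta> x = 0"
    and d\<theta>: "\<And>x. (\<theta> has_derivative \<theta>' x) (at x)" "\<And>v. continuous_on UNIV (\<lambda>x. \<theta>' x v)"
    and h: "continuous_on (closure D) h" "\<And>x. x \<in> D \<Longrightarrow> (h has_derivative h' x) (at x)"
      "\<And>v. continuous_on (closure D) (\<lambda>x. h' x v)"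
  shows "(\<integral>x. indicator D x *\<^sub>R (\<theta> x *\<^sub>R h' x (axis (coord j) 1) + \<theta>' x (axis (coord j) 1) *\<^sub>R h x) \<partial>lborel) = 0"
proof -
  define P where "P x = (if x \<in> D then \<theta> x *\<^sub>R h x else 0)" for x
  define P' where "P' x v = (if x \<in> D then \<theta> x *\<^sub>R h' x v + \<theta>' x v *\<^sub>R h x else 0)" for x v
  define V where "V = W \<union> - closure D"
  have V: "open V" using W(1) by (auto simp: V_def)
  have DV: "D \<union> V = UNIV" using W(2) D(1) by (auto simp: V_def frontier_def interior_open)
  have c\<theta>: "continuous_on A \<theta>" for A
    using continuous_at_imp_continuous_on has_derivative_continuous[OF d\<theta>(1)] by blast
  have \<theta>'0: "\<theta>' x v = 0" if "x \<in> W" for x v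
  proof -
    have "(\<theta> has_derivative (\<lambda>_. 0)) (at x)"
      by (rule has_derivative_transform_within_open[of "\<lambda>_. 0" _ _ "UNIV" W]) (use that W(1) \<theta> in auto)
    then have "\<theta>' x = (\<lambda>_. 0)" by (rule has_derivative_unique[OF d\<theta>(1)])
    then show ?thesis by simp
  qed
  have V0: "P x = 0" "P' x v = 0" if "x \<in> V" for x v
    using that \<theta> \<theta>'0 closure_subset[of D] by (auto simp: V_def P_def P'_def)
  have dP: "(P has_derivative P' x) (at x)" for x
  proof (cases "x \<in> D")
    case True
    have "((\<lambda>x. \<theta> x *\<^sub>R h x) has_derivative P' x) (at x)"
      using has_derivative_scaleR[OF d\<theta>(1) h(2)[OF True]] True unfolding P'_def by (simp add: add.commute)
    then show ?thesis by (rule has_derivative_transform_within_open[OF _ D(1) True]) (simp add: P_def)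
  next
    case False
    then have x: "x \<in> V" using DV by blast
    have "(P has_derivative (\<lambda>_. 0)) (at x)"
      by (rule has_derivative_transform_within_open[of "\<lambda>_. 0" _ _ "UNIV" V]) (use x V V0 in auto)
    moreover have "P' x = (\<lambda>_. 0)" using False by (simp add: P'_def fun_eq_iff)
    ultimately show ?thesis by simp
  qed
  have cP': "continuous_on UNIV (\<lambda>x. P' x v)" for v
  proof -
    have "continuous_on D (\<lambda>x. \<theta> x *\<^sub>R h' x v + \<theta>' x v *\<^sub>R h x)"
      by (intro continuous_intros c\<theta> continuous_on_subset[OF h(1) closure_subset]
          continuous_on_subset[OF h(3) closure_subset] continuous_on_subset[OF d\<theta>(2)]) auto
    then have "continuous_on D (\<lambda>x. P' x v)" by (rule continuous_on_eq) (simp add: P'_def)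
    moreover have "continuous_on V (\<lambda>x. P' x v)"
      using continuous_on_cong[of V V "\<lambda>x. P' x v" "\<lambda>_. 0"] V0 by simp
    ultimately show ?thesis using continuous_on_open_Un[OF D(1) V] unfolding DV by blast
  qed
  have "(\<integral>x. indicator UNIV x *\<^sub>R P' x (axis (coord j) 1) \<partial>lborel) = 0"
  proof (rule integral_partial_derivative_eq_0[where P = P and B = D])
    show "integrable lborel (\<lambda>x. indicator UNIV x *\<^sub>R P' x (axis (coord j) 1))"
      by (rule integrable_continuous_bounded_support[OF _ cP' _ _ D(2)]) (auto simp: P'_def)
    show "P x = 0 \<and> (\<forall>v. P' x v = 0)" if "x \<notin> D" for x using that by (simp add: P_def P'_def)
  qed (simp_all add: dP cP' D(2))
  moreover have "indicator UNIV x *\<^sub>R P' x (axis (coord j) 1)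
    = indicator D x *\<^sub>R (\<theta> x *\<^sub>R h' x (axis (coord j) 1) + \<theta>' x (axis (coord j) 1) *\<^sub>R h x)" for x
    by (simp add: P'_def)
  ultimately show ?thesis by simp
qed

text \<open>
  With \<open>S\<close> the sum of the partition of unity, the field splits as \<open>h = \<Sum> \<rho> h + (1 - S) h\<close>. Each \<open>\<rho> h\<close>
  gives its patch integral, and \<open>1 - S\<close> vanishes near the frontier.
\<close>

lemma divergence_theorem:
  fixes h :: "real^'n::{finite,wellorder} \<Rightarrow> 'b::euclidean_space"
  assumes D: "open D" "bounded D" and ps: "boundary_atlas D ps"
    and h: "continuous_on (closure D) h" "\<And>x. x \<in> D \<Longrightarrow> (h has_derivative h' x) (at x)"
      "\<And>v. continuous_on (closure D) (\<lambda>x. h' x v)"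
    and j: "j \<in> {1..CARD('n)}"
  shows "\<And>p. p \<in> set ps \<Longrightarrow> integrable (patch_measure p) (patch_integrand (hat_form j h) p)"
    and "(\<Sum>p\<leftarrow>ps. integral\<^sup>L (patch_measure p) (patch_integrand (hat_form j h) p))
      = (\<integral>x. indicator D x *\<^sub>R h' x (axis (coord j) 1) \<partial>lborel)"
proof -
  define rho where "rho = (\<lambda>(i::nat, s::real, \<gamma>::real^'n::_ \<Rightarrow> real, U::(real^'n::_) set, \<rho>::real^'n::_ \<Rightarrow> real). \<rho>)"
  define e where "e = (axis (coord j) 1 :: real^'n::_)"
  have patch: "graph_patch D i s \<gamma> U \<and> smooth \<rho> \<and> closure {y. \<rho> y \<noteq> 0} \<subseteq> U"
    if "(i, s, \<gamma>, U, \<rho>) \<in> set ps" for i s \<gamma> U \<rho>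
    using ps that by (auto simp: boundary_atlas_def)
  have props: "smooth (rho p) \<and> integrable (patch_measure p) (patch_integrand (hat_form j h) p) \<and>
      integral\<^sup>L (patch_measure p) (patch_integrand (hat_form j h) p)
      = (\<integral>x. indicator D x *\<^sub>R localized_partial h h' j (rho p) x \<partial>lborel)" if pps: "p \<in> set ps" for p
  proof -
    obtain i s \<gamma> U \<rho> where p: "p = (i, s, \<gamma>, U, \<rho>)" by (rule prod_cases5)
    have g: "graph_patch D i s \<gamma> U" and sm: "smooth \<rho>" "closure {y. \<rho> y \<noteq> 0} \<subseteq> U"
      using patch[of i s \<gamma> U \<rho>] pps unfolding p by simp_all
    have "rho p = \<rho>" by (simp add: rho_def p)
    then show ?thesis
      using patch_divergence[OF D(2) g sm h j] sm(1) unfolding p by simp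
  qed
  then have smooth: "smooth (rho p)"
    and eq: "integral\<^sup>L (patch_measure p) (patch_integrand (hat_form j h) p)
      = (\<integral>x. indicator D x *\<^sub>R localized_partial h h' j (rho p) x \<partial>lborel)" if "p \<in> set ps" for p
    using that by auto
  show "integrable (patch_measure p) (patch_integrand (hat_form j h) p)" if "p \<in> set ps" for p
    using props[OF that] by simp
  have intD: "integrable lborel (\<lambda>x. indicator D x *\<^sub>R F x)" if "continuous_on (closure D) F" for F :: "_ \<Rightarrow> 'b"
    by (rule integrable_continuous_bounded_support[OF closed_closure that closure_subset _ D(2)]) (use D(1) in auto)
  define S where "S qs x = (\<Sum>p\<leftarrow>qs. rho p x)" for qs x
  define S' where "S' qs x v = (\<Sum>p\<leftarrow>qs. frechet_derivative (rho p) (at x) v)" for qs x v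
  have S: "(\<forall>x. (S qs has_derivative S' qs x) (at x)) \<and> (\<forall>v. continuous_on UNIV (\<lambda>x. S' qs x v))
      \<and> (\<Sum>p\<leftarrow>qs. \<integral>x. indicator D x *\<^sub>R localized_partial h h' j (rho p) x \<partial>lborel)
        = (\<integral>x. indicator D x *\<^sub>R (S qs x *\<^sub>R h' x e + S' qs x e *\<^sub>R h x) \<partial>lborel)"
    if "set qs \<subseteq> set ps" for qs
    using that
  proof (induction qs)
    case Nil
    have "S [] = (\<lambda>_. 0)" "S' [] = (\<lambda>_ _. 0)" by (simp_all add: S_def S'_def fun_eq_iff)
    then show ?case by simp
  next
    case (Cons p qs)
    then have IH: "\<And>x. (S qs has_derivative S' qs x) (at x)" "\<And>v. continuous_on UNIV (\<lambda>x. S' qs x v)"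
      "(\<Sum>p\<leftarrow>qs. \<integral>x. indicator D x *\<^sub>R localized_partial h h' j (rho p) x \<partial>lborel)
        = (\<integral>x. indicator D x *\<^sub>R (S qs x *\<^sub>R h' x e + S' qs x e *\<^sub>R h x) \<partial>lborel)"
      and p: "smooth (rho p)" using smooth by auto
    have eqS: "S (p # qs) = (\<lambda>x. rho p x + S qs x)"
      "S' (p # qs) = (\<lambda>x v. frechet_derivative (rho p) (at x) v + S' qs x v)"
      by (simp_all add: S_def S'_def fun_eq_iff)
    have cS: "continuous_on A (S qs)" for A
      using continuous_at_imp_continuous_on has_derivative_continuous[OF IH(1)] by blast
    have cS': "continuous_on A (\<lambda>x. S' qs x v)" for A v
      using continuous_on_subset[OF IH(2)] by blast
    have i1: "integrable lborel (\<lambda>x. indicator D x *\<^sub>R (S qs x *\<^sub>R h' x e + S' qs x e *\<^sub>R h x))"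
      by (intro intD continuous_intros h cS cS')
    have i2: "integrable lborel (\<lambda>x. indicator D x *\<^sub>R localized_partial h h' j (rho p) x)"
      unfolding localized_partial_def
      by (intro intD continuous_intros h smooth_continuous[OF p] smooth_continuous_derivative[OF p])
    have split: "indicator D x *\<^sub>R (S (p # qs) x *\<^sub>R h' x e + S' (p # qs) x e *\<^sub>R h x)
      = indicator D x *\<^sub>R localized_partial h h' j (rho p) x + indicator D x *\<^sub>R (S qs x *\<^sub>R h' x e + S' qs x e *\<^sub>R h x)" for x
      by (simp add: eqS localized_partial_def e_def[symmetric] algebra_simps)
    have "(S (p # qs) has_derivative S' (p # qs) x) (at x)" for x
      unfolding eqS by (intro has_derivative_add smooth_has_derivative[OF p] IH)
    moreover have "continuous_on UNIV (\<lambda>x. S' (p # qs) x v)" for v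
      unfolding eqS by (intro continuous_intros smooth_continuous_derivative[OF p] IH)
    moreover have "(\<integral>x. indicator D x *\<^sub>R (S (p # qs) x *\<^sub>R h' x e + S' (p # qs) x e *\<^sub>R h x) \<partial>lborel)
      = (\<Sum>p\<leftarrow>p # qs. \<integral>x. indicator D x *\<^sub>R localized_partial h h' j (rho p) x \<partial>lborel)"
      unfolding split Bochner_Integration.integral_add[OF i2 i1] IH(3)[symmetric] by simp
    ultimately show ?case by simp
  qed
  note S = S[OF subset_refl]
  have dS: "(S ps has_derivative S' ps x) (at x)" for x using S by blast
  have atlas_sum: "(\<Sum>(i, s, \<gamma>, U, \<rho>)\<leftarrow>ps. \<rho> y) = S ps y" for y
  proof -
    have "(case p of (i, s, \<gamma>, U, \<rho>) \<Rightarrow> \<rho> y) = rho p y" for p by (simp add: rho_def split: prod.split)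
    then show ?thesis unfolding S_def by presburger
  qed
  have "\<exists>W. open W \<and> frontier D \<subseteq> W \<and> (\<forall>y\<in>W. S ps y = 1)"
    using ps unfolding boundary_atlas_def atlas_sum by (rule conjunct2)
  then obtain W where W: "open W" "frontier D \<subseteq> W" "\<And>y. y \<in> W \<Longrightarrow> S ps y = 1" by blast
  have cS: "continuous_on A (S ps)" for A
    using continuous_at_imp_continuous_on has_derivative_continuous[OF dS] by blast
  have cS': "continuous_on A (\<lambda>x. S' ps x v)" for A v
    by (rule continuous_on_subset[of UNIV]) (use S in auto)
  have "(\<integral>x. indicator D x *\<^sub>R ((1 - S ps x) *\<^sub>R h' x e + (- S' ps x e) *\<^sub>R h x) \<partial>lborel) = 0"
    unfolding e_def
  proof (rule interior_divergence[OF D W(1,2) _ _ _ h])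
    show "1 - S ps x = 0" if "x \<in> W" for x using W(3)[OF that] by simp
    show "((\<lambda>x. 1 - S ps x) has_derivative (\<lambda>v. - S' ps x v)) (at x)" for x
      using has_derivative_diff[OF has_derivative_const, of "S ps" "S' ps x" "at x" 1] dS by simp
    show "continuous_on UNIV (\<lambda>x. - S' ps x v)" for v by (intro continuous_intros cS')
  qed
  moreover have "indicator D x *\<^sub>R ((1 - S ps x) *\<^sub>R h' x e + (- S' ps x e) *\<^sub>R h x)
     = indicator D x *\<^sub>R h' x e - indicator D x *\<^sub>R (S ps x *\<^sub>R h' x e + S' ps x e *\<^sub>R h x)" for x
    by (simp add: algebra_simps)
  moreover have "integrable lborel (\<lambda>x. indicator D x *\<^sub>R h' x e)" by (intro intD h)
  moreover have "integrable lborel (\<lambda>x. indicator D x *\<^sub>R (S ps x *\<^sub>R h' x e + S' ps x e *\<^sub>R h x))"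
    by (intro intD continuous_intros h cS cS')
  ultimately have "(\<integral>x. indicator D x *\<^sub>R h' x e \<partial>lborel)
    = (\<integral>x. indicator D x *\<^sub>R (S ps x *\<^sub>R h' x e + S' ps x e *\<^sub>R h x) \<partial>lborel)" by simp
  also have "\<dots> = (\<Sum>p\<leftarrow>ps. integral\<^sup>L (patch_measure p) (patch_integrand (hat_form j h) p))"
    using S eq by (simp cong: map_cong)
  finally show "(\<Sum>p\<leftarrow>ps. integral\<^sup>L (patch_measure p) (patch_integrand (hat_form j h) p))
      = (\<integral>x. indicator D x *\<^sub>R h' x (axis (coord j) 1) \<partial>lborel)" unfolding e_def by simp
qed

section \<open>Smooth bump functions\<close>

text \<open>
  The one-variable counterpart of \<open>C_diff\<close>. Having a derivative as a witness, and not as the value of an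
  operator, keeps the closure properties short.
\<close>

primrec C_real :: "nat \<Rightarrow> (real \<Rightarrow> real) \<Rightarrow> bool" where
  "C_real 0 h \<longleftrightarrow> continuous_on UNIV h"
| "C_real (Suc k) h \<longleftrightarrow> (\<exists>h'. (\<forall>t. (h has_real_derivative h' t) (at t)) \<and> C_real k h')"

lemma C_real_Suc_imp: "C_real (Suc k) h \<Longrightarrow> C_real k h"
proof (induction k arbitrary: h)
  case 0
  then obtain h' where "\<And>t. (h has_real_derivative h' t) (at t)" by auto
  then have "isCont h t" for t using DERIV_isCont by blast
  then show ?case by (simp add: continuous_at_imp_continuous_on)
next
  case (Suc k)
  then show ?case using C_real.simps(2)[of k] C_real.simps(2)[of "Suc k"] by metis
qed

lemma C_real_add: "C_real k f \<Longrightarrow> C_real k g \<Longrightarrow> C_real k (\<lambda>t. f t + g t)"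
proof (induction k arbitrary: f g)
  case 0
  then show ?case by (simp add: continuous_on_add)
next
  case (Suc k)
  obtain f' where f': "\<And>t. (f has_real_derivative f' t) (at t)" "C_real k f'" using Suc.prems(1) by auto
  obtain g' where g': "\<And>t. (g has_real_derivative g' t) (at t)" "C_real k g'" using Suc.prems(2) by auto
  have "((\<lambda>t. f t + g t) has_real_derivative f' t + g' t) (at t)" for t
    by (rule DERIV_add[OF f'(1) g'(1)])
  moreover have "C_real k (\<lambda>t. f' t + g' t)" by (rule Suc.IH[OF f'(2) g'(2)])
  ultimately show ?case unfolding C_real.simps by (intro exI[of _ "\<lambda>t. f' t + g' t"] conjI allI)
qed

lemma C_real_mult: "C_real k f \<Longrightarrow> C_real k g \<Longrightarrow> C_real k (\<lambda>t. f t * g t)"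
proof (induction k arbitrary: f g)
  case 0
  then show ?case by (simp add: continuous_on_mult)
next
  case (Suc k)
  obtain f' where f': "\<And>t. (f has_real_derivative f' t) (at t)" "C_real k f'" using Suc.prems(1) by auto
  obtain g' where g': "\<And>t. (g has_real_derivative g' t) (at t)" "C_real k g'" using Suc.prems(2) by auto
  have "((\<lambda>t. f t * g t) has_real_derivative f' t * g t + g' t * f t) (at t)" for t
    by (rule DERIV_mult[OF f'(1) g'(1)])
  moreover have "C_real k (\<lambda>t. f' t * g t + g' t * f t)"
    by (rule C_real_add[OF Suc.IH[OF f'(2) C_real_Suc_imp[OF Suc.prems(2)]] Suc.IH[OF g'(2) C_real_Suc_imp[OF Suc.prems(1)]]])
  ultimately show ?case unfolding C_real.simps by (intro exI[of _ "\<lambda>t. f' t * g t + g' t * f t"] conjI allI)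
qed

lemma C_real_const: "C_real k (\<lambda>_. c)"
proof (induction k arbitrary: c)
  case (Suc k)
  have "((\<lambda>_. c) has_real_derivative 0) (at t)" for t by simp
  with Suc show ?case unfolding C_real.simps by (intro exI[of _ "\<lambda>_. 0"] conjI allI)
qed simp

lemma C_real_inverse:
  assumes "\<And>t. f t \<noteq> 0"
  shows "C_real k f \<Longrightarrow> C_real k (\<lambda>t. inverse (f t))"
proof (induction k)
  case 0
  then show ?case using assms by (simp add: continuous_on_inverse)
next
  case (Suc k)
  obtain f' where f': "\<And>t. (f has_real_derivative f' t) (at t)" "C_real k f'" using Suc.prems by auto
  have IH: "C_real k (\<lambda>t. inverse (f t))" by (rule Suc.IH[OF C_real_Suc_imp[OF Suc.prems]])
  have "((\<lambda>t. inverse (f t)) has_real_derivative (- 1) * (inverse (f t) * f' t * inverse (f t))) (at t)" for t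
    using DERIV_inverse'[OF f'(1) assms] by simp
  moreover have "C_real k (\<lambda>t. (- 1) * (inverse (f t) * f' t * inverse (f t)))"
    by (rule C_real_mult[OF C_real_const C_real_mult[OF C_real_mult[OF IH f'(2)] IH]])
  ultimately show ?case unfolding C_real.simps
    by (intro exI[of _ "\<lambda>t. (- 1) * (inverse (f t) * f' t * inverse (f t))"] conjI allI)
qed

lemma C_real_reflect: "C_real k f \<Longrightarrow> C_real k (\<lambda>t. f (c - t))"
proof (induction k arbitrary: f)
  case 0
  then show ?case by (auto intro!: continuous_on_compose2[of UNIV f] continuous_intros)
next
  case (Suc k)
  obtain f' where f': "\<And>t. (f has_real_derivative f' t) (at t)" "C_real k f'" using Suc.prems by auto
  have "((\<lambda>t. f (c - t)) has_real_derivative (- 1) * f' (c - t)) (at t)" for t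
    by (rule DERIV_cong[OF DERIV_chain2[OF f'(1)]]) (auto intro!: derivative_eq_intros)
  moreover have "C_real k (\<lambda>t. (- 1) * f' (c - t))" by (rule C_real_mult[OF C_real_const Suc.IH[OF f'(2)]])
  ultimately show ?case unfolding C_real.simps by (intro exI[of _ "\<lambda>t. (- 1) * f' (c - t)"] conjI allI)
qed

text \<open>
  The smooth functions \<open>p(1/t) exp(-1/t)\<close>, continued by zero. Polynomials \<open>p\<close> are admitted because
  this family is closed under differentiation.
\<close>

definition flat :: "real poly \<Rightarrow> real \<Rightarrow> real" where
  "flat p t = (if 0 < t then poly p (1 / t) * exp (- (1 / t)) else 0)"

lemma poly_times_exp_tendsto_0: "((\<lambda>x. poly p x * exp (- x)) \<longlongrightarrow> 0) at_top" for p :: "real poly"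
proof -
  have "((\<lambda>x. \<Sum>i\<le>degree p. coeff p i * (x ^ i / exp x)) \<longlongrightarrow> (\<Sum>i\<le>degree p. coeff p i * 0)) at_top"
    by (intro tendsto_sum tendsto_mult tendsto_const tendsto_power_div_exp_0)
  then show ?thesis by (simp add: poly_altdef exp_minus divide_inverse[symmetric] sum_divide_distrib)
qed

lemma flat_tendsto_0: "(flat p \<longlongrightarrow> 0) (at 0)"
proof -
  have "((\<lambda>t. poly p (1 / t) * exp (- (1 / t))) \<longlongrightarrow> 0) (at_right 0)"
    using filterlim_compose[OF poly_times_exp_tendsto_0 filterlim_inverse_at_top_right] by (simp add: inverse_eq_divide)
  then have "(flat p \<longlongrightarrow> 0) (at_right 0)"
    by (rule Lim_transform_eventually)
       (rule eventually_mono[OF eventually_at_right_less[of 0]], simp add: flat_def)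
  moreover have "(flat p \<longlongrightarrow> 0) (at_left 0)"
    by (rule tendsto_eventually) (auto simp: flat_def eventually_at_left_field intro!: exI[of _ "- 1"])
  ultimately show ?thesis by (rule filterlim_split_at[rotated])
qed

lemma flat_has_derivative:
  "(flat p has_real_derivative flat ([:0, 0, 1:] * (p - pderiv p)) t) (at t)"
proof -
  consider "t > 0" | "t < 0" | "t = 0" by linarith
  then show ?thesis
  proof cases
    case 1
    have "((\<lambda>t. poly p (1 / t) * exp (- (1 / t))) has_real_derivative flat ([:0, 0, 1:] * (p - pderiv p)) t) (at t)"
      using 1 by (auto intro!: derivative_eq_intros simp: flat_def field_simps power2_eq_square)
    then show ?thesis
      by (rule has_field_derivative_transform_within_open[of _ _ _ "{0<..}"]) (use 1 in \<open>auto simp: flat_def\<close>)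
  next
    case 2
    have "((\<lambda>t. 0) has_real_derivative flat ([:0, 0, 1:] * (p - pderiv p)) t) (at t)"
      using 2 by (simp add: flat_def)
    then show ?thesis
      by (rule has_field_derivative_transform_within_open[of _ _ _ "{..<0}"]) (use 2 in \<open>auto simp: flat_def\<close>)
  next
    case 3
    \<comment> \<open>a difference quotient at \<open>0\<close> is again of this form, so the limit at \<open>0\<close> suffices\<close>
    have "(\<lambda>h. (flat p (0 + h) - flat p 0) / h) = flat ([:0, 1:] * p)"
      by (auto simp: flat_def)
    then have "(flat p has_real_derivative 0) (at 0)"
      unfolding DERIV_def using flat_tendsto_0[of "[:0, 1:] * p"] by simp
    then show ?thesis using 3 by (simp add: flat_def)
  qed
qed

lemma C_real_flat: "C_real k (flat p)"
proof (induction k arbitrary: p)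
  case 0
  have "isCont (flat p) t" for t using flat_has_derivative DERIV_isCont by blast
  then show ?case by (simp add: continuous_at_imp_continuous_on)
next
  case (Suc k)
  then show ?case using flat_has_derivative by auto
qed

definition smooth_step :: "real \<Rightarrow> real" where
  "smooth_step t = flat 1 t * inverse (flat 1 t + flat 1 (1 - t))"

lemma flat_1_sum_pos: "0 < flat 1 t + flat 1 (1 - t)"
  by (cases "0 < t") (auto simp: flat_def add_pos_nonneg add_nonneg_pos)

lemma C_real_smooth_step: "C_real k smooth_step"
proof -
  have "C_real k (\<lambda>t. flat 1 t * inverse (flat 1 t + flat 1 (1 - t)))"
    by (rule C_real_mult[OF C_real_flat C_real_inverse[OF _ C_real_add[OF C_real_flat C_real_reflect[OF C_real_flat]]]])
       (use flat_1_sum_pos in \<open>simp add: less_imp_neq[THEN not_sym]\<close>)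
  then show ?thesis by (simp add: smooth_step_def[abs_def])
qed

lemma smooth_step_bounds: "0 \<le> smooth_step t" "smooth_step t \<le> 1"
proof -
  have f: "0 \<le> flat 1 u" for u by (simp add: flat_def)
  show "0 \<le> smooth_step t"
    unfolding smooth_step_def using f flat_1_sum_pos[of t] by (intro mult_nonneg_nonneg) auto
  show "smooth_step t \<le> 1"
    using f[of "1 - t"] flat_1_sum_pos[of t] by (simp add: smooth_step_def field_simps)
qed

lemma smooth_step_eq: "t \<le> 0 \<Longrightarrow> smooth_step t = 0" "1 \<le> t \<Longrightarrow> smooth_step t = 1"
  by (auto simp: smooth_step_def flat_def)

lemma C_diff_Suc_imp: "C_diff (Suc k) g \<Longrightarrow> C_diff k g"
proof (induction k arbitrary: g)
  case 0
  then show ?case using C_diff_continuous by (metis C_diff.simps(1))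
next
  case (Suc k)
  have d: "\<forall>x. g differentiable at x" using Suc.prems by simp
  have "C_diff k (pdiff j g)" if "j \<in> {1..CARD('a)}" for j
  proof -
    have "C_diff (Suc k) (pdiff j g)" using Suc.prems that unfolding C_diff.simps(2)[of "Suc k" g] by blast
    then show ?thesis by (rule Suc.IH)
  qed
  with d show ?case by simp
qed

lemma pdiff_eqI: "(g has_derivative g') (at x) \<Longrightarrow> pdiff j g x = g' (axis (coord j) 1)"
  unfolding pdiff_def by (simp add: frechet_derivative_at[symmetric])

lemma C_diff_SucI:
  assumes "\<And>x. (g has_derivative g' x) (at x)"
    and "\<And>j. j \<in> {1..CARD('n)} \<Longrightarrow> C_diff k (\<lambda>x. g' x (axis (coord j) 1))"
  shows "C_diff (Suc k) (g :: real^'n::{finite,wellorder} \<Rightarrow> real)"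
proof -
  have "pdiff j g = (\<lambda>x. g' x (axis (coord j) 1))" for j
    using pdiff_eqI[OF assms(1)] by (rule ext)
  then show ?thesis using assms by (auto simp: differentiable_def)
qed

lemma C_diff_SucD:
  assumes "C_diff (Suc k) (g :: real^'n::{finite,wellorder} \<Rightarrow> real)"
  shows "(g has_derivative frechet_derivative g (at x)) (at x)"
    and "j \<in> {1..CARD('n)} \<Longrightarrow> C_diff k (\<lambda>x. frechet_derivative g (at x) (axis (coord j) 1))"
proof -
  show "(g has_derivative frechet_derivative g (at x)) (at x)"
    using assms frechet_derivative_works by auto
  show "C_diff k (\<lambda>x. frechet_derivative g (at x) (axis (coord j) 1))" if "j \<in> {1..CARD('n)}"
    using assms that by (simp add: pdiff_def[abs_def])
qed

lemma C_diff_const: "C_diff k (\<lambda>_. c)"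
proof (induction k arbitrary: c)
  case (Suc k)
  then show ?case by (intro C_diff_SucI[where g' = "\<lambda>_ _. 0"]) auto
qed simp

lemma C_diff_add: "C_diff k f \<Longrightarrow> C_diff k g \<Longrightarrow> C_diff k (\<lambda>x. f x + g x)"
proof (induction k arbitrary: f g)
  case 0
  then show ?case by (simp add: continuous_on_add)
next
  case (Suc k)
  note f = C_diff_SucD[OF Suc.prems(1)] and g = C_diff_SucD[OF Suc.prems(2)]
  show ?case
    by (rule C_diff_SucI[OF has_derivative_add[OF f(1) g(1)]]) (intro Suc.IH f(2) g(2))
qed

lemma C_diff_mult: "C_diff k f \<Longrightarrow> C_diff k g \<Longrightarrow> C_diff k (\<lambda>x. f x * g x)"
proof (induction k arbitrary: f g)
  case 0
  then show ?case by (simp add: continuous_on_mult)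
next
  case (Suc k)
  note f = C_diff_SucD[OF Suc.prems(1)] and g = C_diff_SucD[OF Suc.prems(2)]
  show ?case
    by (rule C_diff_SucI[OF has_derivative_mult[OF f(1) g(1)]])
       (intro C_diff_add Suc.IH f(2) g(2) C_diff_Suc_imp[OF Suc.prems(1)] C_diff_Suc_imp[OF Suc.prems(2)])
qed

lemma C_diff_sum: "(\<And>l. l \<in> I \<Longrightarrow> C_diff k (f l)) \<Longrightarrow> C_diff k (\<lambda>x. \<Sum>l\<in>I. f l x)"
  by (induction I rule: infinite_finite_induct) (auto intro: C_diff_const C_diff_add)

lemma C_diff_nth: "C_diff k (\<lambda>x. x $ l)"
proof (cases k)
  case 0
  then show ?thesis by (auto intro: continuous_intros)
next
  case (Suc m)
  have d: "((\<lambda>x. x $ l) has_derivative (\<lambda>h. h $ l)) (at x)" for x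
    by (rule bounded_linear_imp_has_derivative[OF bounded_linear_vec_nth])
  show ?thesis unfolding Suc by (rule C_diff_SucI[OF d]) (rule C_diff_const)
qed

lemma C_diff_compose: "C_real k h \<Longrightarrow> C_diff k P \<Longrightarrow> C_diff k (\<lambda>x. h (P x))"
proof (induction k arbitrary: h)
  case 0
  then show ?case by (auto intro!: continuous_on_compose2[of UNIV h])
next
  case (Suc k)
  obtain h' where h': "\<And>t. (h has_real_derivative h' t) (at t)" "C_real k h'" using Suc.prems(1) by auto
  note P = C_diff_SucD[OF Suc.prems(2)]
  have d: "((\<lambda>x. h (P x)) has_derivative (\<lambda>v. h' (P x) * frechet_derivative P (at x) v)) (at x)" for x
    using has_derivative_compose[OF P(1) h'(1)[unfolded has_field_derivative_def]] .
  show ?case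
    by (rule C_diff_SucI[OF d]) (rule C_diff_mult[OF Suc.IH[OF h'(2) C_diff_Suc_imp[OF Suc.prems(2)]] P(2)])
qed

lemma smooth_mult: "smooth f \<Longrightarrow> smooth g \<Longrightarrow> smooth (\<lambda>x. f x * g x)"
  by (simp add: smooth_def C_diff_mult)

lemma smooth_one_minus: "smooth f \<Longrightarrow> smooth (\<lambda>x. 1 - f x)"
proof -
  assume "smooth f"
  then have "C_diff k (\<lambda>x. 1 + (- 1) * f x)" for k
    unfolding smooth_def by (intro C_diff_add C_diff_mult C_diff_const) blast
  then show ?thesis by (simp add: smooth_def)
qed

text \<open>
  The argument of the step is quadratic in \<open>x\<close>, equal to \<open>1\<close> at distance \<open>r\<close> from \<open>p\<close> and to \<open>0\<close> at
  distance \<open>2 r\<close>.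
\<close>

lemma ex_smooth_bump:
  fixes p :: "real^'n::{finite,wellorder}"
  assumes "0 < r"
  shows "\<exists>\<theta>. smooth \<theta> \<and> (\<forall>x. 0 \<le> \<theta> x) \<and> (\<forall>x. \<theta> x \<le> 1) \<and> (\<forall>x\<in>ball p r. \<theta> x = 1)
    \<and> closure {x. \<theta> x \<noteq> 0} \<subseteq> cball p (2 * r)"
proof -
  define q where "q x = 4 / 3 + (- 1 / (3 * r\<^sup>2)) * (\<Sum>l\<in>UNIV. (x $ l + (- p $ l)) * (x $ l + (- p $ l)))" for x
  define \<theta> where "\<theta> x = smooth_step (q x)" for x
  have q: "q x = (4 * r\<^sup>2 - (dist p x)\<^sup>2) / (3 * r\<^sup>2)" for x
  proof -
    have "(\<Sum>l\<in>UNIV. (x $ l + (- p $ l)) * (x $ l + (- p $ l))) = (x - p) \<bullet> (x - p)" by (simp add: inner_vec_def)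
    also have "\<dots> = (dist p x)\<^sup>2" by (simp only: dist_norm norm_minus_commute[of p x] power2_norm_eq_inner)
    finally show ?thesis using assms by (simp add: q_def field_simps)
  qed
  have Cq: "C_diff k q" for k
    unfolding q_def[abs_def] by (intro C_diff_add C_diff_mult C_diff_const C_diff_sum C_diff_nth)
  have "C_diff k \<theta>" for k
    unfolding \<theta>_def[abs_def] by (rule C_diff_compose[OF C_real_smooth_step Cq])
  then have 1: "smooth \<theta>" by (simp add: smooth_def)
  have 2: "\<theta> x = 1" if "x \<in> ball p r" for x
  proof -
    have "(dist p x)\<^sup>2 \<le> r\<^sup>2" using that by (intro power_mono) auto
    then have "1 \<le> q x" using assms by (simp add: q)
    then show ?thesis by (simp add: \<theta>_def smooth_step_eq)
  qed
  have "{x. \<theta> x \<noteq> 0} \<subseteq> cball p (2 * r)"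
  proof
    fix x assume "x \<in> {x. \<theta> x \<noteq> 0}"
    then have "0 < q x" using smooth_step_eq(1)[of "q x"] by (auto simp: \<theta>_def not_le[symmetric])
    then have "(dist p x)\<^sup>2 < (2 * r)\<^sup>2" using assms by (simp add: q zero_less_divide_iff power_mult_distrib)
    then have "dist p x < 2 * r" by (rule power_less_imp_less_base) (use assms in simp)
    then show "x \<in> cball p (2 * r)" by simp
  qed
  then have 3: "closure {x. \<theta> x \<noteq> 0} \<subseteq> cball p (2 * r)" by (rule closure_minimal) simp
  have "0 \<le> \<theta> x" "\<theta> x \<le> 1" for x by (simp_all add: \<theta>_def smooth_step_bounds)
  then show ?thesis using 1 2 3 by (intro exI[of _ \<theta>] conjI) blast+
qed

section \<open>Existence of an atlas with a partition of unity\<close>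

text \<open>
  Starting from bump functions on a finite cover, each new bump \<open>\<theta>\<close> is put in front and the earlier functions
  are multiplied by \<open>1 - \<theta>\<close>. The sum \<open>\<Sigma>\<close> becomes \<open>\<theta> + (1 - \<theta>) \<Sigma>\<close>, which is \<open>1\<close> wherever \<open>\<theta> = 1\<close> or \<open>\<Sigma> = 1\<close>.
  In particular the sum equals \<open>1\<close> on an open set around the frontier.
\<close>

lemma ex_boundary_atlas:
  fixes D :: "(real^'n::{finite,wellorder}) set"
  assumes D: "bounded D" "smooth_boundary D"
  shows "\<exists>ps. boundary_atlas D ps"
proof -
  define good where "good = (\<lambda>(i, s, \<gamma>, U, \<rho>). graph_patch D i s \<gamma> U \<and> smooth \<rho> \<and> (\<forall>y. 0 \<le> \<rho> y) \<and> closure {y. \<rho> y \<noteq> 0} \<subseteq> U)"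
  have "\<exists>r>0. \<exists>i s \<gamma> U. graph_patch D i s \<gamma> U \<and> cball p (2 * r) \<subseteq> U" if pD: "p \<in> frontier D" for p
  proof -
    obtain i s \<gamma> U where g: "p \<in> U" "graph_patch D i s \<gamma> U" using D(2) pD unfolding smooth_boundary_def by blast
    then have "open U" by (simp add: graph_patch_def)
    then obtain e where "e > 0" "cball p e \<subseteq> U" using g(1) open_contains_cball by blast
    then have "e / 2 > 0" "cball p (2 * (e / 2)) \<subseteq> U" by auto
    then show ?thesis using g(2) by blast
  qed
  then obtain r where r: "\<And>p. p \<in> frontier D \<Longrightarrow> 0 < r p"
    "\<And>p. p \<in> frontier D \<Longrightarrow> \<exists>i s \<gamma> U. graph_patch D i s \<gamma> U \<and> cball p (2 * r p) \<subseteq> U" by metis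
  have "compact (frontier D)" using D(1) by (rule compact_frontier_bounded)
  moreover have "frontier D \<subseteq> (\<Union>p\<in>frontier D. ball p (r p))" using r(1) by force
  ultimately obtain F where F: "F \<subseteq> frontier D" "finite F" "frontier D \<subseteq> (\<Union>p\<in>F. ball p (r p))"
    by (rule compactE_image[OF _ open_ball])
  from F(2,1) have "\<exists>ps. (\<forall>p\<in>set ps. good p) \<and> (\<forall>y\<in>(\<Union>p\<in>F. ball p (r p)). (\<Sum>(i, s, \<gamma>, U, \<rho>)\<leftarrow>ps. \<rho> y) = 1)"
  proof (induction F rule: finite_induct)
    case empty
    show ?case by (rule exI[of _ "[]"]) simp
  next
    case (insert p F)
    have "F \<subseteq> frontier D" using insert.prems by simp
    then obtain ps where ps0: "(\<forall>p\<in>set ps. good p) \<and> (\<forall>y\<in>(\<Union>p\<in>F. ball p (r p)). (\<Sum>(i, s, \<gamma>, U, \<rho>)\<leftarrow>ps. \<rho> y) = 1)"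
      using insert.IH by blast
    then have ps: "\<And>p. p \<in> set ps \<Longrightarrow> good p"
      "\<And>y. y \<in> (\<Union>p\<in>F. ball p (r p)) \<Longrightarrow> (\<Sum>(i, s, \<gamma>, U, \<rho>)\<leftarrow>ps. \<rho> y) = 1" by blast+
    have p: "p \<in> frontier D" using insert.prems by simp
    obtain i s \<gamma> U where g: "graph_patch D i s \<gamma> U" "cball p (2 * r p) \<subseteq> U" using r(2)[OF p] by blast
    obtain \<theta> where \<theta>0: "smooth \<theta> \<and> (\<forall>x. 0 \<le> \<theta> x) \<and> (\<forall>x. \<theta> x \<le> 1) \<and> (\<forall>x\<in>ball p (r p). \<theta> x = 1)
      \<and> closure {x. \<theta> x \<noteq> 0} \<subseteq> cball p (2 * r p)"
      using ex_smooth_bump[OF r(1)[OF p]] by (rule exE)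
    then have \<theta>: "smooth \<theta>" "\<And>x. 0 \<le> \<theta> x" "\<And>x. \<theta> x \<le> 1" "\<And>x. x \<in> ball p (r p) \<Longrightarrow> \<theta> x = 1"
      "closure {x. \<theta> x \<noteq> 0} \<subseteq> cball p (2 * r p)" by blast+
    define damp where "damp = (\<lambda>(i::nat, s::real, \<gamma>::real^'n::_ \<Rightarrow> real, U::(real^'n::_) set, \<rho>). (i, s, \<gamma>, U, \<lambda>y. (1 - \<theta> y) * \<rho> y))"
    let ?ps = "(i, s, \<gamma>, U, \<theta>) # map damp ps"
    have "good (damp w)" if "good w" for w
    proof -
      obtain i s \<gamma> U \<rho> where w: "w = (i, s, \<gamma>, U, \<rho>)" by (rule prod_cases5)
      have "closure {y. (1 - \<theta> y) * \<rho> y \<noteq> 0} \<subseteq> closure {y. \<rho> y \<noteq> 0}" by (rule closure_mono) auto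
      then show ?thesis using that \<theta>(1,3)
        by (auto simp: w good_def damp_def smooth_mult smooth_one_minus)
    qed
    then have "\<forall>p\<in>set ?ps. good p" using ps(1) g \<theta>(1,2,5) by (auto simp: good_def)
    moreover have "(\<Sum>(i, s, \<gamma>, U, \<rho>)\<leftarrow>?ps. \<rho> y) = 1" if "y \<in> (\<Union>p\<in>insert p F. ball p (r p))" for y
    proof -
      have "(\<Sum>(i, s, \<gamma>, U, \<rho>)\<leftarrow>map damp qs. \<rho> y) = (1 - \<theta> y) * (\<Sum>(i, s, \<gamma>, U, \<rho>)\<leftarrow>qs. \<rho> y)" for qs
        by (induction qs) (auto simp: damp_def algebra_simps)
      then have eq: "(\<Sum>(i, s, \<gamma>, U, \<rho>)\<leftarrow>?ps. \<rho> y) = \<theta> y + (1 - \<theta> y) * (\<Sum>(i, s, \<gamma>, U, \<rho>)\<leftarrow>ps. \<rho> y)" by simp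
      show ?thesis
      proof (cases "y \<in> ball p (r p)")
        case True
        then show ?thesis unfolding eq by (simp add: \<theta>(4))
      next
        case False
        then have "y \<in> (\<Union>p\<in>F. ball p (r p))" using that by blast
        then show ?thesis unfolding eq by (simp add: ps(2))
      qed
    qed
    ultimately show ?case by blast
  qed
  then obtain ps where ps: "\<forall>p\<in>set ps. good p"
    "\<forall>y\<in>(\<Union>p\<in>F. ball p (r p)). (\<Sum>(i, s, \<gamma>, U, \<rho>)\<leftarrow>ps. \<rho> y) = 1" by blast
  have "boundary_atlas D ps"
    unfolding boundary_atlas_def
  proof
    show "\<forall>(i, s, \<gamma>, U, \<rho>)\<in>set ps. graph_patch D i s \<gamma> U \<and> smooth \<rho> \<and> (\<forall>y. 0 \<le> \<rho> y) \<and> closure {y. \<rho> y \<noteq> 0} \<subseteq> U"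
      using ps(1) unfolding good_def .
    show "\<exists>W. open W \<and> frontier D \<subseteq> W \<and> (\<forall>y\<in>W. (\<Sum>(i, s, \<gamma>, U, \<rho>)\<leftarrow>ps. \<rho> y) = 1)"
      by (intro exI[of _ "\<Union>p\<in>F. ball p (r p)"] conjI open_UN ballI open_ball F(3) ps(2))
  qed
  then show ?thesis ..
qed

section \<open>Conjugate coefficients from the conditions on the minors\<close>

lemma ex_inverse_block:
  fixes a :: "nat \<Rightarrow> nat \<Rightarrow> 'a::comm_ring_1"
  assumes u: "D0 q a * u = 1"
  obtains X where "X \<in> carrier_mat q q" "Determinant.det X * D0 q a = 1"
    "Matrix.mat q q (\<lambda>(r, c). a (Suc r) (Suc c)) * X = 1\<^sub>m q"
proof -
  define N where "N = Matrix.mat q q (\<lambda>(r, c). a (Suc r) (Suc c))"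
  define X where "X = u \<cdot>\<^sub>m adj_mat N"
  have N: "N \<in> carrier_mat q q" by (simp add: N_def)
  have dN: "Determinant.det N = D0 q a"
    unfolding D0_def det_rows_def N_def by (rule arg_cong[of _ _ Determinant.det], rule eq_matI) (auto simp del: upt_Suc)
  have X: "X \<in> carrier_mat q q" using adj_mat(1)[OF N] by (simp add: X_def)
  have "N * X = u \<cdot>\<^sub>m (N * adj_mat N)"
    unfolding X_def by (rule mult_smult_distrib[OF N adj_mat(1)[OF N]])
  also have "\<dots> = u \<cdot>\<^sub>m (D0 q a \<cdot>\<^sub>m 1\<^sub>m q)" using adj_mat(2)[OF N] dN by simp
  also have "\<dots> = 1\<^sub>m q" using u by (intro eq_matI) (auto simp: mult.commute)
  finally have NX: "N * X = 1\<^sub>m q" .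
  then have "Determinant.det N * Determinant.det X = 1" using det_mult[OF N X] by simp
  then have "Determinant.det X * D0 q a = 1" by (simp add: dN mult.commute)
  with X NX show ?thesis unfolding N_def by (intro that)
qed

text \<open>
  Cramer's rule. Multiply the matrix of the minor by the inverse \<open>X\<close> of the leading block: all rows but the last
  become unit vectors other than the \<open>m\<close>-th, and the last row becomes the row of \<open>C\<close>. Expanding along column \<open>m\<close>
  leaves only its last entry. The sign comes from the position of the new row, at the bottom and not in place \<open>m\<close>.
\<close>

lemma Dkm_eq:
  fixes a :: "nat \<Rightarrow> nat \<Rightarrow> 'a::comm_ring_1"
  assumes X: "X \<in> carrier_mat q q" "Determinant.det X * D0 q a = 1"
    and NX: "\<And>r c. r < q \<Longrightarrow> c < q \<Longrightarrow> (\<Sum>l<q. a (Suc r) (Suc l) * X $$ (l, c)) = (if r = c then 1 else 0)"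
    and m: "m \<in> {1..q}"
  shows "Dkm q a k m = D0 q a * ((- 1) ^ (q + m) * (\<Sum>l<q. a (q + k) (Suc l) * X $$ (l, m - 1)))"
proof -
  define js where "js = [1..<m] @ [Suc m..<Suc q] @ [q + k]"
  define R where "R = Matrix.mat q q (\<lambda>(r, c). a (js ! r) (Suc c))"
  define c0 where "c0 = m - 1"
  have c0: "c0 < q" "m = Suc c0" using m by (auto simp: c0_def)
  have js1: "js ! r = Suc (insert_index c0 r)" if "r < q - 1" for r
    using that m by (auto simp: js_def nth_append c0_def insert_index_def simp del: upt_Suc)
  have js2: "js ! (q - 1) = q + k" using m by (auto simp: js_def nth_append simp del: upt_Suc)
  have R: "R \<in> carrier_mat q q" by (simp add: R_def)
  have RX: "R * X \<in> carrier_mat q q" using R X(1) by simp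
  have ent: "(R * X) $$ (r, c) = (\<Sum>l<q. a (js ! r) (Suc l) * X $$ (l, c))" if "r < q" "c < q" for r c
    using that X(1) R by (simp add: scalar_prod_def R_def atLeast0LessThan)
  have ent1: "(R * X) $$ (r, c) = (if insert_index c0 r = c then 1 else 0)" if "r < q - 1" "c < q" for r c
  proof -
    have "insert_index c0 r < q" using that by (auto simp: insert_index_def)
    then show ?thesis using that NX[of "insert_index c0 r" c] by (simp add: ent js1)
  qed
  have "Determinant.det (R * X) = (\<Sum>r<q. (R * X) $$ (r, c0) * cofactor (R * X) r c0)"
    by (rule laplace_expansion_column[OF RX c0(1)])
  also have "\<dots> = (\<Sum>r\<in>{q - 1}. (R * X) $$ (r, c0) * cofactor (R * X) r c0)"
  proof (rule sum.mono_neutral_right)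
    show "\<forall>r\<in>{..<q} - {q - 1}. (R * X) $$ (r, c0) * cofactor (R * X) r c0 = 0"
    proof
      fix r assume "r \<in> {..<q} - {q - 1}"
      then have "r < q - 1" by auto
      moreover have "insert_index c0 r \<noteq> c0" by (auto simp: insert_index_def)
      ultimately show "(R * X) $$ (r, c0) * cofactor (R * X) r c0 = 0" using ent1[of r c0] c0 by simp
    qed
  qed (use c0 in auto)
  also have "\<dots> = (R * X) $$ (q - 1, c0) * cofactor (R * X) (q - 1) c0" by simp
  also have "cofactor (R * X) (q - 1) c0 = (- 1) ^ (q + m)"
  proof -
    have "mat_delete (R * X) (q - 1) c0 = 1\<^sub>m (q - 1)"
    proof (rule eq_matI)
      fix r c assume "r < dim_row (1\<^sub>m (q - 1))" "c < dim_col (1\<^sub>m (q - 1))"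
      then have rc: "r < q - 1" "c < q - 1" by simp_all
      have i: "insert_index c0 c < q" using rc by (auto simp: insert_index_def)
      have "mat_delete (R * X) (q - 1) c0 $$ (r, c) = (R * X) $$ (insert_index (q - 1) r, insert_index c0 c)"
        using mat_delete_index[of "R * X" "q - 1" "q - 1" c0 r c] RX rc c0 by simp
      also have "insert_index (q - 1) r = r" using rc by (simp add: insert_index_def)
      also have "(R * X) $$ (r, insert_index c0 c) = (if insert_index c0 r = insert_index c0 c then 1 else 0)"
        by (rule ent1[OF rc(1) i])
      also have "insert_index c0 r = insert_index c0 c \<longleftrightarrow> r = c" by (auto simp: insert_index_def split: if_splits)
      finally show "mat_delete (R * X) (q - 1) c0 $$ (r, c) = 1\<^sub>m (q - 1) $$ (r, c)" using rc by simp
    qed (use RX in \<open>auto simp: mat_delete_def\<close>)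
    moreover have "(- 1) ^ (q - 1 + c0) = ((- 1) ^ (q + m) :: 'a)"
    proof -
      have "q + m = (q - 1 + c0) + 2" using c0 by simp
      then show ?thesis by (simp only: power_add) simp
    qed
    ultimately show ?thesis by (simp add: cofactor_def)
  qed
  also have "(R * X) $$ (q - 1, c0) = (\<Sum>l<q. a (q + k) (Suc l) * X $$ (l, m - 1))"
    using ent[of "q - 1" c0, OF _ c0(1)] c0(1) unfolding js2 c0_def[symmetric] by simp
  finally have "Determinant.det R * Determinant.det X = (- 1) ^ (q + m) * (\<Sum>l<q. a (q + k) (Suc l) * X $$ (l, m - 1))"
    using det_mult[OF R X(1)] by (simp add: mult.commute)
  moreover have "Dkm q a k m = Determinant.det R" by (simp only: Dkm_def det_rows_def R_def js_def)
  moreover have "Determinant.det R = D0 q a * (Determinant.det R * Determinant.det X)"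
    using X(2) by (metis mult.assoc mult.commute mult.right_neutral)
  ultimately show ?thesis by simp
qed

text \<open>
  With \<open>X\<close> the inverse of the leading block and \<open>C = a X\<close> (so that the first \<open>q\<close> rows of \<open>C\<close> form the identity),
  \<open>F\<close> is \<open>C\<close> with the remaining rows negated and \<open>B = F X\<^sup>T\<close>. Then \<open>a B\<^sup>T = C F\<^sup>T\<close>: its mixed blocks are
  negative transposes of each other, and both diagonal blocks are the identity, the lower one since the hypothesis says
  that the rows of \<open>C\<close> below \<open>q\<close> have products \<open>- \<delta>\<close>.
\<close>

lemma ex_conjugate_coefficients:
  fixes a :: "nat \<Rightarrow> nat \<Rightarrow> 'a::comm_ring_1"
  assumes "q \<le> n" and D0: "D0 q a dvd 1"
    and A: "\<forall>k\<in>{1..n - q}. \<forall>l\<in>{1..n - q}.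
           (\<Sum>m=1..q. Dkm q a l m * Dkm q a k m) + (if l = k then 1 else 0) * (D0 q a)\<^sup>2 = 0"
  shows "\<exists>B. \<forall>i\<in>{1..n}. \<forall>j\<in>{1..n}.
    (\<Sum>m=1..q. a j m * B i m) + (\<Sum>m=1..q. a i m * B j m) = (if i = j then 2 else 0)"
proof -
  obtain u where u: "D0 q a * u = 1" using D0 by (metis dvdE)
  obtain X where X: "X \<in> carrier_mat q q" "Determinant.det X * D0 q a = 1"
    and NX0: "Matrix.mat q q (\<lambda>(r, c). a (Suc r) (Suc c)) * X = 1\<^sub>m q"
    by (rule ex_inverse_block[OF u])
  have NX: "(\<Sum>l<q. a (Suc r) (Suc l) * X $$ (l, c)) = (if r = c then 1 else 0)" if "r < q" "c < q" for r c
  proof -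
    have "(Matrix.mat q q (\<lambda>(r, c). a (Suc r) (Suc c)) * X) $$ (r, c) = (\<Sum>l<q. a (Suc r) (Suc l) * X $$ (l, c))"
      using that X(1) by (simp add: scalar_prod_def atLeast0LessThan)
    then show ?thesis using that by (simp add: NX0)
  qed
  define C where "C j l = (\<Sum>m=1..q. a j m * X $$ (m - 1, l - 1))" for j l
  define F where "F j l = (if j \<le> q then C j l else - C j l)" for j l
  define B where "B i m = (\<Sum>l=1..q. F i l * X $$ (m - 1, l - 1))" for i m
  have shift: "(\<Sum>m=1..q. f m) = (\<Sum>l<q. f (Suc l))" for f :: "nat \<Rightarrow> 'a"
    by (rule sum.reindex_bij_witness[of _ Suc "\<lambda>m. m - 1"]) auto
  have C': "C j l = (\<Sum>m<q. a j (Suc m) * X $$ (m, l - 1))" for j l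
    unfolding C_def shift by simp
  have C1: "C j l = (if j = l then 1 else 0)" if "j \<in> {1..q}" "l \<in> {1..q}" for j l
    using NX[of "j - 1" "l - 1"] that unfolding C' by auto
  have C2: "(\<Sum>m=1..q. C (q + k) m * C (q + l) m) = (if l = k then - 1 else 0)"
    if kl: "k \<in> {1..n - q}" "l \<in> {1..n - q}" for k l
  proof -
    have D: "Dkm q a k m = D0 q a * ((- 1) ^ (q + m) * C (q + k) m)" if "m \<in> {1..q}" for k m
      using Dkm_eq[OF X NX that, of k] unfolding C' .
    have "Dkm q a l m * Dkm q a k m = (D0 q a)\<^sup>2 * (C (q + k) m * C (q + l) m)" if "m \<in> {1..q}" for m
    proof -
      define s :: 'a where "s = (- 1) ^ (q + m)"
      have s: "s * s = 1" unfolding s_def by (simp add: power_mult_distrib[symmetric])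
      have "Dkm q a l m * Dkm q a k m = (s * s) * ((D0 q a)\<^sup>2 * (C (q + k) m * C (q + l) m))"
        unfolding D[OF that] s_def[symmetric] power2_eq_square by (simp only: mult_ac)
      then show ?thesis by (simp add: s)
    qed
    then have "(\<Sum>m=1..q. Dkm q a l m * Dkm q a k m) = (D0 q a)\<^sup>2 * (\<Sum>m=1..q. C (q + k) m * C (q + l) m)"
      by (simp add: sum_distrib_left)
    moreover define T where "T = (\<Sum>m=1..q. C (q + k) m * C (q + l) m)"
    moreover define e :: 'a where "e = (if l = k then 1 else 0)"
    moreover have "(\<Sum>m=1..q. Dkm q a l m * Dkm q a k m) + (if l = k then 1 else 0) * (D0 q a)\<^sup>2 = 0"
      using A kl by blast
    ultimately have "(D0 q a)\<^sup>2 * T + e * (D0 q a)\<^sup>2 = 0" by (simp only:)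
    then have "(D0 q a)\<^sup>2 * (T + e) = 0" by (simp only: distrib_left mult.commute[of e])
    then have "u\<^sup>2 * ((D0 q a)\<^sup>2 * (T + e)) = 0" by simp
    then have "(D0 q a * u)\<^sup>2 * (T + e) = 0" by (simp only: power_mult_distrib mult_ac)
    then have "T = - e" by (simp add: u eq_neg_iff_add_eq_0)
    then show ?thesis by (simp add: T_def e_def)
  qed
  have S: "(\<Sum>m=1..q. a j m * B i m) = (\<Sum>l=1..q. F i l * C j l)" for i j
  proof -
    have "(\<Sum>m=1..q. a j m * B i m) = (\<Sum>m=1..q. \<Sum>l=1..q. F i l * (a j m * X $$ (m - 1, l - 1)))"
      by (simp add: B_def sum_distrib_left mult.left_commute)
    also have "\<dots> = (\<Sum>l=1..q. \<Sum>m=1..q. F i l * (a j m * X $$ (m - 1, l - 1)))" by (rule sum.swap)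
    finally show ?thesis by (simp only: C_def sum_distrib_left)
  qed
  have "(\<Sum>l=1..q. F i l * C j l) + (\<Sum>l=1..q. F j l * C i l) = (if i = j then 2 else 0)"
    if ij: "i \<in> {1..n}" "j \<in> {1..n}" for i j
  proof -
    have delta: "(\<Sum>l=1..q. C i l * C j l) = (if i = j then 1 else 0)" if "i \<in> {1..q}" "j \<in> {1..q}" for i j
    proof -
      have "(\<Sum>l=1..q. C i l * C j l) = (\<Sum>l=1..q. if l = i then (if i = j then 1 else 0) else 0)"
        by (rule sum.cong[OF refl]) (use that in \<open>auto simp: C1\<close>)
      then show ?thesis using that by simp
    qed
    consider "i \<le> q" "j \<le> q" | "i \<le> q" "q < j" | "q < i" "j \<le> q" | "q < i" "q < j" by linarith
    then show ?thesis
    proof cases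
      case 1
      then show ?thesis using ij delta[of i j] delta[of j i] by (simp add: F_def)
    next
      case 2
      then show ?thesis by (simp add: F_def sum_negf mult.commute)
    next
      case 3
      then show ?thesis by (simp add: F_def sum_negf mult.commute)
    next
      case 4
      then have "j - q \<in> {1..n - q}" "i - q \<in> {1..n - q}" using ij by auto
      then have "(\<Sum>l=1..q. C i l * C j l) = (if i = j then - 1 else 0)"
        using C2[of "i - q" "j - q"] 4 by (auto split: if_splits)
      then show ?thesis using 4 by (simp add: F_def sum_negf mult.commute[of "C j _"])
    qed
  qed
  then show ?thesis unfolding S[symmetric] by blast
qed

section \<open>The angular part of the kernel\<close>

text \<open>
  The norm need not be submultiplicative, but in finite dimension every bilinear map is bounded.
\<close>

lemma bounded_bilinear_algebra_mult:
  "bounded_bilinear ((*) :: 'a::{comm_ring_1, real_algebra_1, euclidean_space} \<Rightarrow> 'a \<Rightarrow> 'a)"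
  unfolding bilinear_conv_bounded_bilinear[symmetric] bilinear_def
  by (auto intro!: linearI simp: algebra_simps)

text \<open>
  The coefficient of the \<open>j\<close>-th flux form in the Cauchy form is \<open>f y\<close> times this linear map at \<open>z = y - x\<close>,
  divided by \<open>\<parallel>z\<parallel>\<^sup>n\<close>.
\<close>

definition kernel_symbol ::
    "nat \<Rightarrow> (nat \<Rightarrow> nat \<Rightarrow> 'a::{comm_ring_1, real_algebra_1}) \<Rightarrow> (nat \<Rightarrow> nat \<Rightarrow> 'a) \<Rightarrow> nat \<Rightarrow> real^'n::{finite,wellorder} \<Rightarrow> 'a" where
  "kernel_symbol q a b j z = (\<Sum>m=1..q. a j m * (\<Sum>i=1..CARD('n). z $ coord i *\<^sub>R b i m))"

lemma kernel_symbol_eq_sum: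
  "kernel_symbol q a b j (z :: real^'n::{finite,wellorder}) = (\<Sum>i=1..CARD('n). z $ coord i *\<^sub>R (\<Sum>m=1..q. a j m * b i m))"
  unfolding kernel_symbol_def
  by (simp only: sum_distrib_left scaleR_sum_right mult_scaleR_right) (rule sum.swap)

lemma linear_kernel_symbol: "linear (kernel_symbol q a b j)"
  by (rule linearI) (simp_all only: kernel_symbol_eq_sum vector_add_component vector_scaleR_component
      scaleR_add_left sum.distrib scaleR_sum_right real_scaleR_def scaleR_scaleR)

lemma norm_sq_eq_sum_coord: "(norm (z :: real^'n::{finite,wellorder}))\<^sup>2 = (\<Sum>j=1..CARD('n). (z $ coord j)\<^sup>2)"
proof -
  have "(norm z)\<^sup>2 = (\<Sum>l\<in>UNIV. (z $ l)\<^sup>2)"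
    by (simp only: power2_norm_eq_inner inner_vec_def) (simp add: power2_eq_square)
  then show ?thesis using sum.reindex_bij_betw[OF coord_bij[where 'n='n], of "\<lambda>l. (z $ l)\<^sup>2"] by simp
qed

text \<open>
  Both quantities see only the symmetric part of the matrix \<open>S i j\<close>, which is \<open>c\<close> times the identity.
\<close>

lemma
  fixes a b :: "nat \<Rightarrow> nat \<Rightarrow> 'a::{comm_ring_1, real_algebra_1}" and c :: real
  assumes sym: "\<And>i j. i \<in> {1..CARD('n::{finite,wellorder})} \<Longrightarrow> j \<in> {1..CARD('n)} \<Longrightarrow>
    (\<Sum>m=1..q. a j m * b i m) + (\<Sum>m=1..q. a i m * b j m) = (if i = j then (2 * c) *\<^sub>R 1 else 0)"
  shows radial_kernel_symbol:
      "(\<Sum>j=1..CARD('n). (z :: real^'n::_) $ coord j *\<^sub>R kernel_symbol q a b j z) = (c * (norm z)\<^sup>2) *\<^sub>R 1"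
    and div_kernel_symbol:
      "(\<Sum>j=1..CARD('n). kernel_symbol q a b j (axis (coord j :: 'n) 1)) = (real CARD('n) * c) *\<^sub>R 1"
proof -
  let ?n = "CARD('n)"
  define S where "S i j = (\<Sum>m=1..q. a j m * b i m)" for i j
  have Ssym: "S i j + S j i = (if i = j then (2 * c) *\<^sub>R 1 else 0)" if "i \<in> {1..?n}" "j \<in> {1..?n}" for i j
    unfolding S_def by (rule sym[OF that])
  have halve: "x = (c * t) *\<^sub>R 1" if "x + x = (2 * c * t) *\<^sub>R 1" for x :: 'a and t :: real
  proof -
    have "x = (1 / 2) *\<^sub>R (x + x)" by simp
    also have "\<dots> = (c * t) *\<^sub>R 1" unfolding that by simp
    finally show ?thesis .
  qed
  let ?Q = "\<Sum>j=1..?n. \<Sum>i=1..?n. (z $ coord j * z $ coord i) *\<^sub>R S i j"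
  have Q: "(\<Sum>j=1..?n. z $ coord j *\<^sub>R kernel_symbol q a b j z) = ?Q"
    by (simp only: kernel_symbol_eq_sum S_def scaleR_sum_right scaleR_scaleR)
  have "?Q = (\<Sum>j=1..?n. \<Sum>i=1..?n. (z $ coord i * z $ coord j) *\<^sub>R S j i)" by (rule sum.swap)
  then have "?Q + ?Q = (\<Sum>j=1..?n. \<Sum>i=1..?n. (z $ coord j * z $ coord i) *\<^sub>R S i j)
      + (\<Sum>j=1..?n. \<Sum>i=1..?n. (z $ coord i * z $ coord j) *\<^sub>R S j i)" by simp
  also have "\<dots> = (\<Sum>j=1..?n. \<Sum>i=1..?n. (z $ coord j * z $ coord i) *\<^sub>R (S i j + S j i))"
    by (simp only: sum.distrib[symmetric] scaleR_add_right mult.commute)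
  also have "\<dots> = (\<Sum>j=1..?n. \<Sum>i=1..?n. if i = j then (2 * c * (z $ coord j)\<^sup>2) *\<^sub>R 1 else 0)"
    by (intro sum.cong refl, subst Ssym, assumption, assumption) (simp add: power2_eq_square mult_ac)
  also have "\<dots> = (2 * c * (norm z)\<^sup>2) *\<^sub>R 1"
    by (simp add: norm_sq_eq_sum_coord sum_distrib_left scaleR_sum_left)
  finally show "(\<Sum>j=1..?n. z $ coord j *\<^sub>R kernel_symbol q a b j z) = (c * (norm z)\<^sup>2) *\<^sub>R 1"
    unfolding Q by (rule halve)
  have "kernel_symbol q a b j (axis (coord j :: 'n) 1) = c *\<^sub>R 1" if j: "j \<in> {1..?n}" for j
  proof -
    have "kernel_symbol q a b j (axis (coord j :: 'n) 1) = (\<Sum>i=1..?n. if i = j then S i j else 0)"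
      unfolding kernel_symbol_eq_sum S_def[symmetric]
      by (rule sum.cong[OF refl]) (use j in \<open>auto simp: axis_def coord_eq_iff\<close>)
    also have "\<dots> = S j j" using j by simp
    also have "\<dots> = c *\<^sub>R 1" using halve[of "S j j" 1] Ssym[OF j j] by simp
    finally show ?thesis .
  qed
  then show "(\<Sum>j=1..?n. kernel_symbol q a b j (axis (coord j :: 'n) 1)) = (real ?n * c) *\<^sub>R 1"
    by (simp add: scaleR_conv_of_real mult.commute)
qed

section \<open>Regularising the radial part of the kernel\<close>

text \<open>
  The profile, as a function of \<open>t = \<parallel>z\<parallel>\<^sup>2\<close>, replaces \<open>\<parallel>z\<parallel>\<^sup>-\<^sup>n = t\<^bsup>-n/2\<^esup>\<close> for \<open>t \<le> e\<^sup>2\<close> by its tangent line at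
  \<open>t = e\<^sup>2\<close>, which makes it \<open>C\<^sup>1\<close>. Its derivative is the constant slope up to \<open>e\<^sup>2\<close>, hence the maximum in \<open>profile'\<close>.
\<close>

definition profile :: "real \<Rightarrow> real \<Rightarrow> real \<Rightarrow> real" where
  "profile n e t = (if t \<in> {..e\<^sup>2} then (e\<^sup>2) powr (- n / 2) * (1 + n / 2 * (1 - t / e\<^sup>2)) else t powr (- n / 2))"

definition profile' :: "real \<Rightarrow> real \<Rightarrow> real \<Rightarrow> real" where
  "profile' n e t = (- n / 2) * (max t (e\<^sup>2)) powr (- n / 2 - 1)"

lemma profile_has_derivative:
  assumes e: "0 < e"
  shows "(profile n e has_real_derivative profile' n e t) (at t)"
proof -
  let ?g = "\<lambda>t. (e\<^sup>2) powr (- n / 2) * (1 + n / 2 * (1 - t / e\<^sup>2))"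
  let ?d = "(- n / 2) * (e\<^sup>2) powr (- n / 2 - 1)"
  have e2: "0 < e\<^sup>2" using e by simp
  have cl: "{..e\<^sup>2} \<union> closure {..e\<^sup>2} \<inter> closure {e\<^sup>2<..} = {..e\<^sup>2}"
    "{e\<^sup>2<..} \<union> closure {..e\<^sup>2} \<inter> closure {e\<^sup>2<..} = {e\<^sup>2..}" "{..e\<^sup>2} \<union> {e\<^sup>2<..} = UNIV" by auto
  have "(e\<^sup>2) powr (- n / 2) / e\<^sup>2 = (e\<^sup>2) powr (- n / 2 - 1)"
    using e2 by (simp add: powr_diff)
  then have d1: "(?g has_real_derivative ?d) (at t within A)" for t A
    using e2 by (auto intro!: derivative_eq_intros simp: field_simps)
  have d2: "((\<lambda>t. t powr (- n / 2)) has_real_derivative (- n / 2) * t powr (- n / 2 - 1)) (at t within A)" if "t \<in> {e\<^sup>2..}" for t A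
    by (intro has_field_derivative_at_within[OF has_real_derivative_powr] less_le_trans[OF e2]) (use that in simp)
  have "((\<lambda>t. if t \<in> {..e\<^sup>2} then ?g t else t powr (- n / 2)) has_vector_derivative
      (if t \<in> {..e\<^sup>2} then ?d else (- n / 2) * t powr (- n / 2 - 1))) (at t within ({..e\<^sup>2} \<union> {e\<^sup>2<..}))"
  proof (rule has_vector_derivative_If_within_closures)
    show "t \<in> {..e\<^sup>2} \<union> {e\<^sup>2<..}" by auto
    show "(?g has_vector_derivative ?d) (at t within {..e\<^sup>2} \<union> closure {..e\<^sup>2} \<inter> closure {e\<^sup>2<..})"
      using d1 by (simp only: has_real_derivative_iff_has_vector_derivative)
    show "((\<lambda>t. t powr (- n / 2)) has_vector_derivative (- n / 2) * t powr (- n / 2 - 1))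
        (at t within {e\<^sup>2<..} \<union> closure {..e\<^sup>2} \<inter> closure {e\<^sup>2<..})"
      if "t \<in> {e\<^sup>2<..} \<union> closure {..e\<^sup>2} \<inter> closure {e\<^sup>2<..}"
      using d2[of t] that unfolding cl by (simp only: has_real_derivative_iff_has_vector_derivative)
    show "?g t = t powr (- n / 2)" "?d = (- n / 2) * t powr (- n / 2 - 1)"
      if "t \<in> closure {..e\<^sup>2}" "t \<in> closure {e\<^sup>2<..}"
    proof -
      have "t = e\<^sup>2" using that by auto
      then show "?g t = t powr (- n / 2)" "?d = (- n / 2) * t powr (- n / 2 - 1)" using e2 by simp_all
    qed
  qed (rule refl)
  moreover have "(if t \<in> {..e\<^sup>2} then ?d else (- n / 2) * t powr (- n / 2 - 1)) = profile' n e t"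
    by (auto simp: profile'_def max_def)
  ultimately show ?thesis
    unfolding cl has_real_derivative_iff_has_vector_derivative profile_def[abs_def] by simp
qed

lemma continuous_on_profile': "0 < e \<Longrightarrow> continuous_on A (profile' n e)"
  unfolding profile'_def by (intro continuous_intros) (auto simp: max_def)

lemma continuous_on_profile: "0 < e \<Longrightarrow> continuous_on A (profile n e)"
  using profile_has_derivative DERIV_isCont continuous_at_imp_continuous_on by metis

lemma profile_outside: "0 < e \<Longrightarrow> e \<le> r \<Longrightarrow> profile (real k) e (r\<^sup>2) = inverse (r ^ k)"
proof -
  assume e: "0 < e" "e \<le> r"
  have r: "(r\<^sup>2) powr (- real k / 2) = inverse (r ^ k)"
  proof -
    have "(r\<^sup>2) powr (- real k / 2) = (r powr 2) powr (- real k / 2)" using e by simp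
    also have "\<dots> = r powr (- real k)" by (simp only: powr_powr) simp
    also have "\<dots> = inverse (r ^ k)" using e by (simp add: powr_minus powr_realpow)
    finally show ?thesis .
  qed
  show ?thesis
  proof (cases "r = e")
    case True
    then show ?thesis using r e by (simp add: profile_def)
  next
    case False
    then have "e\<^sup>2 < r\<^sup>2" using e by (simp add: power_strict_mono)
    then show ?thesis using r by (simp add: profile_def)
  qed
qed

text \<open>
  The left side is the divergence of \<open>profile(\<parallel>z\<parallel>\<^sup>2) z\<close> at \<open>t = \<parallel>z\<parallel>\<^sup>2\<close>.
\<close>

lemma profile_divergence:
  assumes "0 < e"
  shows "n * profile n e t + 2 * t * profile' n e t
    = (if t \<le> e\<^sup>2 then (e\<^sup>2) powr (- n / 2) * (n * (1 + n / 2) * (1 - t / e\<^sup>2)) else 0)"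
proof (cases "t \<le> e\<^sup>2")
  case True
  have "(e\<^sup>2) powr (- n / 2 - 1) = (e\<^sup>2) powr (- n / 2) / e\<^sup>2" using assms by (simp add: powr_diff)
  then show ?thesis using True assms by (simp add: profile_def profile'_def field_simps power2_eq_square)
next
  case False
  moreover have "0 < t" using False assms by (meson not_le order_less_trans zero_less_power)
  then have "t powr (- n / 2 - 1) = t powr (- n / 2) / t" by (simp add: powr_diff)
  ultimately show ?thesis using \<open>0 < t\<close> by (simp add: profile_def profile'_def)
qed

lemma integral_scale:
  fixes F :: "'m::euclidean_space \<Rightarrow> real"
  assumes "0 < e" and F: "F \<in> borel_measurable borel"
  shows "(\<integral>y. F y \<partial>lborel) = e ^ DIM('m) * (\<integral>z. F (x + e *\<^sub>R z) \<partial>lborel)"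
proof -
  have m: "(\<lambda>z. x + e *\<^sub>R z) \<in> measurable lborel borel" by measurable
  have "(\<integral>y. F y \<partial>lborel) = (\<integral>y. F y \<partial>density (distr lborel borel (\<lambda>z. x + e *\<^sub>R z)) (\<lambda>_. ennreal (e ^ DIM('m))))"
    using lborel_affine[of e x] assms(1) by simp
  also have "\<dots> = (\<integral>y. e ^ DIM('m) *\<^sub>R F y \<partial>distr lborel borel (\<lambda>z. x + e *\<^sub>R z))"
    using F assms(1) by (intro integral_density) auto
  also have "\<dots> = (\<integral>z. e ^ DIM('m) *\<^sub>R F (x + e *\<^sub>R z) \<partial>lborel)"
    using F m by (intro integral_distr) auto
  finally show ?thesis by simp
qed

text \<open>
  The flux of \<open>z / \<parallel>z\<parallel>\<^sup>n\<close> through a sphere, that is, the area of the unit sphere, written as the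
  integral of the divergence of the regularised field over the unit ball. In this form its positivity is evident
  and it needs no integration in polar coordinates.
\<close>

definition bump_mass :: "'m::euclidean_space itself \<Rightarrow> real" where
  "bump_mass _ = (\<integral>z. indicator (cball 0 1) (z :: 'm) *\<^sub>R (real DIM('m) * (1 + real DIM('m) / 2) * (1 - (norm z)\<^sup>2)) \<partial>lborel)"

text \<open>
  The flux through the sphere of radius \<open>e\<close> does not depend on \<open>e\<close>: scaling to the unit ball produces the factor
  \<open>e\<^sup>n\<close>, which cancels the power of \<open>e\<close> in the profile.
\<close>

lemma integral_profile_divergence:
  fixes x :: "'m::euclidean_space"
  assumes e: "0 < e"
  shows "(\<integral>y. indicator (cball x e) y *\<^sub>R ((e\<^sup>2) powr (- real DIM('m) / 2)
      * (real DIM('m) * (1 + real DIM('m) / 2) * (1 - (norm (y - x))\<^sup>2 / e\<^sup>2))) \<partial>lborel) = bump_mass TYPE('m)"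
proof -
  let ?n = "real DIM('m)"
  let ?\<alpha> = "(e\<^sup>2) powr (- ?n / 2)"
  have "?\<alpha> = (e powr 2) powr (- ?n / 2)" using e by simp
  also have "\<dots> = inverse (e ^ DIM('m))" using e by (simp only: powr_powr) (simp add: powr_minus powr_realpow)
  finally have \<alpha>: "?\<alpha> = inverse (e ^ DIM('m))" .
  have ind: "indicator (cball x e) (x + e *\<^sub>R z) = (indicator (cball 0 1) z :: real)" for z
    using e by (auto simp: indicator_def dist_norm)
  have nrm: "(norm (e *\<^sub>R z))\<^sup>2 / e\<^sup>2 = (norm z)\<^sup>2" for z :: 'm using e by (simp add: power_mult_distrib)
  have "(\<integral>y. indicator (cball x e) y *\<^sub>R (?\<alpha> * (?n * (1 + ?n / 2) * (1 - (norm (y - x))\<^sup>2 / e\<^sup>2))) \<partial>lborel)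
    = e ^ DIM('m) * (\<integral>z. indicator (cball x e) (x + e *\<^sub>R z) *\<^sub>R (?\<alpha> * (?n * (1 + ?n / 2) * (1 - (norm (x + e *\<^sub>R z - x))\<^sup>2 / e\<^sup>2))) \<partial>lborel)"
    by (rule integral_scale[OF e], rule borel_measurable_continuous_on_indicator)
       (use e in \<open>auto intro!: continuous_intros\<close>)
  also have "\<dots> = e ^ DIM('m) * (\<integral>z. ?\<alpha> * (indicator (cball (0 :: 'm) 1) z *\<^sub>R (?n * (1 + ?n / 2) * (1 - (norm z)\<^sup>2))) \<partial>lborel)"
    by (simp only: ind add_diff_cancel_left' nrm real_scaleR_def mult.left_commute)
  also have "\<dots> = bump_mass TYPE('m)" using e unfolding bump_mass_def \<alpha> by simp
  finally show ?thesis .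
qed

lemma bump_mass_pos: "0 < bump_mass TYPE('m::euclidean_space)"
proof -
  let ?n = "real DIM('m)"
  define F where "F z = ?n * (1 + ?n / 2) * (1 - (norm z)\<^sup>2)" for z :: 'm
  have n: "0 < ?n" by simp
  have int: "integrable lborel (\<lambda>z. indicator (cball 0 1) z *\<^sub>R F z)"
    unfolding F_def by (intro borel_integrable_compact continuous_intros) simp
  have "0 < ?n * (1 + ?n / 2) * (3 / 4) * measure lborel (ball (0 :: 'm) (1 / 2))"
    using n content_ball_pos[of "1 / 2" "0 :: 'm"] by simp
  also have "\<dots> = (\<integral>z. indicator (ball (0 :: 'm) (1 / 2)) z *\<^sub>R (?n * (1 + ?n / 2) * (3 / 4)) \<partial>lborel)"
    by simp
  also have "\<dots> \<le> (\<integral>z. indicator (cball 0 1) z *\<^sub>R F z \<partial>lborel)"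
  proof (rule integral_mono[OF _ int])
    show "integrable lborel (\<lambda>z. indicator (ball (0 :: 'm) (1 / 2)) z *\<^sub>R (?n * (1 + ?n / 2) * (3 / 4)))"
      by (intro integrable_scaleR_left integrable_real_indicator) (auto simp: emeasure_ball)
    fix z :: 'm
    show "indicator (ball 0 (1 / 2)) z *\<^sub>R (?n * (1 + ?n / 2) * (3 / 4)) \<le> indicator (cball 0 1) z *\<^sub>R F z"
    proof (cases "z \<in> ball 0 (1 / 2)")
      case True
      then have "(norm z)\<^sup>2 \<le> (1 / 2)\<^sup>2" by (intro power_mono) auto
      then have "?n * (1 + ?n / 2) * (3 / 4) \<le> F z" unfolding F_def by (intro mult_left_mono) (auto simp: power2_eq_square)
      then show ?thesis using True by simp
    next
      case False
      have "0 \<le> F z" if "norm z \<le> 1"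
        using power_mono[OF that norm_ge_zero, of 2] n unfolding F_def by (intro mult_nonneg_nonneg) auto
      then show ?thesis using False by (auto simp: indicator_def)
    qed
  qed
  finally show ?thesis by (simp add: bump_mass_def F_def)
qed

section \<open>The flux of the regularised Cauchy form\<close>

text \<open>
  Where the cutoff does not vanish, the points of the graph lie on the frontier.
\<close>

lemma patch_integrand_cong:
  assumes D: "open D" and ps: "boundary_atlas D ps" "p \<in> set ps"
    and eq: "\<And>y vs. y \<in> frontier D \<Longrightarrow> \<omega> y vs = \<omega>' y vs"
  shows "patch_integrand \<omega> p = patch_integrand \<omega>' p"
proof -
  obtain i s \<gamma> U \<rho> where p: "p = (i, s, \<gamma>, U, \<rho>)" by (rule prod_cases5)
  have g: "graph_patch D i s \<gamma> U" and \<rho>: "closure {y. \<rho> y \<noteq> 0} \<subseteq> U"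
    using ps unfolding p boundary_atlas_def by auto
  have inv: "\<And>x t. \<gamma> (x + t *\<^sub>R axis (coord i) 1) = \<gamma> x"
    and DU: "D \<inter> U = {x \<in> U. s * (x $ coord i - \<gamma> x) < 0}" using g by (auto simp: graph_patch_def)
  have "\<rho> y = 0 \<or> y \<in> frontier D" if "y = graph_map i \<gamma> x" for x y
  proof (cases "y \<in> U")
    case True
    have y0: "y $ coord i - \<gamma> y = 0" unfolding that graph_map_eq by (simp add: inv)
    then have "y \<in> {x. s * (x $ coord i - \<gamma> x) \<le> 0} \<inter> U" using True by simp
    then have "y \<in> closure D" using graph_patch_closure[OF g] by blast
    moreover have "s * (y $ coord i - \<gamma> y) < 0" if "y \<in> D" using DU True that by blast
    then have "y \<notin> D" unfolding y0 by auto
    ultimately show ?thesis using D by (simp add: frontier_def interior_open)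
  next
    case False
    then have "y \<notin> {y. \<rho> y \<noteq> 0}" using \<rho> closure_subset[of "{y. \<rho> y \<noteq> 0}"] by blast
    then show ?thesis by simp
  qed
  note on_frontier = this[OF refl]
  show ?thesis
  proof
    fix u
    show "patch_integrand \<omega> p u = patch_integrand \<omega>' p u"
      using on_frontier[of "hyper i u"] eq[of "graph_map i \<gamma> (hyper i u)"]
      by (auto simp: p patch_integrand_def Let_def)
  qed
qed

lemma flux_eq_integral_divergence:
  fixes h :: "nat \<Rightarrow> real^'n::{finite,wellorder} \<Rightarrow> 'b::euclidean_space"
  assumes D: "open D" "bounded D" and ps: "boundary_atlas D ps"
    and \<omega>: "\<And>y vs. y \<in> frontier D \<Longrightarrow> \<omega> y vs = (\<Sum>j=1..CARD('n). hat_form j (h j) y vs)"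
    and h: "\<And>j. continuous_on (closure D) (h j)" "\<And>j x. x \<in> D \<Longrightarrow> (h j has_derivative h' j x) (at x)"
      "\<And>j v. continuous_on (closure D) (\<lambda>x. h' j x v)"
  shows "\<And>p. p \<in> set ps \<Longrightarrow> integrable (patch_measure p) (patch_integrand \<omega> p)"
    and "(\<Sum>p\<leftarrow>ps. integral\<^sup>L (patch_measure p) (patch_integrand \<omega> p))
      = (\<integral>x. indicator D x *\<^sub>R (\<Sum>j=1..CARD('n). h' j x (axis (coord j) 1)) \<partial>lborel)"
proof -
  let ?J = "{1..CARD('n)}"
  have eq: "patch_integrand \<omega> p = (\<lambda>u. \<Sum>j\<in>?J. patch_integrand (hat_form j (h j)) p u)" if p: "p \<in> set ps" for p
  proof -
    have "patch_integrand \<omega> p = patch_integrand (\<lambda>y vs. \<Sum>j\<in>?J. hat_form j (h j) y vs) p"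
      by (rule patch_integrand_cong[OF D(1) ps p \<omega>])
    also have "\<dots> = (\<lambda>u. \<Sum>j\<in>?J. patch_integrand (hat_form j (h j)) p u)"
      by (cases p) (simp add: patch_integrand_def Let_def scaleR_sum_right)
    finally show ?thesis .
  qed
  have int: "integrable (patch_measure p) (patch_integrand (hat_form j (h j)) p)" if "p \<in> set ps" "j \<in> ?J" for p j
    using divergence_theorem(1)[OF D ps h that(2) that(1)] .
  show "integrable (patch_measure p) (patch_integrand \<omega> p)" if "p \<in> set ps" for p
    unfolding eq[OF that] using int[OF that] by (rule Bochner_Integration.integrable_sum)
  have intD: "integrable lborel (\<lambda>x. indicator D x *\<^sub>R h' j x (axis (coord j) 1))" for j
    by (rule integrable_continuous_bounded_support[OF closed_closure h(3) closure_subset _ D(2)]) (use D(1) in auto)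
  have "(\<Sum>p\<leftarrow>ps. integral\<^sup>L (patch_measure p) (patch_integrand \<omega> p))
    = (\<Sum>p\<leftarrow>ps. \<Sum>j\<in>?J. integral\<^sup>L (patch_measure p) (patch_integrand (hat_form j (h j)) p))"
  proof (rule arg_cong[of _ _ sum_list], rule map_cong[OF refl])
    fix p assume "p \<in> set ps"
    then show "integral\<^sup>L (patch_measure p) (patch_integrand \<omega> p)
      = (\<Sum>j\<in>?J. integral\<^sup>L (patch_measure p) (patch_integrand (hat_form j (h j)) p))"
      unfolding eq[OF \<open>p \<in> set ps\<close>] by (intro Bochner_Integration.integral_sum int)
  qed
  also have "\<dots> = (\<Sum>j\<in>?J. \<Sum>p\<leftarrow>ps. integral\<^sup>L (patch_measure p) (patch_integrand (hat_form j (h j)) p))"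
    by (induction ps) (simp_all add: sum.distrib)
  also have "\<dots> = (\<Sum>j\<in>?J. \<integral>x. indicator D x *\<^sub>R h' j x (axis (coord j) 1) \<partial>lborel)"
    by (intro sum.cong refl divergence_theorem(2)[OF D ps h])
  also have "\<dots> = (\<integral>x. (\<Sum>j\<in>?J. indicator D x *\<^sub>R h' j x (axis (coord j) 1)) \<partial>lborel)"
    by (rule Bochner_Integration.integral_sum[symmetric]) (rule intD)
  also have "\<dots> = (\<integral>x. indicator D x *\<^sub>R (\<Sum>j\<in>?J. h' j x (axis (coord j) 1)) \<partial>lborel)"
    by (simp only: scaleR_sum_right)
  finally show "(\<Sum>p\<leftarrow>ps. integral\<^sup>L (patch_measure p) (patch_integrand \<omega> p))
      = (\<integral>x. indicator D x *\<^sub>R (\<Sum>j=1..CARD('n). h' j x (axis (coord j) 1)) \<partial>lborel)" .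
qed

lemma cauchy_form_eq_sum_hat_form:
  fixes x y :: "real^'n::{finite,wellorder}"
  assumes "0 < e" "e \<le> norm (y - x)"
  shows "cauchy_form q a b f x y vs
    = (\<Sum>j=1..CARD('n). hat_form j (\<lambda>y. profile (real CARD('n)) e ((norm (y - x))\<^sup>2) *\<^sub>R (f y * kernel_symbol q a b j (y - x))) y vs)"
proof -
  define N where "N = inverse (norm (y - x) ^ CARD('n))"
  define \<sigma> where "\<sigma> j = (- 1) ^ (j - 1) * dhat j vs" for j
  have phi: "phi b m x y = (\<Sum>i=1..CARD('n). (y - x) $ coord i *\<^sub>R b i m)" for m by (simp add: phi_def)
  have "cauchy_form q a b f x y vs = f y * (\<Sum>m=1..q. \<Sum>j=1..CARD('n). \<sigma> j *\<^sub>R (a j m * (N *\<^sub>R phi b m x y)))"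
    by (simp only: cauchy_form_def \<sigma>_def N_def)
  also have "\<dots> = f y * (\<Sum>j=1..CARD('n). \<Sum>m=1..q. \<sigma> j *\<^sub>R (a j m * (N *\<^sub>R phi b m x y)))"
    by (subst sum.swap) (rule refl)
  also have "\<dots> = (\<Sum>j=1..CARD('n). \<sigma> j *\<^sub>R (N *\<^sub>R (f y * kernel_symbol q a b j (y - x))))"
    unfolding kernel_symbol_def phi
    by (simp only: sum_distrib_left scaleR_sum_right mult_scaleR_right)
  finally show ?thesis using profile_outside[OF assms, of "CARD('n)"] by (simp add: hat_form_def \<sigma>_def N_def)
qed

section \<open>The integral representation\<close>

lemma weighted_average_close:
  fixes f :: "'m::euclidean_space \<Rightarrow> 'b::euclidean_space"
  assumes e: "0 < e" and f: "continuous_on (cball x e) f" and W: "continuous_on (cball x e) W" "\<And>y. y \<in> cball x e \<Longrightarrow> 0 \<le> W y"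
    and mass: "(\<integral>y. indicator (cball x e) y *\<^sub>R W y \<partial>lborel) = \<kappa>" and \<kappa>: "0 < \<kappa>"
    and close: "\<And>y. y \<in> cball x e \<Longrightarrow> norm (f y - c) \<le> \<delta>"
  shows "norm ((\<integral>y. indicator (cball x e) y *\<^sub>R ((1 / \<kappa> * W y) *\<^sub>R f y) \<partial>lborel) - c) \<le> \<delta>"
proof -
  let ?I = "\<lambda>y. indicator (cball x e) y :: real"
  have i1: "integrable lborel (\<lambda>y. ?I y *\<^sub>R (W y *\<^sub>R f y))"
    by (intro borel_integrable_compact continuous_intros f W) simp
  have i2: "integrable lborel (\<lambda>y. ?I y *\<^sub>R W y)"
    by (intro borel_integrable_compact W) simp
  have i3: "integrable lborel (\<lambda>y. ?I y *\<^sub>R (W y *\<^sub>R (f y - c)))"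
    by (intro borel_integrable_compact continuous_intros f W) simp
  have "(\<integral>y. ?I y *\<^sub>R (W y *\<^sub>R (f y - c)) \<partial>lborel)
    = (\<integral>y. ?I y *\<^sub>R (W y *\<^sub>R f y) - (?I y *\<^sub>R W y) *\<^sub>R c \<partial>lborel)" by (simp add: algebra_simps)
  also have "\<dots> = (\<integral>y. ?I y *\<^sub>R (W y *\<^sub>R f y) \<partial>lborel) - (\<integral>y. ?I y *\<^sub>R W y \<partial>lborel) *\<^sub>R c"
    using i1 i2 by (subst Bochner_Integration.integral_diff) auto
  finally have "(\<integral>y. ?I y *\<^sub>R (W y *\<^sub>R f y) \<partial>lborel) = \<kappa> *\<^sub>R c + (\<integral>y. ?I y *\<^sub>R (W y *\<^sub>R (f y - c)) \<partial>lborel)"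
    unfolding mass by simp
  then have e1: "(1 / \<kappa>) *\<^sub>R (\<integral>y. ?I y *\<^sub>R (W y *\<^sub>R f y) \<partial>lborel) - c
    = (1 / \<kappa>) *\<^sub>R (\<integral>y. ?I y *\<^sub>R (W y *\<^sub>R (f y - c)) \<partial>lborel)" using \<kappa> by (simp add: scaleR_add_right)
  have e2: "(\<integral>y. ?I y *\<^sub>R ((1 / \<kappa> * W y) *\<^sub>R f y) \<partial>lborel) = (1 / \<kappa>) *\<^sub>R (\<integral>y. ?I y *\<^sub>R (W y *\<^sub>R f y) \<partial>lborel)"
    by (subst integral_scaleR_right[symmetric]) (simp add: mult_ac)
  have e3: "norm (\<integral>y. ?I y *\<^sub>R (W y *\<^sub>R (f y - c)) \<partial>lborel) \<le> \<kappa> * \<delta>"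
  proof -
    have "norm (\<integral>y. ?I y *\<^sub>R (W y *\<^sub>R (f y - c)) \<partial>lborel) \<le> (\<integral>y. norm (?I y *\<^sub>R (W y *\<^sub>R (f y - c))) \<partial>lborel)"
      by (rule integral_norm_bound)
    also have "\<dots> \<le> (\<integral>y. (?I y *\<^sub>R W y) * \<delta> \<partial>lborel)"
    proof (rule integral_mono)
      show "integrable lborel (\<lambda>y. norm (?I y *\<^sub>R (W y *\<^sub>R (f y - c))))" using i3 by (rule integrable_norm)
      show "integrable lborel (\<lambda>y. (?I y *\<^sub>R W y) * \<delta>)" using i2 by (rule integrable_mult_left)
      show "norm (?I y *\<^sub>R (W y *\<^sub>R (f y - c))) \<le> (?I y *\<^sub>R W y) * \<delta>" for y
        using W(2)[of y] close[of y] by (cases "y \<in> cball x e") (simp_all add: mult_left_mono)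
    qed
    also have "\<dots> = (\<integral>y. ?I y *\<^sub>R W y \<partial>lborel) * \<delta>" by (rule integral_mult_left_zero)
    also have "\<dots> = \<kappa> * \<delta>" unfolding mass ..
    finally show ?thesis .
  qed
  have "norm ((1 / \<kappa>) *\<^sub>R (\<integral>y. ?I y *\<^sub>R (W y *\<^sub>R (f y - c)) \<partial>lborel))
    = norm (\<integral>y. ?I y *\<^sub>R (W y *\<^sub>R (f y - c)) \<partial>lborel) / \<kappa>" using \<kappa> by simp
  also have "\<dots> \<le> \<kappa> * \<delta> / \<kappa>" using e3 \<kappa> by (intro divide_right_mono) auto
  also have "\<dots> = \<delta>" using \<kappa> by simp
  finally show ?thesis unfolding e2 e1 .
qed

text \<open>
  Outside the ball the regularised kernel agrees with the Cauchy kernel, so the boundary integral is the integral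
  of the divergence of the regularised field. In that divergence the derivatives of \<open>f\<close> cancel by the
  Cauchy-Riemann equations, and the rest is \<open>c\<close> times the divergence of the regularised radial field.
\<close>

lemma cauchy_flux:
  fixes a b :: "nat \<Rightarrow> nat \<Rightarrow> 'a::{comm_ring_1, real_algebra_1, euclidean_space}" and c :: real
    and f :: "real^'n::{finite,wellorder} \<Rightarrow> 'a"
  assumes sym: "\<And>i j. i \<in> {1..CARD('n)} \<Longrightarrow> j \<in> {1..CARD('n)} \<Longrightarrow>
      (\<Sum>m=1..q. a j m * b i m) + (\<Sum>m=1..q. a i m * b j m) = (if i = j then (2 * c) *\<^sub>R 1 else 0)"
    and D: "open D" "bounded D" and ps: "boundary_atlas D ps"
    and f: "C1_on_closure D f" "CR_solution q a D f"
    and e: "0 < e" "cball x e \<subseteq> D"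
  shows "\<And>p. p \<in> set ps \<Longrightarrow> integrable (patch_measure p) (patch_integrand (cauchy_form q a b f x) p)"
    and "(\<Sum>p\<leftarrow>ps. integral\<^sup>L (patch_measure p) (patch_integrand (cauchy_form q a b f x) p))
      = (\<integral>y. indicator (cball x e) y *\<^sub>R ((c * ((e\<^sup>2) powr (- real CARD('n) / 2)
          * (real CARD('n) * (1 + real CARD('n) / 2) * (1 - (norm (y - x))\<^sup>2 / e\<^sup>2)))) *\<^sub>R f y) \<partial>lborel)"
proof -
  let ?n = "real CARD('n)"
  let ?K = "\<lambda>j. kernel_symbol q a b j :: real^'n::_ \<Rightarrow> 'a"
  obtain f' where f': "\<And>y. y \<in> D \<Longrightarrow> (f has_derivative f' y) (at y)"
      "\<And>v. continuous_on (closure D) (\<lambda>y. f' y v)" and cf: "continuous_on (closure D) f"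
    using f(1) by (auto simp: C1_on_closure_def)
  define H where "H j y = profile ?n e ((norm (y - x))\<^sup>2) *\<^sub>R (f y * ?K j (y - x))" for j y
  define H' where "H' j y v = profile ?n e ((norm (y - x))\<^sup>2) *\<^sub>R (f y * ?K j v + f' y v * ?K j (y - x))
      + (2 * ((y - x) \<bullet> v) * profile' ?n e ((norm (y - x))\<^sup>2)) *\<^sub>R (f y * ?K j (y - x))" for j y v
  note bb = bounded_bilinear_algebra_mult[where 'a = 'a]
  have blK: "bounded_linear (?K j)" for j
    using linear_kernel_symbol linear_conv_bounded_linear by blast
  have cK: "continuous_on A (\<lambda>y. ?K j (y - x))" for A j
    by (intro bounded_linear.continuous_on[OF blK] continuous_intros)
  have cp: "continuous_on A (\<lambda>y. profile ?n e ((norm (y - x))\<^sup>2))" for A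
    by (rule continuous_on_compose2[OF continuous_on_profile[OF e(1), of UNIV]]) (auto intro!: continuous_intros)
  have cp': "continuous_on A (\<lambda>y. profile' ?n e ((norm (y - x))\<^sup>2))" for A
    by (rule continuous_on_compose2[OF continuous_on_profile'[OF e(1), of UNIV]]) (auto intro!: continuous_intros)
  have cH: "continuous_on (closure D) (H j)" for j
    unfolding H_def by (intro continuous_on_scaleR cp bounded_bilinear.continuous_on[OF bb] cf cK)
  have cH': "continuous_on (closure D) (\<lambda>y. H' j y v)" for j v
    unfolding H'_def
    by (intro continuous_on_add continuous_on_scaleR cp cp' bounded_bilinear.continuous_on[OF bb] cf f' cK continuous_intros)
  have dH: "(H j has_derivative H' j y) (at y)" if "y \<in> D" for j y
  proof -
    have dK: "((\<lambda>y. ?K j (y - x)) has_derivative ?K j) (at y)"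
      by (rule has_derivative_compose[of "\<lambda>y. y - x" "\<lambda>v. v" y UNIV, OF _ bounded_linear_imp_has_derivative[OF blK]])
         (auto intro!: derivative_eq_intros)
    have dN: "((\<lambda>y. (norm (y - x))\<^sup>2) has_derivative (\<lambda>v. 2 * ((y - x) \<bullet> v))) (at y)"
      unfolding power2_norm_eq_inner by (auto intro!: derivative_eq_intros simp: inner_commute)
    have dp: "((\<lambda>y. profile ?n e ((norm (y - x))\<^sup>2)) has_derivative
        (\<lambda>v. profile' ?n e ((norm (y - x))\<^sup>2) * (2 * ((y - x) \<bullet> v)))) (at y)"
      by (rule has_derivative_compose[OF dN profile_has_derivative[OF e(1), unfolded has_field_derivative_def]])
    have "(H j has_derivative (\<lambda>v. profile ?n e ((norm (y - x))\<^sup>2) *\<^sub>R (f y * ?K j v + f' y v * ?K j (y - x))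
        + (profile' ?n e ((norm (y - x))\<^sup>2) * (2 * ((y - x) \<bullet> v))) *\<^sub>R (f y * ?K j (y - x)))) (at y)"
      unfolding H_def
      by (rule has_derivative_scaleR[OF dp bounded_bilinear.FDERIV[OF bb f'(1)[OF that] dK]])
    then show ?thesis unfolding H'_def by (simp only: mult.commute)
  qed
  have frontier: "cauchy_form q a b f x y vs = (\<Sum>j=1..CARD('n). hat_form j (H j) y vs)" if "y \<in> frontier D" for y vs
  proof -
    have "y \<notin> cball x e" using that e(2) D(1) by (auto simp: frontier_def interior_open)
    then have "e \<le> norm (y - x)" by (simp add: dist_norm norm_minus_commute)
    then show ?thesis unfolding H_def by (rule cauchy_form_eq_sum_hat_form[OF e(1)])
  qed
  note flux = flux_eq_integral_divergence[OF D ps frontier cH dH cH']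
  show "\<And>p. p \<in> set ps \<Longrightarrow> integrable (patch_measure p) (patch_integrand (cauchy_form q a b f x) p)"
    by (rule flux(1))
  let ?W = "\<lambda>y. (e\<^sup>2) powr (- ?n / 2) * (?n * (1 + ?n / 2) * (1 - (norm (y - x))\<^sup>2 / e\<^sup>2))"
  have div: "(\<Sum>j=1..CARD('n). H' j y (axis (coord j) 1)) = (c * (if (norm (y - x))\<^sup>2 \<le> e\<^sup>2 then ?W y else 0)) *\<^sub>R f y"
    if y: "y \<in> D" for y
  proof -
    define z where "z = y - x"
    define r where "r = (norm z)\<^sup>2"
    let ?e = "\<lambda>j. axis (coord j) 1 :: real^'n::_"
    have CR: "(\<Sum>j=1..CARD('n). f' y (?e j) * ?K j z) = 0"
    proof -
      have pd: "pdiff j f y = f' y (?e j)" for j by (rule pdiff_eqI[OF f'(1)[OF y]])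
      have CRm: "(\<Sum>j=1..CARD('n). f' y (?e j) * a j m) = 0" if "m \<in> {1..q}" for m
      proof -
        have "(\<Sum>j=1..CARD('n). pdiff j f y * a j m) = 0"
          using f(2) y that unfolding CR_solution_def by blast
        then show ?thesis by (simp only: pd)
      qed
      have "(\<Sum>j=1..CARD('n). f' y (?e j) * ?K j z)
        = (\<Sum>j=1..CARD('n). \<Sum>m=1..q. (f' y (?e j) * a j m) * (\<Sum>i=1..CARD('n). z $ coord i *\<^sub>R b i m))"
        by (simp only: kernel_symbol_def sum_distrib_left[of "f' y _"] mult.assoc)
      also have "\<dots> = (\<Sum>m=1..q. (\<Sum>j=1..CARD('n). f' y (?e j) * a j m) * (\<Sum>i=1..CARD('n). z $ coord i *\<^sub>R b i m))"
        by (subst sum.swap) (simp only: sum_distrib_right)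
      also have "\<dots> = 0" by (rule sum.neutral) (intro ballI, simp only: CRm mult_zero_left)
      finally show ?thesis .
    qed
    have radial: "(\<Sum>j=1..CARD('n). z $ coord j *\<^sub>R ?K j z) = (c * r) *\<^sub>R 1"
      unfolding r_def by (rule radial_kernel_symbol) (rule sym)
    have div_const: "(\<Sum>j=1..CARD('n). ?K j (?e j)) = (?n * c) *\<^sub>R 1"
      by (rule div_kernel_symbol) (rule sym)
    have "(\<Sum>j=1..CARD('n). H' j y (?e j))
      = profile ?n e r *\<^sub>R (f y * (\<Sum>j=1..CARD('n). ?K j (?e j))) + profile ?n e r *\<^sub>R (\<Sum>j=1..CARD('n). f' y (?e j) * ?K j z)
        + (2 * profile' ?n e r) *\<^sub>R (f y * (\<Sum>j=1..CARD('n). z $ coord j *\<^sub>R ?K j z))"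
      unfolding H'_def z_def[symmetric] r_def[symmetric]
      by (simp add: inner_axis sum.distrib scaleR_add_right scaleR_sum_right sum_distrib_left mult_ac)
    also have "\<dots> = (c * (?n * profile ?n e r + 2 * r * profile' ?n e r)) *\<^sub>R f y"
      unfolding CR radial div_const by (simp add: scaleR_add_left[symmetric] distrib_left mult_ac)
    also have "\<dots> = (c * (if r \<le> e\<^sup>2 then (e\<^sup>2) powr (- ?n / 2) * (?n * (1 + ?n / 2) * (1 - r / e\<^sup>2)) else 0)) *\<^sub>R f y"
      unfolding profile_divergence[OF e(1)] ..
    finally show ?thesis by (simp only: r_def z_def)
  qed
  have "(\<Sum>p\<leftarrow>ps. integral\<^sup>L (patch_measure p) (patch_integrand (cauchy_form q a b f x) p))
    = (\<integral>y. indicator D y *\<^sub>R (\<Sum>j=1..CARD('n). H' j y (axis (coord j) 1)) \<partial>lborel)" by (rule flux(2))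
  also have "\<dots> = (\<integral>y. indicator (cball x e) y *\<^sub>R ((c * ?W y) *\<^sub>R f y) \<partial>lborel)"
  proof (rule Bochner_Integration.integral_cong[OF refl])
    fix y
    have iff: "(norm (y - x))\<^sup>2 \<le> e\<^sup>2 \<longleftrightarrow> y \<in> cball x e"
      using e(1) by (simp add: dist_norm norm_minus_commute abs_le_square_iff[symmetric])
    show "indicator D y *\<^sub>R (\<Sum>j=1..CARD('n). H' j y (axis (coord j) 1)) = indicator (cball x e) y *\<^sub>R ((c * ?W y) *\<^sub>R f y)"
    proof (cases "y \<in> D")
      case True
      then show ?thesis unfolding div[OF True] iff by (cases "y \<in> cball x e") simp_all
    next
      case False
      then have "y \<notin> cball x e" using e(2) by blast
      then show ?thesis using False by simp
    qed
  qed
  finally show "(\<Sum>p\<leftarrow>ps. integral\<^sup>L (patch_measure p) (patch_integrand (cauchy_form q a b f x) p))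
      = (\<integral>y. indicator (cball x e) y *\<^sub>R ((c * ?W y) *\<^sub>R f y) \<partial>lborel)" .
qed

text \<open>
  The boundary integral is the average of \<open>f\<close> over an arbitrarily small ball around \<open>x\<close> with respect to a nonnegative
  weight of mass \<open>1\<close>, and \<open>f\<close> is continuous at \<open>x\<close>.
\<close>

lemma cauchy_formula:
  fixes a b :: "nat \<Rightarrow> nat \<Rightarrow> 'a::{comm_ring_1, real_algebra_1, euclidean_space}"
    and f :: "real^'n::{finite,wellorder} \<Rightarrow> 'a"
  assumes sym: "\<And>i j. i \<in> {1..CARD('n)} \<Longrightarrow> j \<in> {1..CARD('n)} \<Longrightarrow>
      (\<Sum>m=1..q. a j m * b i m) + (\<Sum>m=1..q. a i m * b j m)
        = (if i = j then (2 * (1 / bump_mass TYPE(real^'n::_))) *\<^sub>R 1 else 0)"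
    and D: "smooth_domain D" and f: "C1_on_closure D f" "CR_solution q a D f" and x: "x \<in> D"
  shows "(cauchy_form q a b f x has_boundary_integral f x) D"
proof -
  let ?n = "real CARD('n)"
  let ?\<kappa> = "bump_mass TYPE(real^'n::_)"
  have D': "open D" "bounded D" "smooth_boundary D" using D by (auto simp: smooth_domain_def)
  obtain f' where f': "(f has_derivative f') (at x)" using f(1) x by (auto simp: C1_on_closure_def)
  have cf: "continuous_on (closure D) f" using f(1) by (simp add: C1_on_closure_def)
  obtain e0 where e0: "0 < e0" "cball x e0 \<subseteq> D" using D'(1) x open_contains_cball by blast
  show ?thesis
    unfolding has_boundary_integral_def
  proof (intro conjI allI impI ballI)
    show "\<exists>ps. boundary_atlas D ps" by (rule ex_boundary_atlas[OF D'(2,3)])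
  next
    fix ps p assume ps: "boundary_atlas D ps" and "p \<in> set ps"
    then show "integrable (patch_measure p) (patch_integrand (cauchy_form q a b f x) p)"
      using cauchy_flux(1)[OF sym D'(1,2) ps f e0] by blast
  next
    fix ps assume ps: "boundary_atlas D ps"
    define T where "T = (\<Sum>p\<leftarrow>ps. integral\<^sup>L (patch_measure p) (patch_integrand (cauchy_form q a b f x) p))"
    have "norm (T - f x) \<le> \<delta>" if "0 < \<delta>" for \<delta>
    proof -
      have "continuous (at x) f" using f' by (rule has_derivative_continuous)
      then have "\<exists>d>0. \<forall>y. dist y x < d \<longrightarrow> dist (f y) (f x) < \<delta>"
        using \<open>0 < \<delta>\<close> by (simp add: continuous_at_eps_delta)
      then obtain d where d: "0 < d" "\<And>y. dist y x < d \<Longrightarrow> dist (f y) (f x) < \<delta>" by blast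
      define e where "e = min e0 (d / 2)"
      have e: "0 < e" "cball x e \<subseteq> D" using e0 d(1) by (auto simp: e_def)
      let ?W = "\<lambda>y. (e\<^sup>2) powr (- ?n / 2) * (?n * (1 + ?n / 2) * (1 - (norm (y - x))\<^sup>2 / e\<^sup>2))"
      have "T = (\<integral>y. indicator (cball x e) y *\<^sub>R ((1 / ?\<kappa> * ?W y) *\<^sub>R f y) \<partial>lborel)"
        unfolding T_def by (rule cauchy_flux(2)[OF sym D'(1,2) ps f e])
      moreover have "norm ((\<integral>y. indicator (cball x e) y *\<^sub>R ((1 / ?\<kappa> * ?W y) *\<^sub>R f y) \<partial>lborel) - f x) \<le> \<delta>"
      proof (rule weighted_average_close[OF e(1)])
        show "continuous_on (cball x e) f"
          using e(2) closure_subset[of D] by (intro continuous_on_subset[OF cf]) blast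
        show "continuous_on (cball x e) ?W" using e(1) by (intro continuous_intros) simp
        show "(\<integral>y. indicator (cball x e) y *\<^sub>R ?W y \<partial>lborel) = ?\<kappa>"
          using integral_profile_divergence[OF e(1), of x] by simp
        show "0 < ?\<kappa>" by (rule bump_mass_pos)
        fix y assume y: "y \<in> cball x e"
        then have "norm (y - x) \<le> e" by (simp add: dist_norm norm_minus_commute)
        then have "(norm (y - x))\<^sup>2 \<le> e\<^sup>2" by (intro power_mono) auto
        then show "0 \<le> ?W y" using e(1) by (intro mult_nonneg_nonneg) auto
        have "dist y x < d" using y d(1) by (auto simp: e_def dist_commute)
        then show "norm (f y - f x) \<le> \<delta>" using d(2)[of y] by (simp add: dist_norm)
      qed
      ultimately show ?thesis by simp
    qed
    then have "norm (T - f x) \<le> 0" by (rule field_le_epsilon[of _ 0, simplified])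
    then show "(\<Sum>p\<leftarrow>ps. integral\<^sup>L (patch_measure p) (patch_integrand (cauchy_form q a b f x) p)) = f x"
      by (simp add: T_def)
  qed
qed

theorem mainTheorem1:
  fixes a :: "nat \<Rightarrow> nat \<Rightarrow> 'a::{comm_ring_1, real_algebra_1, euclidean_space}"
    and q :: nat
  assumes "1 \<le> q" and "q \<le> CARD('n::{finite,wellorder})"
    and "D0 q a dvd 1"
    and "\<forall>k\<in>{1..CARD('n) - q}. \<forall>l\<in>{1..CARD('n) - q}.
           (\<Sum>m=1..q. Dkm q a l m * Dkm q a k m) + (if l = k then 1 else 0) * (D0 q a)\<^sup>2 = 0"
  shows "admits_integral_representation TYPE('n) q a"
proof -
  obtain B where B: "\<And>i j. i \<in> {1..CARD('n)} \<Longrightarrow> j \<in> {1..CARD('n)} \<Longrightarrow>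
    (\<Sum>m=1..q. a j m * B i m) + (\<Sum>m=1..q. a i m * B j m) = (if i = j then 2 else 0)"
    using ex_conjugate_coefficients[OF assms(2-4)] by blast
  define \<kappa> where "\<kappa> = bump_mass TYPE(real^'n::_)"
  define b where "b i m = (1 / \<kappa>) *\<^sub>R B i m" for i m
  have "(\<Sum>m=1..q. a j m * b i m) + (\<Sum>m=1..q. a i m * b j m) = (if i = j then (2 * (1 / \<kappa>)) *\<^sub>R 1 else 0)"
    if "i \<in> {1..CARD('n)}" "j \<in> {1..CARD('n)}" for i j
  proof -
    have "(\<Sum>m=1..q. a j m * b i m) + (\<Sum>m=1..q. a i m * b j m)
      = (1 / \<kappa>) *\<^sub>R ((\<Sum>m=1..q. a j m * B i m) + (\<Sum>m=1..q. a i m * B j m))"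
      by (simp only: b_def mult_scaleR_right scaleR_sum_right scaleR_add_right)
    also have "\<dots> = (if i = j then (2 * (1 / \<kappa>)) *\<^sub>R 1 else 0)"
    proof -
      have "(1 / \<kappa>) *\<^sub>R (2 :: 'a) = (1 / \<kappa>) *\<^sub>R (2 *\<^sub>R 1)" using scaleR_2[of "1 :: 'a"] by simp
      then show ?thesis unfolding B[OF that] by simp
    qed
    finally show ?thesis .
  qed
  then show ?thesis
    unfolding admits_integral_representation_def \<kappa>_def
    by (intro exI[of _ b] allI impI ballI cauchy_formula)
qed

end
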